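(* Let $R$ be a reduced commutative unital ring whose set $\mathrm{min}(R)$ of minimal prime ideals is finite. Then the following are equivalent. (1) $R^+$ exists, i.e., the absolute integral closure of $R$ is uniquely determined (up to isomorphism of $R$-algebras). (2) $R$ is a finite direct product of integral domains.
   Context: All rings are commutative and unital; the trivial ring is allowed, and is the direct product of the empty family of domains. A ring extension $R\subseteq S$ is tight if every non-zero ideal of $S$ has non-zero intersection with $R$. A ring $S$ is absolutely integrally closed (ai closed) if every monic polynomial in $S[X]$ factorizes as a product of monic linear polynomials in $S[X]$ (uniqueness of the factorization is not required). An absolute integral closure (aic) of $R$ is an extension ring $S\supseteq R$ that is ai closed, integral over $R$ and tight over $R$. Every ring has an aic. If all aics of $R$ are isomorphic as $R$-algebras, the unique aic is denoted $R^+$ and one says that $R^+$ exists. *)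

theory Defs
  imports
    "HOL-Algebra.UnivPoly"
    "HOL-Algebra.Chinese_Remainder"
    "HOL-Library.Equipollence"
begin

definition reduced_ring :: "('a, 'm) ring_scheme \<Rightarrow> bool"
  where "reduced_ring R \<longleftrightarrow>
    (\<forall>x \<in> carrier R. \<forall>n::nat. x [^]\<^bsub>R\<^esub> n = \<zero>\<^bsub>R\<^esub> \<longrightarrow> x = \<zero>\<^bsub>R\<^esub>)"

definition min_primes :: "('a, 'm) ring_scheme \<Rightarrow> 'a set set"
  where "min_primes R =
    {P. primeideal P R \<and> (\<forall>Q. primeideal Q R \<longrightarrow> Q \<subseteq> P \<longrightarrow> Q = P)}"

text \<open>Over the trivial ring the only polynomial, zero, is monic in the following sense, and
  it is the empty product; so the trivial ring is absolutely integrally closed below, and it is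
  integral over itself.\<close>

definition monic_poly :: "('a, 'm) ring_scheme \<Rightarrow> (nat \<Rightarrow> 'a) \<Rightarrow> bool"
  where "monic_poly R p \<longleftrightarrow>
    p \<in> carrier (UP R) \<and> coeff (UP R) p (deg R p) = \<one>\<^bsub>R\<^esub>"

definition ai_closed :: "('a, 'm) ring_scheme \<Rightarrow> bool"
  where "ai_closed S \<longleftrightarrow>
    (\<forall>p. monic_poly S p \<longrightarrow>
      (\<exists>(n::nat) a. a \<in> {..<n} \<rightarrow> carrier S \<and>
        p = (\<Otimes>\<^bsub>UP S\<^esub>i\<in>{..<n}.
              monom (UP S) \<one>\<^bsub>S\<^esub> 1 \<ominus>\<^bsub>UP S\<^esub> monom (UP S) (a i) 0)))"

text \<open>An extension of \<open>R\<close> is a ring \<open>S\<close> together with an injective ring homomorphism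
  \<open>\<phi>\<close> from \<open>R\<close> to \<open>S\<close>, which takes the place of the inclusion.\<close>

definition ring_extension ::
    "('a, 'm) ring_scheme \<Rightarrow> ('b, 'n) ring_scheme \<Rightarrow> ('a \<Rightarrow> 'b) \<Rightarrow> bool"
  where "ring_extension R S \<phi> \<longleftrightarrow> ring_hom_cring R S \<phi> \<and> inj_on \<phi> (carrier R)"

definition integral_extension ::
    "('a, 'm) ring_scheme \<Rightarrow> ('b, 'n) ring_scheme \<Rightarrow> ('a \<Rightarrow> 'b) \<Rightarrow> bool"
  where "integral_extension R S \<phi> \<longleftrightarrow>
    ring_extension R S \<phi> \<and>
    (\<forall>s \<in> carrier S. \<exists>p. monic_poly R p \<and> eval R S \<phi> s p = \<zero>\<^bsub>S\<^esub>)"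

definition tight_extension ::
    "('a, 'm) ring_scheme \<Rightarrow> ('b, 'n) ring_scheme \<Rightarrow> ('a \<Rightarrow> 'b) \<Rightarrow> bool"
  where "tight_extension R S \<phi> \<longleftrightarrow>
    ring_extension R S \<phi> \<and>
    (\<forall>J. ideal J S \<longrightarrow> J \<noteq> {\<zero>\<^bsub>S\<^esub>} \<longrightarrow> J \<inter> \<phi> ` carrier R \<noteq> {\<zero>\<^bsub>S\<^esub>})"

definition is_aic ::
    "('a, 'm) ring_scheme \<Rightarrow> ('b, 'n) ring_scheme \<Rightarrow> ('a \<Rightarrow> 'b) \<Rightarrow> bool"
  where "is_aic R S \<phi> \<longleftrightarrow>
    ai_closed S \<and> integral_extension R S \<phi> \<and> tight_extension R S \<phi>"

definition algebra_isomorphic ::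
    "('a, 'm) ring_scheme \<Rightarrow> ('b, 'n) ring_scheme \<Rightarrow> ('a \<Rightarrow> 'b) \<Rightarrow>
      ('c, 'k) ring_scheme \<Rightarrow> ('a \<Rightarrow> 'c) \<Rightarrow> bool"
  where "algebra_isomorphic R S \<phi> T \<psi> \<longleftrightarrow>
    (\<exists>h \<in> ring_iso S T. \<forall>r \<in> carrier R. h (\<phi> r) = \<psi> r)"

text \<open>HOL cannot quantify over all types, so the absolute integral closures considered are
  those whose elements live in a given type \<open>'b\<close>. This is only meaningful when \<open>'b\<close> is
  large enough to accommodate them. The existence conjunct excludes that uniqueness holds
  vacuously.\<close>

definition aic_exists_uniquely :: "'b itself \<Rightarrow> ('a, 'm) ring_scheme \<Rightarrow> bool"
  where "aic_exists_uniquely (_ :: 'b itself) R \<longleftrightarrow>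
    (\<exists>(S :: 'b ring) \<phi>. is_aic R S \<phi>) \<and>
    (\<forall>(S :: 'b ring) \<phi> (T :: 'b ring) \<psi>.
      is_aic R S \<phi> \<longrightarrow> is_aic R T \<psi> \<longrightarrow> algebra_isomorphic R S \<phi> T \<psi>)"

text \<open>Each factor of a direct product is isomorphic to a ring whose carrier is an ideal of the
  product, so it is no restriction that the factors live in the same type as \<open>R\<close>. The product
  of the empty list is the trivial ring.\<close>

definition finite_product_of_domains :: "('a, 'm) ring_scheme \<Rightarrow> bool"
  where "finite_product_of_domains R \<longleftrightarrow>
    (\<exists>Ds :: 'a ring list. (\<forall>D \<in> set Ds. domain D) \<and> R \<simeq> RDirProd_list Ds)"

end

theory Submission
  imports Defs "HOL-Algebra.Algebraic_Closure"
begin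

text \<open>Let \<open>S\<^sub>P\<close> be the integral closure of \<open>R/P\<close> in an algebraically closed field. For a finite
  antichain \<open>I\<close> of primes with zero intersection, \<open>W = \<Prod>\<^sub>P S\<^sub>P\<close> is an absolute integral closure of
  \<open>R\<close>: integral elements of a factor have non-zero multiples in \<open>R/P\<close>, and these can be moved into
  \<open>R\<close> by an element that avoids \<open>P\<close> and lies in all other members of \<open>I\<close>. The key tool is that a ring
  integral over \<open>R\<close> maps over \<open>R\<close> to every absolutely integrally closed domain over \<open>R\<close> whose kernel
  contains its kernel (lying over, then Zorn).

  If \<open>R\<close> is a finite product of domains, take for \<open>I\<close> the kernels of the projections. Every absolute
  integral closure maps to \<open>W\<close>; the map is injective by tightness and surjective because \<open>R\<close> has the
  necessary idempotents.

  Otherwise take the minimal primes for \<open>I\<close>; two of them, \<open>P\<close> and \<open>Q\<close>, lie in a common prime \<open>M\<close>.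
  Both \<open>S\<^sub>P\<close> and \<open>S\<^sub>Q\<close> map to an absolute integral closure \<open>k\<close> of \<open>R/M\<close>, and the elements of \<open>W\<close>
  whose components at \<open>P\<close> and \<open>Q\<close> agree in \<open>k\<close> form another absolute integral closure, because a root
  at \<open>P\<close> can be matched by a root at \<open>Q\<close>. It does not contain the idempotent of \<open>W\<close> supported at \<open>P\<close>,
  so it is not isomorphic to \<open>W\<close>.\<close>

section \<open>Polynomials and absolute integral closedness\<close>

text \<open>Two obstacles shape the development. First, all closures must live in \<open>'b\<close>,
  while algebraic closures come in a far larger type. An integral element is one of the finitely
  many roots of a monic polynomial over \<open>R\<close>, and there are at most max(|R|, aleph_0)
  such polynomials; so each integral closure can be copied into \<open>'b\<close>. Second, the rings
  involved are not fields. Fraction-free arguments are used instead: pseudo-division by a polynomial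
  of least degree replaces minimal polynomials, and homogenizing a monic equation replaces
  localization in lying over. The integral closure is built from above, as an intersection of
  integrally closed subrings: it is then visibly a ring with the required roots, and only the
  integrality of its elements needs an argument. For non-uniqueness, a missing idempotent is not
  enough, since an isomorphism could send the idempotent elsewhere. Linearity over \<open>R\<close>
  excludes this: whatever in \<open>R\<close> kills the idempotent also kills its image.\<close>

text \<open>In a ring, \<open>eval\<close> and \<open>coeff\<close> also denote operations on the list polynomials that the
  algebraic closure is built from, hence the separate names.\<close>

abbreviation (input) upeval :: "('a, 'm) ring_scheme \<Rightarrow> ('b, 'n) ring_scheme \<Rightarrow> ('a \<Rightarrow> 'b) \<Rightarrow> 'b \<Rightarrow> (nat \<Rightarrow> 'a) \<Rightarrow> 'b"
  where "upeval \<equiv> UnivPoly.eval"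

abbreviation (input) upcoeff :: "('a, 'p, 'm) up_ring_scheme \<Rightarrow> 'p \<Rightarrow> nat \<Rightarrow> 'a"
  where "upcoeff \<equiv> up_ring.coeff"

lemma ring_hom_cring_trans:
  assumes "ring_hom_cring R S f" and "ring_hom_cring S T g"
  shows "ring_hom_cring R T (g \<circ> f)"
proof -
  interpret f: ring_hom_cring R S f by fact
  interpret g: ring_hom_cring S T g by fact
  show ?thesis
    by unfold_locales (rule ring_hom_trans[OF f.homh g.homh])
qed

lemma (in abelian_group) minus_eq_zero_iff:
  assumes "x \<in> carrier G" and "y \<in> carrier G"
  shows "x \<ominus> y = \<zero> \<longleftrightarrow> x = y"
  using assms by (metis minus_eq minus_equality minus_minus r_neg a_inv_closed)

section \<open>Evaluation and base change of polynomials\<close>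

lemma UP_carrier_iff:
  "p \<in> carrier (UP R) \<longleftrightarrow> (\<forall>n. p n \<in> carrier R) \<and> (\<exists>n. \<forall>m>n. p m = \<zero>\<^bsub>R\<^esub>)"
  by (auto simp: UP_def up_def Pi_def bound_def)

lemma coeff_UP: "p \<in> carrier (UP R) \<Longrightarrow> upcoeff (UP R) p = p"
  by (auto simp: UP_def)

text \<open>Terms beyond the degree vanish. The slack in the bound matters because a change of
  coefficients can lower the degree.\<close>

lemma eval_eq_sum:
  assumes "ring_hom_cring R S h" and p: "p \<in> carrier (UP R)" and "deg R p \<le> n" and s: "s \<in> carrier S"
  shows "upeval R S h s p = (\<Oplus>\<^bsub>S\<^esub>i\<in>{..n}. h (p i) \<otimes>\<^bsub>S\<^esub> s [^]\<^bsub>S\<^esub> i)"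
proof -
  interpret ring_hom_cring R S h by fact
  interpret U: UP_cring R "UP R" by unfold_locales simp
  have c: "p i \<in> carrier R" for i using p by (simp add: UP_carrier_iff)
  have z: "p i = \<zero>\<^bsub>R\<^esub>" if "deg R p < i" for i
    using U.deg_aboveD[OF that p] p by (simp add: coeff_UP)
  have "(\<Oplus>\<^bsub>S\<^esub>i\<in>{..deg R p}. h (p i) \<otimes>\<^bsub>S\<^esub> s [^]\<^bsub>S\<^esub> i) = (\<Oplus>\<^bsub>S\<^esub>i\<in>{..n}. h (p i) \<otimes>\<^bsub>S\<^esub> s [^]\<^bsub>S\<^esub> i)"
    by (rule S.add.finprod_mono_neutral_cong_left) (use assms c z s in auto)
  then show ?thesis using p by (simp add: U.eval_on_carrier coeff_UP)
qed

lemma eval_hom: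
  assumes "ring_hom_cring R S h" and "s \<in> carrier S"
  shows "ring_hom_cring (UP R) S (upeval R S h s)"
proof -
  interpret ring_hom_cring R S h by fact
  interpret U: UP_pre_univ_prop R S h "UP R" by unfold_locales simp
  show ?thesis
    using U.eval_ring_hom[OF assms(2)] U.UP_cring S.is_cring by (simp add: UnivPoly.ring_hom_cringI)
qed

lemma eval_closed:
  assumes "ring_hom_cring R S h" and "s \<in> carrier S" and "p \<in> carrier (UP R)"
  shows "upeval R S h s p \<in> carrier S"
proof -
  interpret ring_hom_cring "UP R" S "upeval R S h s" by (rule eval_hom) fact+
  show ?thesis using assms(3) by simp
qed

text \<open>Change of coefficients along \<open>f\<close>; composition suffices because a polynomial
  of \<open>UP\<close> is its coefficient function.\<close>

definition upmap :: "('a \<Rightarrow> 'b) \<Rightarrow> (nat \<Rightarrow> 'a) \<Rightarrow> nat \<Rightarrow> 'b"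
  where "upmap f p = (\<lambda>n. f (p n))"

lemma upmap_closed:
  assumes "ring_hom_cring R S f" and "p \<in> carrier (UP R)"
  shows "upmap f p \<in> carrier (UP S)"
proof -
  interpret ring_hom_cring R S f by fact
  show ?thesis using assms(2) by (force simp: UP_carrier_iff upmap_def)
qed

lemma upmap_hom:
  assumes "ring_hom_cring R S f"
  shows "ring_hom_cring (UP R) (UP S) (upmap f)"
proof -
  interpret ring_hom_cring R S f by fact
  interpret U: UP_cring R "UP R" by unfold_locales simp
  interpret V: UP_cring S "UP S" by unfold_locales simp
  note cl = upmap_closed[OF assms]
  show ?thesis
  proof (rule UnivPoly.ring_hom_cringI)
    show "upmap f \<in> ring_hom (UP R) (UP S)"
    proof (rule ring_hom_memI)
      fix p q assume pq: "p \<in> carrier (UP R)" "q \<in> carrier (UP R)"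
      have p: "p i \<in> carrier R" "q i \<in> carrier R" for i using pq by (auto simp: UP_carrier_iff)
      have "(p \<otimes>\<^bsub>UP R\<^esub> q) n = (\<Oplus>\<^bsub>R\<^esub>i\<in>{..n}. p i \<otimes>\<^bsub>R\<^esub> q (n - i))" for n
        using U.coeff_mult[OF pq, of n] pq by (simp add: coeff_UP del: U.coeff_mult)
      moreover have "(upmap f p \<otimes>\<^bsub>UP S\<^esub> upmap f q) n
          = (\<Oplus>\<^bsub>S\<^esub>i\<in>{..n}. upmap f p i \<otimes>\<^bsub>S\<^esub> upmap f q (n - i))" for n
        using V.coeff_mult[OF cl[OF pq(1)] cl[OF pq(2)], of n] cl pq by (simp add: coeff_UP del: V.coeff_mult)
      moreover have "f (\<Oplus>\<^bsub>R\<^esub>i\<in>{..n}. p i \<otimes>\<^bsub>R\<^esub> q (n - i))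
          = (\<Oplus>\<^bsub>S\<^esub>i\<in>{..n}. f (p i) \<otimes>\<^bsub>S\<^esub> f (q (n - i)))" for n
        using p by (subst hom_finsum) (auto simp: Pi_def comp_def)
      ultimately show "upmap f (p \<otimes>\<^bsub>UP R\<^esub> q) = upmap f p \<otimes>\<^bsub>UP S\<^esub> upmap f q"
        by (intro ext) (simp add: upmap_def)
      have "(p \<oplus>\<^bsub>UP R\<^esub> q) n = p n \<oplus>\<^bsub>R\<^esub> q n" for n
        using U.coeff_add[OF pq, of n] pq by (simp add: coeff_UP)
      moreover have "(upmap f p \<oplus>\<^bsub>UP S\<^esub> upmap f q) n = upmap f p n \<oplus>\<^bsub>S\<^esub> upmap f q n" for n
        using V.coeff_add[OF cl[OF pq(1)] cl[OF pq(2)], of n] cl pq by (simp add: coeff_UP)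
      ultimately show "upmap f (p \<oplus>\<^bsub>UP R\<^esub> q) = upmap f p \<oplus>\<^bsub>UP S\<^esub> upmap f q"
        using p by (intro ext) (simp add: upmap_def)
    qed (auto simp: cl, auto simp: UP_def upmap_def)
  qed (rule U.UP_cring V.UP_cring)+
qed

lemma deg_upmap_le:
  assumes "ring_hom_cring R S f" and p: "p \<in> carrier (UP R)"
  shows "deg S (upmap f p) \<le> deg R p"
proof -
  interpret ring_hom_cring R S f by fact
  interpret U: UP_cring R "UP R" by unfold_locales simp
  interpret V: UP_cring S "UP S" by unfold_locales simp
  note cl = upmap_closed[OF assms]
  show ?thesis
  proof (rule V.deg_aboveI[OF _ cl])
    fix m assume "deg R p < m"
    then have "p m = \<zero>\<^bsub>R\<^esub>" using U.deg_aboveD[of p m] p by (simp add: coeff_UP)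
    then show "upcoeff (UP S) (upmap f p) m = \<zero>\<^bsub>S\<^esub>" by (simp add: coeff_UP[OF cl]) (simp add: upmap_def)
  qed
qed

lemma deg_upmap:
  assumes "ring_hom_cring R S f" and p: "p \<in> carrier (UP R)" and "f (p (deg R p)) \<noteq> \<zero>\<^bsub>S\<^esub>"
  shows "deg S (upmap f p) = deg R p"
proof (rule antisym)
  interpret ring_hom_cring R S f by fact
  interpret V: UP_cring S "UP S" by unfold_locales simp
  note cl = upmap_closed[OF assms(1,2)]
  show "deg R p \<le> deg S (upmap f p)"
    by (rule V.deg_belowI[OF _ cl]) (use assms(3) in \<open>simp add: coeff_UP[OF cl], simp add: upmap_def\<close>)
qed (rule deg_upmap_le[OF assms(1,2)])

lemma eval_upmap:
  assumes f: "ring_hom_cring R S f" and g: "ring_hom_cring S T g"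
    and p: "p \<in> carrier (UP R)" and t: "t \<in> carrier T"
  shows "upeval S T g t (upmap f p) = upeval R T (g \<circ> f) t p"
  unfolding eval_eq_sum[OF g upmap_closed[OF f p] deg_upmap_le[OF f p] t]
    eval_eq_sum[OF ring_hom_cring_trans[OF f g] p order.refl t]
  by (simp add: upmap_def)

text \<open>Homomorphisms commute with finite sums and powers. Together with
  \<open>eval_upmap\<close>, a root can be moved by changing either the coefficients or the
  point.\<close>

lemma hom_eval:
  assumes f: "ring_hom_cring R S f" and g: "ring_hom_cring S T g"
    and p: "p \<in> carrier (UP R)" and s: "s \<in> carrier S"
  shows "g (upeval R S f s p) = upeval R T (g \<circ> f) (g s) p"
proof -
  interpret f: ring_hom_cring R S f by fact
  interpret g: ring_hom_cring S T g by fact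
  have c: "p i \<in> carrier R" for i using p by (simp add: UP_carrier_iff)
  show ?thesis
    unfolding eval_eq_sum[OF f p order.refl s]
      eval_eq_sum[OF ring_hom_cring_trans[OF f g] p order.refl g.hom_closed[OF s]]
    using s c by (auto simp: g.hom_finsum Pi_def g.hom_pow intro!: g.S.finsum_cong')
qed

text \<open>The body repeats the linear factor of \<open>ai_closed\<close>, so that
  \<open>lin_def\<close> folds it there.\<close>

definition lin :: "('a, 'm) ring_scheme \<Rightarrow> 'a \<Rightarrow> nat \<Rightarrow> 'a"
  where "lin R a = monom (UP R) \<one>\<^bsub>R\<^esub> 1 \<ominus>\<^bsub>UP R\<^esub> monom (UP R) a 0"

lemma lin_closed:
  assumes "cring R" and "a \<in> carrier R" shows "lin R a \<in> carrier (UP R)"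
proof -
  interpret R: cring R by fact
  interpret U: UP_cring R "UP R" by unfold_locales simp
  show ?thesis using assms by (simp add: lin_def)
qed

lemma eval_lin:
  assumes "ring_hom_cring R S f" and "s \<in> carrier S" and "a \<in> carrier R"
  shows "upeval R S f s (lin R a) = s \<ominus>\<^bsub>S\<^esub> f a"
proof -
  interpret ring_hom_cring R S f by fact
  interpret U: UP_pre_univ_prop R S f "UP R" by unfold_locales simp
  interpret e: ring_hom_cring "UP R" S "upeval R S f s" by (rule eval_hom) fact+
  show ?thesis using U.eval_monom1[OF assms(2)] U.eval_const[OF assms(2,3)] assms
    by (simp add: lin_def a_minus_def del: One_nat_def)
qed

lemma upmap_monom:
  assumes "ring_hom_cring R S f" and "a \<in> carrier R"
  shows "upmap f (monom (UP R) a n) = monom (UP S) (f a) n"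
proof -
  interpret ring_hom_cring R S f by fact
  show ?thesis using assms(2) by (auto simp: UP_def upmap_def)
qed

section \<open>Monic polynomials, their roots and factorizations\<close>

lemma monic_polyD:
  assumes "monic_poly R p"
  shows "p \<in> carrier (UP R)" and "p (deg R p) = \<one>\<^bsub>R\<^esub>"
  using assms by (auto simp: monic_poly_def coeff_UP)

text \<open>The leading coefficient goes to one, which keeps the degree as long as one is not zero;
  over a trivial target every degree drops to zero.\<close>

lemma monic_upmap:
  assumes f: "ring_hom_cring R S f" and "\<one>\<^bsub>S\<^esub> \<noteq> \<zero>\<^bsub>S\<^esub>" and p: "monic_poly R p"
  shows "monic_poly S (upmap f p)" and "deg S (upmap f p) = deg R p"
proof -
  interpret ring_hom_cring R S f by fact
  note c = monic_polyD[OF p]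
  show d: "deg S (upmap f p) = deg R p"
    by (rule deg_upmap[OF f]) (use assms(2) c in auto)
  show "monic_poly S (upmap f p)"
    unfolding monic_poly_def coeff_UP[OF upmap_closed[OF f c(1)]] d
    using c upmap_closed[OF f c(1)] by (simp add: upmap_def)
qed

lemma monic_deg_0:
  assumes "cring S" and "monic_poly S p" and "deg S p = 0"
  shows "p = \<one>\<^bsub>UP S\<^esub>"
proof -
  interpret S: cring S by fact
  interpret U: UP_cring S "UP S" by unfold_locales simp
  show ?thesis
    using assms U.deg_zero_impl_monom[of p] unfolding monic_poly_def by simp
qed

text \<open>Degrees need not add over a ring with zero divisors, so the cofactor \<open>q\<close> is
  controlled by comparing coefficients in \<open>p = X q - a q\<close>.\<close>

lemma monic_root_factor:
  assumes "cring S" and p: "monic_poly S p" and "deg S p > 0"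
    and a: "a \<in> carrier S" and r: "upeval S S id a p = \<zero>\<^bsub>S\<^esub>"
  obtains q where "monic_poly S q" and "deg S p = Suc (deg S q)" and "p = lin S a \<otimes>\<^bsub>UP S\<^esub> q"
proof -
  interpret S: cring S by fact
  interpret U: UP_cring S "UP S" by unfold_locales simp
  note c = monic_polyD[OF p]
  have nt: "\<one>\<^bsub>S\<^esub> \<noteq> \<zero>\<^bsub>S\<^esub>"
    using U.lcoeff_nonzero_deg[of p] c assms(3) by (auto simp: coeff_UP)
  then have nt': "carrier S \<noteq> {\<zero>\<^bsub>S\<^esub>}" by auto
  obtain q where q: "q \<in> carrier (UP S)"
    and "p = lin S a \<otimes>\<^bsub>UP S\<^esub> q \<oplus>\<^bsub>UP S\<^esub> monom (UP S) (upeval S S id a p) 0"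
    using U.remainder_theorem[OF c(1) a nt'] unfolding lin_def by blast
  then have pq: "p = lin S a \<otimes>\<^bsub>UP S\<^esub> q" using a r lin_closed[OF assms(1) a] by simp
  have mq: "monom (UP S) \<one>\<^bsub>S\<^esub> 1 \<otimes>\<^bsub>UP S\<^esub> q \<in> carrier (UP S)" using q by simp
  have pc: "p (Suc n) = q n \<ominus>\<^bsub>S\<^esub> a \<otimes>\<^bsub>S\<^esub> q (Suc n)" for n
  proof -
    have "p = monom (UP S) \<one>\<^bsub>S\<^esub> 1 \<otimes>\<^bsub>UP S\<^esub> q \<ominus>\<^bsub>UP S\<^esub> a \<odot>\<^bsub>UP S\<^esub> q"
      unfolding pq using a q by (simp add: lin_def a_minus_def U.P.l_distr U.P.l_minus U.monom_mult_is_smult)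
    moreover have "upcoeff (UP S) (monom (UP S) \<one>\<^bsub>S\<^esub> 1 \<otimes>\<^bsub>UP S\<^esub> q) (Suc n) = upcoeff (UP S) q n"
      using U.coeff_monom_mult[of "\<one>\<^bsub>S\<^esub>" q 1 n] q U.coeff_closed[OF q] by (simp del: U.coeff_mult)
    ultimately have "upcoeff (UP S) p (Suc n) = upcoeff (UP S) q n \<ominus>\<^bsub>S\<^esub> a \<otimes>\<^bsub>S\<^esub> upcoeff (UP S) q (Suc n)"
      using mq a q by (simp add: a_minus_def del: U.coeff_mult)
    then show ?thesis using c q by (simp add: coeff_UP)
  qed
  let ?m = "deg S q"
  have qc: "q n \<in> carrier S" for n using q by (simp add: UP_carrier_iff)
  have q0: "q n = \<zero>\<^bsub>S\<^esub>" if "?m < n" for n using U.deg_aboveD[OF that q] q by (simp add: coeff_UP)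
  have "q \<noteq> \<zero>\<^bsub>UP S\<^esub>" using pq assms(3) lin_closed[OF assms(1) a] by auto
  then have qm: "q ?m \<noteq> \<zero>\<^bsub>S\<^esub>" using U.lcoeff_nonzero[of q] q by (simp add: coeff_UP)
  \<comment> \<open>From the degree of \<open>q\<close> on, the term with \<open>a\<close> drops out
    and \<open>p\<close> is \<open>q\<close> shifted by one. So both have the same leading
    coefficient.\<close>
  have pm: "p (Suc n) = q n" if "n \<ge> ?m" for n
    using pc[of n] q0[of "Suc n"] that qc a by (simp add: S.minus_eq)
  have d: "deg S p = Suc ?m"
  proof (rule antisym)
    show "deg S p \<le> Suc ?m"
    proof (rule U.deg_aboveI[OF _ c(1)])
      fix m assume "Suc ?m < m"
      then show "upcoeff (UP S) p m = \<zero>\<^bsub>S\<^esub>" 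
        using pm[of "m - 1"] q0[of "m - 1"] c by (simp add: coeff_UP)
    qed
    show "Suc ?m \<le> deg S p"
      by (rule U.deg_belowI) (use c pm[of ?m] qm in \<open>auto simp: coeff_UP\<close>)
  qed
  then have "monic_poly S q" using q c pm[of ?m] by (simp add: monic_poly_def coeff_UP)
  then show thesis using that d pq by blast
qed

text \<open>One root is easier to assemble in a product, or in a subring of it, than a whole
  factorization. The trivial ring satisfies the condition vacuously, as all its polynomials have
  degree zero.\<close>

definition root_closed :: "('a, 'm) ring_scheme \<Rightarrow> bool"
  where "root_closed S \<longleftrightarrow>
    (\<forall>p. monic_poly S p \<longrightarrow> deg S p > 0 \<longrightarrow> (\<exists>a \<in> carrier S. upeval S S id a p = \<zero>\<^bsub>S\<^esub>))"

text \<open>Roots are split off one at a time, the cofactor being monic of degree one less. Over the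
  trivial ring only the base case occurs.\<close>

lemma root_closed_imp_ai_closed:
  assumes "cring S" and "root_closed S"
  shows "ai_closed S"
  unfolding ai_closed_def lin_def[symmetric]
proof (intro allI impI)
  interpret S: cring S by fact
  interpret U: UP_cring S "UP S" by unfold_locales simp
  fix p assume "monic_poly S p"
  then show "\<exists>n a. a \<in> {..<n::nat} \<rightarrow> carrier S \<and> p = (\<Otimes>\<^bsub>UP S\<^esub>i\<in>{..<n}. lin S (a i))"
  proof (induction "deg S p" arbitrary: p)
    case 0
    then have "p = \<one>\<^bsub>UP S\<^esub>" using monic_deg_0[OF assms(1)] by simp
    then show ?case by (intro exI[of _ 0]) simp
  next
    case (Suc k)
    obtain a where a: "a \<in> carrier S" "upeval S S id a p = \<zero>\<^bsub>S\<^esub>"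
      using assms(2) Suc(2,3) unfolding root_closed_def by (metis zero_less_Suc)
    obtain q where q: "monic_poly S q" "deg S p = Suc (deg S q)" "p = lin S a \<otimes>\<^bsub>UP S\<^esub> q"
      using monic_root_factor[OF assms(1) Suc(3) _ a] Suc(2) by auto
    obtain n b where b: "b \<in> {..<n::nat} \<rightarrow> carrier S" "q = (\<Otimes>\<^bsub>UP S\<^esub>i\<in>{..<n}. lin S (b i))"
      using Suc(1)[of q] q Suc(2) by auto
    have "(\<Otimes>\<^bsub>UP S\<^esub>i\<in>{..<n}. lin S ((b(n := a)) i)) = (\<Otimes>\<^bsub>UP S\<^esub>i\<in>{..<n}. lin S (b i))"
      by (rule U.P.finprod_cong') (use b a lin_closed[OF assms(1)] in auto)
    then have "p = (\<Otimes>\<^bsub>UP S\<^esub>i\<in>{..<Suc n}. lin S ((b(n := a)) i))"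
      unfolding lessThan_Suc using b a q lin_closed[OF assms(1)]
      by (subst U.P.finprod_insert) (auto simp: Pi_def)
    moreover have "b(n := a) \<in> {..<Suc n} \<rightarrow> carrier S" using a b by (auto simp: Pi_def)
    ultimately show ?case by blast
  qed
qed

lemma (in ring_hom_cring) hom_finprod':
  "f \<in> A \<rightarrow> carrier R \<Longrightarrow> h (finprod R f A) = finprod S (\<lambda>x. h (f x)) A"
  by (induct A rule: infinite_finite_induct) (auto simp: Pi_def)

lemma (in domain) finprod_zero_iff:
  assumes "finite A" and "f \<in> A \<rightarrow> carrier R"
  shows "finprod R f A = \<zero> \<longleftrightarrow> (\<exists>x\<in>A. f x = \<zero>)"
  using assms by (induct A) (auto simp: Pi_def integral_iff)

lemma ai_closedE:
  assumes "ai_closed S" and "cring S" and "monic_poly S p"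
  obtains n :: nat and a where "a \<in> {..<n} \<rightarrow> carrier S" and "p = (\<Otimes>\<^bsub>UP S\<^esub>i\<in>{..<n}. lin S (a i))"
    and "\<And>i. i < n \<Longrightarrow> upeval S S id (a i) p = \<zero>\<^bsub>S\<^esub>"
proof -
  interpret S: cring S by fact
  interpret U: UP_cring S "UP S" by unfold_locales simp
  obtain n a where a: "a \<in> {..<n::nat} \<rightarrow> carrier S" "p = (\<Otimes>\<^bsub>UP S\<^esub>i\<in>{..<n}. lin S (a i))"
    using assms unfolding ai_closed_def lin_def by metis
  have "upeval S S id (a i) p = \<zero>\<^bsub>S\<^esub>" if "i < n" for i
  proof -
    have ai: "a i \<in> carrier S" using a that by auto
    have idh: "ring_hom_cring S S id" by unfold_locales (simp add: ring_hom_def)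
    interpret e: ring_hom_cring "UP S" S "upeval S S id (a i)" by (rule eval_hom[OF idh ai])
    have l: "(\<lambda>j. lin S (a j)) \<in> A \<rightarrow> carrier (UP S)" if "A \<subseteq> {..<n}" for A
      using a lin_closed[OF assms(2)] that by (auto simp: Pi_def)
    have "p = lin S (a i) \<otimes>\<^bsub>UP S\<^esub> (\<Otimes>\<^bsub>UP S\<^esub>j\<in>{..<n} - {i}. lin S (a j))"
      unfolding a(2) using l[of "{..<n}"] l[of "{..<n} - {i}"] that
      by (subst U.P.finprod_insert[symmetric]) (auto simp: insert_absorb)
    then show ?thesis using ai l[of "{..<n} - {i}"] 
        lin_closed[OF assms(2) ai] eval_lin[OF idh ai ai] by (simp add: S.minus_eq S.r_neg)
  qed
  then show thesis using a that by blast
qed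

text \<open>The factorization of \<open>p\<close> over \<open>S\<close> maps to \<open>T\<close>,
  and in a domain the vanishing product of the differences \<open>t - g (a i)\<close> has a
  vanishing factor. This gives surjectivity onto the factors of a product and the matching of roots
  in the glued ring.\<close>

lemma root_lift:
  assumes ac: "ai_closed S" and g: "ring_hom_cring S T g" and "domain T" and p: "monic_poly S p"
    and t: "t \<in> carrier T" and r: "upeval S T g t p = \<zero>\<^bsub>T\<^esub>"
  obtains s where "s \<in> carrier S" and "t = g s" and "upeval S S id s p = \<zero>\<^bsub>S\<^esub>"
proof -
  interpret g: ring_hom_cring S T g by fact
  interpret T: domain T by fact
  interpret e: ring_hom_cring "UP S" T "upeval S T g t" by (rule eval_hom) fact+
  obtain n :: nat and a where a: "a \<in> {..<n} \<rightarrow> carrier S" "p = (\<Otimes>\<^bsub>UP S\<^esub>i\<in>{..<n}. lin S (a i))"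
    "\<And>i. i < n \<Longrightarrow> upeval S S id (a i) p = \<zero>\<^bsub>S\<^esub>"
    using ai_closedE[OF ac g.R.is_cring p] by metis
  have l: "(\<lambda>i. lin S (a i)) \<in> {..<n} \<rightarrow> carrier (UP S)"
    using a(1) lin_closed[OF g.R.is_cring] by blast
  then have l': "(\<lambda>i. upeval S T g t (lin S (a i))) \<in> {..<n} \<rightarrow> carrier T" by auto
  have "upeval S T g t p = (\<Otimes>\<^bsub>T\<^esub>i\<in>{..<n}. upeval S T g t (lin S (a i)))"
    unfolding a(2) by (rule e.hom_finprod'[OF l])
  then obtain i where i: "i < n" "upeval S T g t (lin S (a i)) = \<zero>\<^bsub>T\<^esub>"
    using r T.finprod_zero_iff[OF _ l'] by auto
  then have "t \<ominus>\<^bsub>T\<^esub> g (a i) = \<zero>\<^bsub>T\<^esub>" using eval_lin[OF g t, of "a i"] a(1) by (auto simp: Pi_def)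
  then have "t = g (a i)" using t a(1) i(1) by (simp add: Pi_def g.S.minus_eq_zero_iff)
  then show thesis using that a i by auto
qed

section \<open>Prime ideals and integrality\<close>

lemma (in ring) chain_Union_subring:
  assumes "C \<noteq> {}" and s: "\<And>B. B \<in> C \<Longrightarrow> subring B R"
    and ch: "\<And>A B. A \<in> C \<Longrightarrow> B \<in> C \<Longrightarrow> A \<subseteq> B \<or> B \<subseteq> A"
  shows "subring (\<Union>C) R"
proof (rule subringI)
  show "\<Union>C \<subseteq> carrier R" using s subringE(1) by blast
  show "\<one> \<in> \<Union>C" using assms(1) s subringE(3) by blast
  show "\<ominus> h \<in> \<Union>C" if h: "h \<in> \<Union>C" for h
  proof -
    obtain Z where "Z \<in> C" "h \<in> Z" using h by blast
    then show ?thesis using subringE(5)[OF s] by blast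
  qed
  fix h1 h2 assume "h1 \<in> \<Union>C" "h2 \<in> \<Union>C"
  then obtain Y Z where "Y \<in> C" "Z \<in> C" "h1 \<in> Y" "h2 \<in> Z" by blast
  moreover from this have "Y \<subseteq> Z \<or> Z \<subseteq> Y" using ch by blast
  ultimately obtain Z where Z: "Z \<in> C" "h1 \<in> Z" "h2 \<in> Z" by blast
  show "h1 \<otimes> h2 \<in> \<Union>C" using subringE(6)[OF s Z(2,3)] Z(1) by blast
  show "h1 \<oplus> h2 \<in> \<Union>C" using subringE(7)[OF s Z(2,3)] Z(1) by blast
qed

lemma (in cring) exists_maximal_ideal_disjoint:
  assumes J: "ideal J R" and disj: "J \<inter> M = {}"
  obtains P where "ideal P R" and "J \<subseteq> P" and "P \<inter> M = {}"
    and "\<And>I. ideal I R \<Longrightarrow> P \<subseteq> I \<Longrightarrow> I \<inter> M = {} \<Longrightarrow> I = P"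
proof -
  let ?A = "{I. ideal I R \<and> J \<subseteq> I \<and> I \<inter> M = {}}"
  have "\<exists>P\<in>?A. \<forall>I\<in>?A. P \<subseteq> I \<longrightarrow> I = P"
  proof (rule subset_Zorn_nonempty)
    show "?A \<noteq> {}" using J disj by blast
    fix C assume C: "C \<noteq> {}" "subset.chain ?A C"
    then have "subset.chain {I. ideal I R} C" by (auto simp: pred_on.chain_def)
    from chain_Union_is_ideal[OF this] have "ideal (\<Union>C) R" using C(1) by simp
    then show "\<Union>C \<in> ?A" using C by (auto simp: pred_on.chain_def)
  qed
  then obtain P where P: "P \<in> ?A" "\<forall>I\<in>?A. P \<subseteq> I \<longrightarrow> I = P" by blast
  show thesis by (rule that[of P]) (use P in blast)+
qed

text \<open>An ideal maximal among those avoiding a multiplicative set is prime. The last conclusion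
  keeps the maximality in elementwise form: adding \<open>x\<close> to \<open>P\<close> makes the
  ideal meet \<open>M\<close>. \<open>lying_over\<close> depends on it.\<close>

lemma (in cring) exists_prime_disjoint:
  assumes J: "ideal J R" and M: "M \<subseteq> carrier R" "\<one> \<in> M" "\<And>x y. x \<in> M \<Longrightarrow> y \<in> M \<Longrightarrow> x \<otimes> y \<in> M"
    and disj: "J \<inter> M = {}"
  obtains P where "primeideal P R" and "J \<subseteq> P" and "P \<inter> M = {}"
    and "\<And>x. x \<in> carrier R \<Longrightarrow> x \<notin> P \<Longrightarrow> \<exists>q\<in>P. \<exists>r\<in>carrier R. q \<oplus> r \<otimes> x \<in> M"
proof -
  obtain P where P: "ideal P R" "J \<subseteq> P" "P \<inter> M = {}"
    and max: "\<And>I. ideal I R \<Longrightarrow> P \<subseteq> I \<Longrightarrow> I \<inter> M = {} \<Longrightarrow> I = P"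
    using exists_maximal_ideal_disjoint[OF J disj] by blast
  interpret P: ideal P R by fact
  have ex: "\<exists>q\<in>P. \<exists>r\<in>carrier R. q \<oplus> r \<otimes> x \<in> M" if x: "x \<in> carrier R" "x \<notin> P" for x
  proof -
    have I: "ideal (P <+> PIdl x) R" by (rule add_ideals[OF P(1) cgenideal_ideal[OF x(1)]])
    have xI: "x \<in> P <+> PIdl x"
      using cgenideal_self[OF x(1)] l_zero[OF x(1)] P.zero_closed unfolding set_add_def'
      by (metis (mono_tags, lifting) UN_iff singletonI)
    have PI: "P \<subseteq> P <+> PIdl x"
    proof
      fix p assume p: "p \<in> P"
      have "\<zero> = \<zero> \<otimes> x" using x by simp
      then have "\<zero> \<in> PIdl x" unfolding cgenideal_def using zero_closed by blast
      moreover have "p = p \<oplus> \<zero>" using P.Icarr[OF p] by simp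
      ultimately show "p \<in> P <+> PIdl x"
        using p unfolding set_add_def' by blast
    qed
    have "(P <+> PIdl x) \<inter> M \<noteq> {}" using max[OF I PI] xI x(2) by auto
    then show ?thesis unfolding set_add_def' cgenideal_def by blast
  qed
  have "primeideal P R"
  proof (rule primeidealI[OF P(1) is_cring])
    show "carrier R \<noteq> P" using P(3) M(2) by auto
    fix a b assume ab: "a \<in> carrier R" "b \<in> carrier R" "a \<otimes> b \<in> P"
    show "a \<in> P \<or> b \<in> P"
    proof (rule ccontr)
      assume "\<not> ?thesis"
      then obtain q r q' r' where 1: "q \<in> P" "r \<in> carrier R" "q \<oplus> r \<otimes> a \<in> M"
        "q' \<in> P" "r' \<in> carrier R" "q' \<oplus> r' \<otimes> b \<in> M" using ex ab by meson
      note c = P.Icarr[OF 1(1)] P.Icarr[OF 1(4)]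
      \<comment> \<open>Every term of the expanded product contains \<open>q\<close>,
        \<open>q'\<close> or \<open>a \<otimes> b\<close>, so a member of \<open>M\<close> would lie
        in \<open>P\<close>.\<close>
      have "(q \<oplus> r \<otimes> a) \<otimes> (q' \<oplus> r' \<otimes> b) = (q' \<oplus> r' \<otimes> b) \<otimes> q \<oplus> ((r \<otimes> a) \<otimes> q' \<oplus> (r \<otimes> r') \<otimes> (a \<otimes> b))"
        using c 1 ab by algebra
      also have "\<dots> \<in> P"
        by (intro P.a_closed P.I_l_closed[OF 1(1)] P.I_l_closed[OF 1(4)] P.I_l_closed[OF ab(3)])
          (use 1 c ab in auto)
      finally show False using M(3)[OF 1(3,6)] P(3) by blast
    qed
  qed
  then show thesis using that P ex by blast
qed

lemma (in cring) exists_prime_above: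
  assumes "ideal J R" and "\<one> \<notin> J"
  obtains P where "primeideal P R" and "J \<subseteq> P"
proof (rule exists_prime_disjoint[OF assms(1), of "{\<one>}"])
qed (use assms(2) that in auto)

lemma primeideal_pow:
  assumes "primeideal P R" and "x \<in> carrier R" and "x [^]\<^bsub>R\<^esub> (n::nat) \<in> P"
  shows "x \<in> P"
proof -
  interpret primeideal P R by fact
  show ?thesis using assms(3)
  proof (induct n)
    case 0
    then show ?case using one_imp_carrier I_notcarr by simp
  next
    case (Suc n)
    then show ?case using I_prime[of "x [^]\<^bsub>R\<^esub> n" x] assms(2) by auto
  qed
qed

lemma exists_min_prime_below:
  assumes Q: "primeideal Q R"
  obtains P where "P \<in> min_primes R" and "P \<subseteq> Q"
proof -
  \<comment> \<open>Zorn's lemma yields maximal sets; passing to complements turns this into a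
    minimal prime.\<close>
  let ?A = "{Z. \<exists>P. Z = uminus P \<and> primeideal P R \<and> P \<subseteq> Q}"
  have "\<exists>M\<in>?A. \<forall>Z\<in>?A. M \<subseteq> Z \<longrightarrow> Z = M"
  proof (rule subset_Zorn_nonempty)
    show "?A \<noteq> {}" using Q by blast
    fix C assume C: "C \<noteq> {}" "subset.chain ?A C"
    interpret Q: primeideal Q R by fact
    define D where "D = uminus ` C"
    have D: "D \<noteq> {}" "\<And>P. P \<in> D \<Longrightarrow> primeideal P R \<and> P \<subseteq> Q"
      and ch: "\<And>P P'. P \<in> D \<Longrightarrow> P' \<in> D \<Longrightarrow> P \<subseteq> P' \<or> P' \<subseteq> P"
      using C unfolding D_def by (auto simp: pred_on.chain_def) blast
    have "primeideal (\<Inter>D) R"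
    proof (rule primeidealI)
      show "ideal (\<Inter>D) R" 
        using D by (intro Q.i_Intersect) (auto simp: primeideal_def)
      show "carrier R \<noteq> \<Inter>D" using D Q.I_notcarr Q.Icarr by blast
      fix a b assume ab: "a \<in> carrier R" "b \<in> carrier R" "a \<otimes>\<^bsub>R\<^esub> b \<in> \<Inter>D"
      show "a \<in> \<Inter>D \<or> b \<in> \<Inter>D"
      proof (rule ccontr)
        assume "\<not> ?thesis"
        then obtain P P' where P: "P \<in> D" "P' \<in> D" "a \<notin> P" "b \<notin> P'" by blast
        \<comment> \<open>The smaller of \<open>P\<close> and \<open>P'\<close> misses both
          \<open>a\<close> and \<open>b\<close>.\<close>
        then obtain P'' where P'': "P'' \<in> D" "a \<notin> P''" "b \<notin> P''" using ch[OF P(1,2)] by blast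
        then show False using primeideal.I_prime[of P'' R a b] D(2)[of P''] ab by auto
      qed
    qed (rule Q.is_cring)
    moreover have "\<Inter>D \<subseteq> Q" using D by blast
    moreover have "\<Union>C = uminus (\<Inter>D)" unfolding D_def by auto
    ultimately show "\<Union>C \<in> ?A" by blast
  qed
  then obtain Z where Z: "Z \<in> ?A" "\<forall>Y\<in>?A. Z \<subseteq> Y \<longrightarrow> Y = Z" by blast
  obtain P where P: "Z = uminus P" "primeideal P R" "P \<subseteq> Q" using Z(1) by blast
  have "P' = P" if "primeideal P' R" "P' \<subseteq> P" for P'
  proof -
    have "uminus P' \<in> ?A" using that P(3) by blast
    moreover have "Z \<subseteq> uminus P'" using that P(1) by auto
    ultimately have "uminus P' = uminus P" using Z(2) P(1) by blast
    then show ?thesis by simp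
  qed
  then have "P \<in> min_primes R" unfolding min_primes_def using P(2) by blast
  then show thesis using that P by blast
qed

text \<open>In a reduced ring a non-zero \<open>x\<close> has no vanishing power, so some prime
  avoids all its powers, and a minimal prime below that one avoids \<open>x\<close>.\<close>

lemma reduced_Inter_min_primes:
  assumes "cring R" and red: "reduced_ring R" and x: "x \<in> carrier R"
    and xP: "\<And>P. P \<in> min_primes R \<Longrightarrow> x \<in> P"
  shows "x = \<zero>\<^bsub>R\<^esub>"
proof (rule ccontr)
  interpret cring R by fact
  assume nz: "x \<noteq> \<zero>\<^bsub>R\<^esub>"
  obtain Q where Q: "primeideal Q R" "Q \<inter> range (\<lambda>n::nat. x [^]\<^bsub>R\<^esub> n) = {}"
  proof (rule exists_prime_disjoint[OF zeroideal, of "range (\<lambda>n::nat. x [^]\<^bsub>R\<^esub> n)"])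
    show "\<one>\<^bsub>R\<^esub> \<in> range (\<lambda>n::nat. x [^]\<^bsub>R\<^esub> n)" by (rule range_eqI[of _ _ 0]) simp
    show "{\<zero>\<^bsub>R\<^esub>} \<inter> range (\<lambda>n::nat. x [^]\<^bsub>R\<^esub> n) = {}"
      using red nz x unfolding reduced_ring_def by (auto dest: sym)
  qed (use x in \<open>auto simp: nat_pow_mult\<close>)
  obtain P where "P \<in> min_primes R" "P \<subseteq> Q" using exists_min_prime_below[OF Q(1)] .
  then have "x \<in> Q" using xP by blast
  moreover have "x [^]\<^bsub>R\<^esub> (1::nat) \<in> range (\<lambda>n::nat. x [^]\<^bsub>R\<^esub> n)" by blast
  ultimately show False using Q(2) x by auto
qed

text \<open>Integrality without injectivity, because the maps from \<open>R\<close> to the closures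
  of its residue domains have kernels.\<close>

definition integral_over :: "('a, 'm) ring_scheme \<Rightarrow> ('b, 'n) ring_scheme \<Rightarrow> ('a \<Rightarrow> 'b) \<Rightarrow> bool"
  where "integral_over R S \<phi> \<longleftrightarrow>
    (\<forall>s \<in> carrier S. \<exists>p. monic_poly R p \<and> upeval R S \<phi> s p = \<zero>\<^bsub>S\<^esub>)"

lemma integral_over_surj_trans:
  assumes R: "ring_hom_cring R S \<phi>" and g: "ring_hom_cring S T g" and "g ` carrier S = carrier T"
    and i: "integral_over R S \<phi>"
  shows "integral_over R T (g \<circ> \<phi>)"
  unfolding integral_over_def
proof
  fix t assume "t \<in> carrier T"
  then obtain s where s: "s \<in> carrier S" "t = g s" using assms(3) by blast
  then obtain p where p: "monic_poly R p" "upeval R S \<phi> s p = \<zero>\<^bsub>S\<^esub>" 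
    using i unfolding integral_over_def by blast
  interpret g: ring_hom_cring S T g by fact
  show "\<exists>p. monic_poly R p \<and> upeval R T (g \<circ> \<phi>) t p = \<zero>\<^bsub>T\<^esub>"
    using hom_eval[OF R g monic_polyD(1)[OF p(1)] s(1)] p s by auto
qed

lemma eval_const_term:
  assumes R: "ring_hom_cring R S \<phi>" and p: "p \<in> carrier (UP R)" and s: "s \<in> carrier S"
  obtains q where "q \<in> carrier (UP R)" and "\<And>n. q n = p (Suc n)"
    and "upeval R S \<phi> s p = \<phi> (p 0) \<oplus>\<^bsub>S\<^esub> s \<otimes>\<^bsub>S\<^esub> upeval R S \<phi> s q"
proof -
  interpret ring_hom_cring R S \<phi> by fact
  interpret U: UP_cring R "UP R" by unfold_locales simp
  define q where "q = (\<lambda>n. p (Suc n))"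
  have c: "p n \<in> carrier R" for n using p by (simp add: UP_carrier_iff)
  obtain k where k: "\<forall>m>k. p m = \<zero>\<^bsub>R\<^esub>" using p by (auto simp: UP_carrier_iff)
  have q: "q \<in> carrier (UP R)"
    using c k by (auto simp: UP_carrier_iff q_def intro!: exI[of _ k])
  \<comment> \<open>Equality fails for constant \<open>p\<close>, where both degrees are zero; the
    padded sum takes care of this.\<close>
  have "deg R p \<le> Suc (deg R q)"
  proof (rule U.deg_aboveI[OF _ p])
    fix m assume "Suc (deg R q) < m"
    then show "upcoeff (UP R) p m = \<zero>\<^bsub>R\<^esub>"
      using U.deg_aboveD[of q "m - 1"] q p by (simp add: coeff_UP q_def)
  qed
  then have "upeval R S \<phi> s p = (\<Oplus>\<^bsub>S\<^esub>i\<in>{..Suc (deg R q)}. \<phi> (p i) \<otimes>\<^bsub>S\<^esub> s [^]\<^bsub>S\<^esub> i)"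
    by (rule eval_eq_sum[OF R p _ s])
  also have "\<dots> = (\<Oplus>\<^bsub>S\<^esub>i\<in>{..deg R q}. \<phi> (p (Suc i)) \<otimes>\<^bsub>S\<^esub> s [^]\<^bsub>S\<^esub> Suc i) \<oplus>\<^bsub>S\<^esub> \<phi> (p 0)"
    using c s by (subst S.finsum_Suc2) (auto simp: Pi_def)
  also have "(\<Oplus>\<^bsub>S\<^esub>i\<in>{..deg R q}. \<phi> (p (Suc i)) \<otimes>\<^bsub>S\<^esub> s [^]\<^bsub>S\<^esub> Suc i)
      = s \<otimes>\<^bsub>S\<^esub> (\<Oplus>\<^bsub>S\<^esub>i\<in>{..deg R q}. \<phi> (p (Suc i)) \<otimes>\<^bsub>S\<^esub> s [^]\<^bsub>S\<^esub> i)"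
    using c s by (subst S.finsum_rdistr) (auto simp: Pi_def S.m_ac intro!: S.finsum_cong')
  also have "(\<Oplus>\<^bsub>S\<^esub>i\<in>{..deg R q}. \<phi> (p (Suc i)) \<otimes>\<^bsub>S\<^esub> s [^]\<^bsub>S\<^esub> i) = upeval R S \<phi> s q"
    unfolding eval_eq_sum[OF R q order.refl s] by (simp add: q_def)
  finally show thesis
    using that[of q] q c s eval_closed[OF R s q] by (simp add: q_def S.a_comm)
qed

lemma (in ideal) finsum_mem:
  assumes "f \<in> A \<rightarrow> I"
  shows "finsum R f A \<in> I"
  using assms
proof (induct A rule: infinite_finite_induct)
  case (insert x A)
  then have "f \<in> A \<rightarrow> carrier R" "f x \<in> carrier R" using Icarr by blast+
  then show ?case using insert by simp
qed simp_all

lemma (in ideal) rcos_eq_zero_iff: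
  assumes "x \<in> carrier R"
  shows "I +> x = \<zero>\<^bsub>R Quot I\<^esub> \<longleftrightarrow> x \<in> I"
proof -
  have "\<zero>\<^bsub>R Quot I\<^esub> = I" by (simp add: FactRing_def)
  then show ?thesis using assms rcos_const_imp_mem a_rcos_zero[OF is_ideal] by metis
qed

text \<open>Take \<open>Q\<close> maximal among the ideals that avoid the image of the complement of
  \<open>M\<close>; its preimage lies in \<open>M\<close>. If some \<open>r\<close> in
  \<open>M\<close> had its image outside \<open>Q\<close>, maximality would give
  \<open>\<phi> a\<close>, with \<open>a\<close> outside \<open>M\<close>, congruent to
  \<open>s\<close> times \<open>\<phi> r\<close> modulo \<open>Q\<close>. A monic equation of
  \<open>s\<close>, homogenized in \<open>a\<close> and \<open>r\<close>, then puts a power of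
  \<open>a\<close> into \<open>M\<close>.\<close>

lemma lying_over:
  assumes \<phi>: "ring_hom_cring R S \<phi>" and int: "integral_over R S \<phi>" and M: "primeideal M R"
    and ker: "\<And>r. r \<in> carrier R \<Longrightarrow> \<phi> r = \<zero>\<^bsub>S\<^esub> \<Longrightarrow> r \<in> M"
  obtains Q where "primeideal Q S" and "\<And>r. r \<in> carrier R \<Longrightarrow> \<phi> r \<in> Q \<longleftrightarrow> r \<in> M"
proof -
  interpret f: ring_hom_cring R S \<phi> by fact
  interpret M: primeideal M R by fact
  let ?N = "\<phi> ` (carrier R - M)"
  obtain Q where Q: "primeideal Q S" "Q \<inter> ?N = {}"
    and max: "\<And>x. x \<in> carrier S \<Longrightarrow> x \<notin> Q \<Longrightarrow> \<exists>q\<in>Q. \<exists>r\<in>carrier S. q \<oplus>\<^bsub>S\<^esub> r \<otimes>\<^bsub>S\<^esub> x \<in> ?N"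
  proof (rule f.S.exists_prime_disjoint[OF f.S.zeroideal, of ?N])
    show "?N \<subseteq> carrier S" by auto
    show "\<one>\<^bsub>S\<^esub> \<in> ?N"
      using M.one_imp_carrier M.I_notcarr by (intro rev_image_eqI[of "\<one>\<^bsub>R\<^esub>"]) auto
    show "x \<otimes>\<^bsub>S\<^esub> y \<in> ?N" if xy: "x \<in> ?N" "y \<in> ?N" for x y
    proof -
      obtain a b where ab: "a \<in> carrier R - M" "b \<in> carrier R - M" "x = \<phi> a" "y = \<phi> b" using xy by blast
      then have "a \<otimes>\<^bsub>R\<^esub> b \<in> carrier R - M" using M.I_prime by auto
      moreover have "x \<otimes>\<^bsub>S\<^esub> y = \<phi> (a \<otimes>\<^bsub>R\<^esub> b)" using ab by simp
      ultimately show ?thesis by blast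
    qed
    show "{\<zero>\<^bsub>S\<^esub>} \<inter> ?N = {}" using ker by (auto dest: sym)
  qed blast
  interpret Q: primeideal Q S by fact
  let ?T = "S Quot Q"
  interpret T: "domain" ?T by (rule Q.quotient_is_domain)
  interpret g: ring_hom_cring S ?T "(+>\<^bsub>S\<^esub>) Q" by (rule Q.rcos_ring_hom_cring)
  have gf: "ring_hom_cring R ?T ((+>\<^bsub>S\<^esub>) Q \<circ> \<phi>)" by (rule ring_hom_cring_trans) unfold_locales
  interpret gf: ring_hom_cring R ?T "(+>\<^bsub>S\<^esub>) Q \<circ> \<phi>" by fact
  have z: "Q +>\<^bsub>S\<^esub> x = \<zero>\<^bsub>?T\<^esub> \<longleftrightarrow> x \<in> Q" if "x \<in> carrier S" for x
    by (rule Q.rcos_eq_zero_iff[OF that])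
  have QM: "r \<in> M" if r: "r \<in> carrier R" "\<phi> r \<in> Q" for r using Q(2) r by blast
  have "\<phi> r \<in> Q" if r: "r \<in> carrier R" "r \<in> M" for r
  proof (rule ccontr)
    assume "\<phi> r \<notin> Q"
    then obtain q s a where qs: "q \<in> Q" "s \<in> carrier S" and a: "a \<in> carrier R" "a \<notin> M"
      and e: "q \<oplus>\<^bsub>S\<^esub> s \<otimes>\<^bsub>S\<^esub> \<phi> r = \<phi> a" using max[of "\<phi> r"] r by auto
    let ?g = "(+>\<^bsub>S\<^esub>) Q \<circ> \<phi>" and ?t = "Q +>\<^bsub>S\<^esub> s"
    have t: "?t \<in> carrier ?T" using qs by simp
    have ga: "?g a = ?t \<otimes>\<^bsub>?T\<^esub> ?g r"
      using g.hom_add[of q "s \<otimes>\<^bsub>S\<^esub> \<phi> r"] z[of q] qs r Q.Icarr by (simp add: e)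
    obtain p where p: "monic_poly R p" "upeval R S \<phi> s p = \<zero>\<^bsub>S\<^esub>"
      using int qs unfolding integral_over_def by blast
    note pc = monic_polyD[OF p(1)]
    have pi: "p i \<in> carrier R" for i using pc(1) by (simp add: UP_carrier_iff)
    let ?n = "deg R p"
    \<comment> \<open>The terms of the monic equation homogenized to degree \<open>?n\<close>.
      Modulo \<open>Q\<close> their sum is the \<open>?n\<close>-th power of the image of
      \<open>r\<close> times the value of \<open>p\<close> at \<open>s\<close>, hence zero.\<close>
    define c where "c = (\<lambda>i. p i \<otimes>\<^bsub>R\<^esub> r [^]\<^bsub>R\<^esub> (?n - i) \<otimes>\<^bsub>R\<^esub> a [^]\<^bsub>R\<^esub> i)"
    have cc: "c i \<in> carrier R" for i using pi r a by (simp add: c_def)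
    have "?g (c i) = ?g r [^]\<^bsub>?T\<^esub> ?n \<otimes>\<^bsub>?T\<^esub> (?g (p i) \<otimes>\<^bsub>?T\<^esub> ?t [^]\<^bsub>?T\<^esub> i)" if "i \<le> ?n" for i
    proof -
      have cl: "?g (p i) \<in> carrier ?T" "?g r \<in> carrier ?T" using pi r by auto
      have "?g (c i) = ?g (p i) \<otimes>\<^bsub>?T\<^esub> ?g r [^]\<^bsub>?T\<^esub> (?n - i) \<otimes>\<^bsub>?T\<^esub> (?g a) [^]\<^bsub>?T\<^esub> i"
        unfolding c_def using pi r a by (simp only: gf.hom_mult gf.hom_pow f.R.m_closed f.R.nat_pow_closed)
      also have "\<dots> = ?g (p i) \<otimes>\<^bsub>?T\<^esub> ?g r [^]\<^bsub>?T\<^esub> (?n - i) \<otimes>\<^bsub>?T\<^esub> (?t [^]\<^bsub>?T\<^esub> i \<otimes>\<^bsub>?T\<^esub> ?g r [^]\<^bsub>?T\<^esub> i)"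
        unfolding ga by (simp only: T.nat_pow_distrib[OF t cl(2)])
      also have "\<dots> = (?g r [^]\<^bsub>?T\<^esub> (?n - i) \<otimes>\<^bsub>?T\<^esub> ?g r [^]\<^bsub>?T\<^esub> i) \<otimes>\<^bsub>?T\<^esub> (?g (p i) \<otimes>\<^bsub>?T\<^esub> ?t [^]\<^bsub>?T\<^esub> i)"
        using cl t by (simp only: T.m_ac T.m_closed T.nat_pow_closed)
      finally show ?thesis using that T.nat_pow_mult[OF cl(2), of "?n - i" i] by (simp only: le_add_diff_inverse2)
    qed
    note gc = this
    have "?g (finsum R c {..?n}) = finsum ?T (\<lambda>i. ?g (c i)) {..?n}"
      using cc by (subst gf.hom_finsum) (auto simp: comp_def)
    also have "\<dots> = finsum ?T (\<lambda>i. ?g r [^]\<^bsub>?T\<^esub> ?n \<otimes>\<^bsub>?T\<^esub> (?g (p i) \<otimes>\<^bsub>?T\<^esub> ?t [^]\<^bsub>?T\<^esub> i)) {..?n}"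
      by (rule T.finsum_cong') (use gc t r pi gf.hom_closed in \<open>auto simp del: comp_apply\<close>)
    also have "\<dots> = ?g r [^]\<^bsub>?T\<^esub> ?n \<otimes>\<^bsub>?T\<^esub> finsum ?T (\<lambda>i. ?g (p i) \<otimes>\<^bsub>?T\<^esub> ?t [^]\<^bsub>?T\<^esub> i) {..?n}"
      by (rule T.finsum_rdistr[symmetric]) (use t r pi gf.hom_closed in \<open>auto simp del: comp_apply\<close>)
    also have "finsum ?T (\<lambda>i. ?g (p i) \<otimes>\<^bsub>?T\<^esub> ?t [^]\<^bsub>?T\<^esub> i) {..?n} = upeval R ?T ?g ?t p"
      by (rule eval_eq_sum[OF gf pc(1) order.refl t, symmetric])
    also have "\<dots> = \<zero>\<^bsub>?T\<^esub>"
      using hom_eval[OF \<phi> g.ring_hom_cring_axioms pc(1) qs(2)] p(2) by simp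
    finally have "?g (finsum R c {..?n}) = \<zero>\<^bsub>?T\<^esub>" 
      using T.r_null[OF T.nat_pow_closed[OF gf.hom_closed[OF r(1)]]] by simp
    moreover have fc: "finsum R c {..?n} \<in> carrier R" using cc by (intro f.R.finsum_closed) auto
    ultimately have "\<phi> (finsum R c {..?n}) \<in> Q" using z[OF f.hom_closed[OF fc]] by (simp only: comp_apply)
    then have cM: "finsum R c {..?n} \<in> M" using QM fc by simp
    \<comment> \<open>All terms but the leading one contain a factor \<open>r\<close>, so the
      leading one, a power of \<open>a\<close>, is forced into \<open>M\<close> as well.\<close>
    have "c i \<in> M" if "i < ?n" for i
    proof -
      obtain k where k: "?n - i = Suc k" using \<open>i < ?n\<close> by (metis Suc_diff_Suc)
      have "c i = (p i \<otimes>\<^bsub>R\<^esub> r [^]\<^bsub>R\<^esub> k \<otimes>\<^bsub>R\<^esub> a [^]\<^bsub>R\<^esub> i) \<otimes>\<^bsub>R\<^esub> r"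
        unfolding c_def k using pi r a by (simp add: f.R.m_ac)
      then show ?thesis using pi r a by (simp add: M.I_l_closed)
    qed
    then have s: "finsum R c {..<?n} \<in> M" by (intro M.finsum_mem) auto
    have "finsum R c {..?n} = c ?n \<oplus>\<^bsub>R\<^esub> finsum R c {..<?n}"
      using cc by (simp add: lessThan_Suc_atMost[symmetric] lessThan_Suc Pi_def)
    then have "c ?n \<oplus>\<^bsub>R\<^esub> finsum R c {..<?n} \<oplus>\<^bsub>R\<^esub> \<ominus>\<^bsub>R\<^esub> finsum R c {..<?n} \<in> M"
      using cM s M.a_closed M.a_inv_closed by auto
    then have "c ?n \<in> M" using cc[of ?n] M.Icarr[OF s] by (simp add: f.R.a_assoc f.R.r_neg)
    moreover have "c ?n = a [^]\<^bsub>R\<^esub> ?n" using pc(2) a by (simp add: c_def)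
    ultimately show False using primeideal_pow[OF M a(1)] a(2) by simp
  qed
  then show thesis using that Q(1) QM by blast
qed

text \<open>The conclusion says that \<open>u\<close> has a non-zero multiple in the image of
  \<open>R\<close>, with a cofactor that is a polynomial in \<open>u\<close>. Powers of
  \<open>u\<close> are cancelled from the equation until the constant term survives; the index
  \<open>n\<close> of a surviving coefficient bounds the number of cancellations.\<close>

lemma integral_const_term:
  assumes \<phi>: "ring_hom_cring R S \<phi>" and "domain S" and u: "u \<in> carrier S" "u \<noteq> \<zero>\<^bsub>S\<^esub>"
    and p: "p \<in> carrier (UP R)" "\<phi> (p n) \<noteq> \<zero>\<^bsub>S\<^esub>" "upeval R S \<phi> u p = \<zero>\<^bsub>S\<^esub>"
  obtains r q where "r \<in> carrier R" and "q \<in> carrier (UP R)" and "\<phi> r \<noteq> \<zero>\<^bsub>S\<^esub>"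
    and "\<phi> r \<oplus>\<^bsub>S\<^esub> u \<otimes>\<^bsub>S\<^esub> upeval R S \<phi> u q = \<zero>\<^bsub>S\<^esub>"
proof -
  interpret S: "domain" S by fact
  interpret f: ring_hom_cring R S \<phi> by fact
  have "\<exists>r\<in>carrier R. \<exists>q\<in>carrier (UP R). \<phi> r \<noteq> \<zero>\<^bsub>S\<^esub> \<and> \<phi> r \<oplus>\<^bsub>S\<^esub> u \<otimes>\<^bsub>S\<^esub> upeval R S \<phi> u q = \<zero>\<^bsub>S\<^esub>"
    using p
  proof (induct n arbitrary: p)
    case 0
    then have "p 0 \<in> carrier R" by (simp add: UP_carrier_iff)
    then show ?case using eval_const_term[OF \<phi> 0(1) u(1)] 0 by metis
  next
    case (Suc n)
    obtain q where q: "q \<in> carrier (UP R)" "\<And>n. q n = p (Suc n)"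
      and e: "upeval R S \<phi> u p = \<phi> (p 0) \<oplus>\<^bsub>S\<^esub> u \<otimes>\<^bsub>S\<^esub> upeval R S \<phi> u q"
      using eval_const_term[OF \<phi> Suc(2) u(1)] by metis
    have p0: "p 0 \<in> carrier R" using Suc by (simp add: UP_carrier_iff)
    show ?case
    proof (cases "\<phi> (p 0) = \<zero>\<^bsub>S\<^esub>")
      \<comment> \<open>The constant term dies, so the non-zero \<open>u\<close> can be cancelled;
        the distinguished coefficient moves down by one place.\<close>
      case True
      have ec: "upeval R S \<phi> u q \<in> carrier S" by (rule eval_closed[OF \<phi> u(1) q(1)])
      then have "u \<otimes>\<^bsub>S\<^esub> upeval R S \<phi> u q = \<zero>\<^bsub>S\<^esub>" using e True Suc(4) u by simp
      then have "upeval R S \<phi> u q = \<zero>\<^bsub>S\<^esub>" using u S.integral ec by blast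
      then show ?thesis using Suc(1)[OF q(1)] q(2)[of n] Suc(3) by metis
    next
      case False
      then show ?thesis using e p0 q(1) Suc(4) by metis
    qed
  qed
  then show thesis using that by blast
qed

text \<open>A divisor of positive degree of a split polynomial has a root among the listed ones. The
  constant \<open>c\<close> is present because divisibility will come from pseudo-division. If
  \<open>a n\<close> is a root of \<open>q\<close> rather than of \<open>p\<close>, its linear
  factor is cancelled; without linear factors left, degrees add up to a contradiction.\<close>

lemma linear_factors_divisor_root:
  assumes "domain T" and c: "c \<in> carrier T" "c \<noteq> \<zero>\<^bsub>T\<^esub>" and a: "a \<in> {..<n::nat} \<rightarrow> carrier T"
    and p: "p \<in> carrier (UP T)" "deg T p > 0" and q: "q \<in> carrier (UP T)"
    and e: "c \<odot>\<^bsub>UP T\<^esub> (\<Otimes>\<^bsub>UP T\<^esub>i\<in>{..<n}. lin T (a i)) = p \<otimes>\<^bsub>UP T\<^esub> q"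
  shows "\<exists>i<n. upeval T T id (a i) p = \<zero>\<^bsub>T\<^esub>"
  using a q e
proof (induct n arbitrary: q)
  interpret T: "domain" T by fact
  interpret U: UP_domain T "UP T" by unfold_locales simp
  {
    case 0
    have pn: "p \<noteq> \<zero>\<^bsub>UP T\<^esub>" using p by auto
    have m: "p \<otimes>\<^bsub>UP T\<^esub> q = monom (UP T) c 0"
      using 0 c U.monom_mult_is_smult[of c "\<one>\<^bsub>UP T\<^esub>"] by simp
    have "monom (UP T) c 0 \<noteq> \<zero>\<^bsub>UP T\<^esub>"
      using c U.coeff_monom[of c 0 0] U.coeff_zero[of 0] by metis
    then have "q \<noteq> \<zero>\<^bsub>UP T\<^esub>" using m p by auto
    then have "deg T p + deg T q = 0" using U.deg_mult[OF pn _ p(1) 0(2)] m c by simp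
    then show ?case using p by simp
  next
    case (Suc n)
    have an: "a n \<in> carrier T" and a': "a \<in> {..<n} \<rightarrow> carrier T" using Suc(2) by auto
    have idh: "ring_hom_cring T T id" by unfold_locales (simp add: ring_hom_def)
    interpret ev: ring_hom_cring "UP T" T "upeval T T id (a n)" by (rule eval_hom[OF idh an])
    let ?P = "\<Otimes>\<^bsub>UP T\<^esub>i\<in>{..<n}. lin T (a i)"
    have l: "lin T (a i) \<in> carrier (UP T)" if "i < Suc n" for i
      using Suc(2) that lin_closed[OF T.is_cring] by auto
    have Pc: "?P \<in> carrier (UP T)" by (rule U.P.finprod_closed) (use l in auto)
    have P: "(\<Otimes>\<^bsub>UP T\<^esub>i\<in>{..<Suc n}. lin T (a i)) = lin T (a n) \<otimes>\<^bsub>UP T\<^esub> ?P"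
      unfolding lessThan_Suc by (rule U.P.finprod_insert) (use l in auto)
    have ln: "lin T (a n) \<in> carrier (UP T)" using l by simp
    have evl: "upeval T T id (a n) (lin T (a n)) = \<zero>\<^bsub>T\<^esub>"
      using eval_lin[OF idh an an] an by (simp add: T.minus_eq T.r_neg)
    show ?case
    proof (cases "upeval T T id (a n) p = \<zero>\<^bsub>T\<^esub>")
      \<comment> \<open>In the domain \<open>T\<close> the other factor \<open>q\<close> must vanish
        at \<open>a n\<close>, and \<open>lin T (a n)\<close> can be cancelled on both
        sides.\<close>
      case False
      have eq: "p \<otimes>\<^bsub>UP T\<^esub> q = lin T (a n) \<otimes>\<^bsub>UP T\<^esub> (c \<odot>\<^bsub>UP T\<^esub> ?P)"
        using Suc(4) unfolding P using U.UP_smult_assoc2 c ln Pc by (metis U.P.m_comm U.UP_smult_closed)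
      have "upeval T T id (a n) (p \<otimes>\<^bsub>UP T\<^esub> q) = \<zero>\<^bsub>T\<^esub>"
        unfolding eq using ln Pc c evl ev.hom_closed by (simp only: ev.hom_mult U.UP_smult_closed T.l_null)
      then have "upeval T T id (a n) p \<otimes>\<^bsub>T\<^esub> upeval T T id (a n) q = \<zero>\<^bsub>T\<^esub>" using p Suc(3) by simp
      then have eq0: "upeval T T id (a n) q = \<zero>\<^bsub>T\<^esub>"
        using False p Suc(3) T.integral ev.hom_closed by blast
      have nt: "carrier T \<noteq> {\<zero>\<^bsub>T\<^esub>}" using T.one_not_zero T.one_closed by blast
      obtain q' where q': "q' \<in> carrier (UP T)" "q = lin T (a n) \<otimes>\<^bsub>UP T\<^esub> q' \<oplus>\<^bsub>UP T\<^esub> monom (UP T) (upeval T T id (a n) q) 0"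
        using U.remainder_theorem[OF Suc(3) an nt] unfolding lin_def by blast
      then have qq: "q = lin T (a n) \<otimes>\<^bsub>UP T\<^esub> q'" using eq0 ln by simp
      have lnz: "lin T (a n) \<noteq> \<zero>\<^bsub>UP T\<^esub>"
        using U.deg_monom_minus[OF an nt] unfolding lin_def by auto
      have "lin T (a n) \<otimes>\<^bsub>UP T\<^esub> (p \<otimes>\<^bsub>UP T\<^esub> q') = lin T (a n) \<otimes>\<^bsub>UP T\<^esub> (c \<odot>\<^bsub>UP T\<^esub> ?P)"
        using eq p q' ln unfolding qq by (simp add: U.P.m_lcomm)
      then have "c \<odot>\<^bsub>UP T\<^esub> ?P = p \<otimes>\<^bsub>UP T\<^esub> q'"
        using U.m_lcancel[OF lnz ln] p q' c Pc by simp
      then show ?thesis using Suc(1)[OF a' q'(1)] by (meson less_SucI)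
    qed (use Suc(2) in blast)
  }
qed

section \<open>Homomorphisms into absolutely integrally closed domains\<close>

lemma RDirProd_simps:
  "carrier (RDirProd R S) = carrier R \<times> carrier S"
  "\<one>\<^bsub>RDirProd R S\<^esub> = (\<one>\<^bsub>R\<^esub>, \<one>\<^bsub>S\<^esub>)"
  "\<zero>\<^bsub>RDirProd R S\<^esub> = (\<zero>\<^bsub>R\<^esub>, \<zero>\<^bsub>S\<^esub>)"
  "x \<oplus>\<^bsub>RDirProd R S\<^esub> y = (fst x \<oplus>\<^bsub>R\<^esub> fst y, snd x \<oplus>\<^bsub>S\<^esub> snd y)"
  "x \<otimes>\<^bsub>RDirProd R S\<^esub> y = (fst x \<otimes>\<^bsub>R\<^esub> fst y, snd x \<otimes>\<^bsub>S\<^esub> snd y)"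
  by (auto simp: RDirProd_def DirProd_def monoid.defs split: prod.split)

lemma RDirProd_cring:
  assumes "cring R" and "cring S"
  shows "cring (RDirProd R S)"
proof -
  interpret R: cring R by fact
  interpret S: cring S by fact
  interpret ring "RDirProd R S" by (rule RDirProd_ring) unfold_locales
  show ?thesis by unfold_locales (auto simp: RDirProd_simps R.m_comm S.m_comm)
qed

text \<open>The situation after \<open>S\<close> is divided by a prime lying over the kernel of
  \<open>\<psi>\<close>. It resembles the extension of an embedding along an algebraic field
  extension, but with domains in place of fields.\<close>

locale integral_pair = S?: "domain" S + T?: "domain" T
  for R :: "('a, 'm) ring_scheme" and S :: "('b, 'n) ring_scheme" and T :: "('c, 'k) ring_scheme" +
  fixes \<phi> :: "'a \<Rightarrow> 'b" and \<psi> :: "'a \<Rightarrow> 'c"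
  assumes phi: "ring_hom_cring R S \<phi>" and psi: "ring_hom_cring R T \<psi>"
    and integral: "integral_over R S \<phi>" and ai_closed: "ai_closed T"
    and same_ker: "r \<in> carrier R \<Longrightarrow> \<phi> r = \<zero>\<^bsub>S\<^esub> \<longleftrightarrow> \<psi> r = \<zero>\<^bsub>T\<^esub>"
begin

interpretation phi: ring_hom_cring R S \<phi> by (rule phi)
interpretation psi: ring_hom_cring R T \<psi> by (rule psi)

abbreviation "D \<equiv> RDirProd S T"
abbreviation "\<chi> r \<equiv> (\<phi> r, \<psi> r)"

text \<open>Graphs of homomorphisms to \<open>T\<close> from subrings of \<open>S\<close> that
  contain the image of \<open>R\<close>; the last condition is single-valuedness, by additivity. As
  subrings of \<open>S \<times> T\<close> they are ordered by inclusion, and unions of chains need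
  no bookkeeping of domains.\<close>

definition partial_graph :: "('b \<times> 'c) set \<Rightarrow> bool"
  where "partial_graph B \<longleftrightarrow> subring B D \<and> \<chi> ` carrier R \<subseteq> B \<and> (\<forall>t. (\<zero>\<^bsub>S\<^esub>, t) \<in> B \<longrightarrow> t = \<zero>\<^bsub>T\<^esub>)"

interpretation D: cring D
  by (rule RDirProd_cring) unfold_locales

lemma graph_cring:
  assumes "subring B D" shows "cring (D\<lparr>carrier := B\<rparr>)"
  using D.subcring_iff[OF subringE(1)[OF assms]] D.subcringI'[OF assms] by simp

lemma fst_hom:
  assumes "subring B D" shows "ring_hom_cring (D\<lparr>carrier := B\<rparr>) S fst"
  by (rule UnivPoly.ring_hom_cringI[OF graph_cring[OF assms]])
    (use subringE(1)[OF assms] in \<open>auto simp: RDirProd_simps S.is_cring intro!: ring_hom_memI\<close>)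

lemma snd_hom:
  assumes "subring B D" shows "ring_hom_cring (D\<lparr>carrier := B\<rparr>) T snd"
  by (rule UnivPoly.ring_hom_cringI[OF graph_cring[OF assms]])
    (use subringE(1)[OF assms] in \<open>auto simp: RDirProd_simps T.is_cring intro!: ring_hom_memI\<close>)

lemma chi_hom:
  assumes "subring B D" and "\<chi> ` carrier R \<subseteq> B"
  shows "ring_hom_cring R (D\<lparr>carrier := B\<rparr>) \<chi>"
  by (rule UnivPoly.ring_hom_cringI[OF phi.R.is_cring graph_cring[OF assms(1)]])
    (use assms(2) in \<open>auto simp: RDirProd_simps intro!: ring_hom_memI\<close>)

text \<open>Integrality makes the partial homomorphisms injective: a non-zero \<open>u\<close> in
  the kernel has a non-zero multiple \<open>\<phi> r\<close>, and then
  \<open>(\<zero>, \<psi> r)\<close> lies in the graph, so \<open>r\<close> is in one kernel but not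
  in the other.\<close>

lemma partial_graph_inj:
  assumes B: "partial_graph B" and u: "(u, \<zero>\<^bsub>T\<^esub>) \<in> B"
  shows "u = \<zero>\<^bsub>S\<^esub>"
proof (rule ccontr)
  assume nz: "u \<noteq> \<zero>\<^bsub>S\<^esub>"
  have sB: "subring B D" and cB: "\<chi> ` carrier R \<subseteq> B" 
    and zB: "\<And>t. (\<zero>\<^bsub>S\<^esub>, t) \<in> B \<Longrightarrow> t = \<zero>\<^bsub>T\<^esub>"
    using B unfolding partial_graph_def by auto
  let ?B = "D\<lparr>carrier := B\<rparr>"
  interpret p: ring_hom_cring ?B S fst by (rule fst_hom[OF sB])
  interpret q: ring_hom_cring ?B T snd by (rule snd_hom[OF sB])
  note chi = chi_hom[OF sB cB]
  interpret c: ring_hom_cring R ?B \<chi> by (rule chi)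
  have uS: "u \<in> carrier S" using subringE(1)[OF sB] u by (auto simp: RDirProd_simps)
  obtain p where p: "monic_poly R p" "upeval R S \<phi> u p = \<zero>\<^bsub>S\<^esub>"
    using integral uS unfolding integral_over_def by blast
  have "\<phi> (p (deg R p)) \<noteq> \<zero>\<^bsub>S\<^esub>" using monic_polyD[OF p(1)] by simp
  then obtain r q where r: "r \<in> carrier R" "q \<in> carrier (UP R)" "\<phi> r \<noteq> \<zero>\<^bsub>S\<^esub>"
    "\<phi> r \<oplus>\<^bsub>S\<^esub> u \<otimes>\<^bsub>S\<^esub> upeval R S \<phi> u q = \<zero>\<^bsub>S\<^esub>"
    using integral_const_term[OF phi S.domain_axioms uS nz monic_polyD(1)[OF p(1)] _ p(2)] by metis
  have w: "(u, \<zero>\<^bsub>T\<^esub>) \<in> carrier ?B" using u by simp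
  let ?v = "upeval R ?B \<chi> (u, \<zero>\<^bsub>T\<^esub>) q"
  have v: "?v \<in> carrier ?B" by (rule eval_closed[OF chi w r(2)])
  have fv: "fst ?v = upeval R S \<phi> u q"
    using hom_eval[OF chi p.ring_hom_cring_axioms r(2) w] by (simp add: comp_def)
  have sv: "snd ?v \<in> carrier T" using q.hom_closed[OF v] .
  have "\<chi> r \<oplus>\<^bsub>?B\<^esub> (u, \<zero>\<^bsub>T\<^esub>) \<otimes>\<^bsub>?B\<^esub> ?v \<in> carrier ?B"
    using c.hom_closed[OF r(1)] w v by (intro p.R.a_closed p.R.m_closed)
  moreover have "\<chi> r \<oplus>\<^bsub>?B\<^esub> (u, \<zero>\<^bsub>T\<^esub>) \<otimes>\<^bsub>?B\<^esub> ?v = (\<zero>\<^bsub>S\<^esub>, \<psi> r)"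
    using r sv fv by (simp add: RDirProd_simps)
  ultimately have "(\<zero>\<^bsub>S\<^esub>, \<psi> r) \<in> B" by simp
  then show False using zB r same_ker by blast
qed

text \<open>The element \<open>s\<close> is adjoined by choosing an image \<open>t\<close>. A
  polynomial of least degree over \<open>B\<close> that kills \<open>s\<close> serves as minimal
  polynomial, \<open>t\<close> is a root of its image over \<open>T\<close>, and pseudo-division
  shows that the relations of \<open>s\<close> are relations of \<open>t\<close>.\<close>

lemma partial_graph_extend:
  assumes B: "partial_graph B" and s: "s \<in> carrier S"
  obtains B' where "partial_graph B'" and "B \<subseteq> B'" and "s \<in> fst ` B'"
proof -
  have sB: "subring B D" and cB: "\<chi> ` carrier R \<subseteq> B" 
    and zB: "\<And>t. (\<zero>\<^bsub>S\<^esub>, t) \<in> B \<Longrightarrow> t = \<zero>\<^bsub>T\<^esub>"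
    using B unfolding partial_graph_def by auto
  let ?B = "D\<lparr>carrier := B\<rparr>"
  interpret p1: ring_hom_cring ?B S fst by (rule fst_hom[OF sB])
  interpret p2: ring_hom_cring ?B T snd by (rule snd_hom[OF sB])
  note p1 = p1.ring_hom_cring_axioms and p2 = p2.ring_hom_cring_axioms
  note chi = chi_hom[OF sB cB]
  interpret c: ring_hom_cring R ?B \<chi> by (rule chi)
  interpret U: UP_cring ?B "UP ?B" by unfold_locales simp
  interpret V: UP_domain T "UP T" by unfold_locales simp
  interpret e1: ring_hom_cring "UP ?B" S "upeval ?B S fst s" by (rule eval_hom[OF p1 s])
  \<comment> \<open>A non-zero element of \<open>B\<close> has two non-zero coordinates, so
    non-vanishing passes between \<open>B\<close>, \<open>S\<close> and \<open>T\<close>.\<close>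
  have zero: "b = \<zero>\<^bsub>?B\<^esub>" if "b \<in> B" "fst b = \<zero>\<^bsub>S\<^esub> \<or> snd b = \<zero>\<^bsub>T\<^esub>" for b
    using that zB[of "snd b"] partial_graph_inj[OF B, of "fst b"] by (cases b) (auto simp: RDirProd_simps)
  obtain g where g: "monic_poly R g" "upeval R S \<phi> s g = \<zero>\<^bsub>S\<^esub>"
    using integral s unfolding integral_over_def by blast
  note gc = monic_polyD(1)[OF g(1)]
  have nt: "\<one>\<^bsub>?B\<^esub> \<noteq> \<zero>\<^bsub>?B\<^esub>" by (simp add: RDirProd_simps)
  note mg = monic_upmap[OF chi nt g(1)]
  let ?g = "upmap \<chi> g"
  note gB = monic_polyD[OF mg(1)]
  have eg: "upeval ?B S fst s ?g = \<zero>\<^bsub>S\<^esub>"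
    using eval_upmap[OF chi p1 gc s] g(2) by (simp add: comp_def)
  have "?g \<noteq> \<zero>\<^bsub>UP ?B\<^esub>" using gB(2) nt U.deg_zero by (auto simp: UP_def)
  then have X: "?g \<in> carrier (UP ?B) \<and> ?g \<noteq> \<zero>\<^bsub>UP ?B\<^esub> \<and> upeval ?B S fst s ?g = \<zero>\<^bsub>S\<^esub>"
    using gB(1) eg by blast
  \<comment> \<open>The substitute for a minimal polynomial; it need not be monic, because
    \<open>B\<close> is not a field.\<close>
  obtain p where p: "p \<in> carrier (UP ?B)" "p \<noteq> \<zero>\<^bsub>UP ?B\<^esub>" "upeval ?B S fst s p = \<zero>\<^bsub>S\<^esub>"
    and least: "\<And>q. q \<in> carrier (UP ?B) \<Longrightarrow> q \<noteq> \<zero>\<^bsub>UP ?B\<^esub> \<Longrightarrow> upeval ?B S fst s q = \<zero>\<^bsub>S\<^esub> \<Longrightarrow>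
      deg ?B p \<le> deg ?B q"
    using ex_has_least_nat[of "\<lambda>p. p \<in> carrier (UP ?B) \<and> p \<noteq> \<zero>\<^bsub>UP ?B\<^esub> \<and> upeval ?B S fst s p = \<zero>\<^bsub>S\<^esub>", OF X]
    by meson
  let ?c = "p (deg ?B p)"
  have cB': "?c \<in> carrier ?B" using p(1) unfolding UP_carrier_iff by blast
  have c0: "?c \<noteq> \<zero>\<^bsub>?B\<^esub>" using U.lcoeff_nonzero[OF p(2,1)] unfolding coeff_UP[OF p(1)] .
  \<comment> \<open>The remainder of the pseudo-division also kills \<open>s\<close> and has smaller
    degree, so it is zero by the choice of \<open>p\<close>.\<close>
  have division: "\<exists>k::nat. \<exists>q\<in>carrier (UP ?B). ?c [^]\<^bsub>?B\<^esub> k \<odot>\<^bsub>UP ?B\<^esub> f = p \<otimes>\<^bsub>UP ?B\<^esub> q"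
    if f: "f \<in> carrier (UP ?B)" "upeval ?B S fst s f = \<zero>\<^bsub>S\<^esub>" for f
  proof -
    obtain q r k where q: "q \<in> carrier (UP ?B)" "r \<in> carrier (UP ?B)"
      "?c [^]\<^bsub>?B\<^esub> (k::nat) \<odot>\<^bsub>UP ?B\<^esub> f = p \<otimes>\<^bsub>UP ?B\<^esub> q \<oplus>\<^bsub>UP ?B\<^esub> r"
      "r = \<zero>\<^bsub>UP ?B\<^esub> \<or> deg ?B r < deg ?B p"
      using U.long_div_theorem[OF p(1) f(1) p(2), unfolded coeff_UP[OF p(1)]]
      by (elim exE conjE) (rule that; assumption)
    have ck: "?c [^]\<^bsub>?B\<^esub> k \<in> carrier ?B" using cB' by (rule p1.R.nat_pow_closed)
    have "?c [^]\<^bsub>?B\<^esub> k \<odot>\<^bsub>UP ?B\<^esub> f = up_ring.monom (UP ?B) (?c [^]\<^bsub>?B\<^esub> k) 0 \<otimes>\<^bsub>UP ?B\<^esub> f"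
      using U.monom_mult_is_smult[OF ck f(1)] by simp
    then have "upeval ?B S fst s (?c [^]\<^bsub>?B\<^esub> k \<odot>\<^bsub>UP ?B\<^esub> f) = \<zero>\<^bsub>S\<^esub>"
      using e1.hom_mult[OF U.monom_closed[OF ck] f(1)] f(2) e1.hom_closed[OF U.monom_closed[OF ck]] by simp
    then have "upeval ?B S fst s r = \<zero>\<^bsub>S\<^esub>"
      unfolding q(3) using p(1,3) q(1,2) e1.hom_closed[OF q(1)] e1.hom_closed[OF q(2)] by simp
    then have "r = \<zero>\<^bsub>UP ?B\<^esub>" using least[OF q(2)] q(4) leD by blast
    then show ?thesis using q p(1) by auto
  qed
  have ev_smult: "upeval ?B T snd t (a \<odot>\<^bsub>UP ?B\<^esub> f) = snd a \<otimes>\<^bsub>T\<^esub> upeval ?B T snd t f"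
    if "t \<in> carrier T" "a \<in> carrier ?B" "f \<in> carrier (UP ?B)" for t a f
  proof -
    interpret W: UP_pre_univ_prop ?B T snd "UP ?B" by unfold_locales
    interpret e2: ring_hom_cring "UP ?B" T "upeval ?B T snd t" by (rule eval_hom[OF p2 that(1)])
    show ?thesis
      unfolding U.monom_mult_is_smult[OF that(2,3), symmetric]
      using W.eval_const[OF that(1,2)] e2.hom_mult[OF U.monom_closed[OF that(2)] that(3)] by simp
  qed
  have c2: "snd ?c \<noteq> \<zero>\<^bsub>T\<^esub>" using zero[of ?c] cB' c0 by auto
  then have d2: "deg T (upmap snd p) = deg ?B p" by (rule deg_upmap[OF p2 p(1)])
  have ck2: "snd (?c [^]\<^bsub>?B\<^esub> k) = snd ?c [^]\<^bsub>T\<^esub> k" for k :: nat by (rule p2.hom_pow[OF cB'])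
  have c2T: "snd ?c \<in> carrier T" by (rule p2.hom_closed[OF cB'])
  have c2k: "snd ?c [^]\<^bsub>T\<^esub> k \<noteq> \<zero>\<^bsub>T\<^esub>" for k :: nat
    using c2 c2T by (induct k) (auto simp: T.integral_iff)
  have dp: "deg ?B p > 0"
  proof (rule ccontr)
    assume "\<not> ?thesis"
    interpret W: UP_pre_univ_prop ?B S fst "UP ?B" by unfold_locales
    have "p = up_ring.monom (UP ?B) ?c 0" using \<open>\<not> deg ?B p > 0\<close> U.deg_zero_impl_monom[OF p(1)] by (simp add: coeff_UP[OF p(1)])
    then have "fst ?c = \<zero>\<^bsub>S\<^esub>" using W.eval_const[OF s cB'] p(3) by simp
    then show False using zero[of ?c] cB' c0 by simp
  qed
  \<comment> \<open>Up to a power of its leading coefficient, \<open>p\<close> divides the monic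
    equation \<open>?g\<close> of \<open>s\<close>. The image of \<open>?g\<close> splits over
    \<open>T\<close>, so the image of \<open>p\<close>, being of positive degree, shares a root with
    it.\<close>
  obtain t where t: "t \<in> carrier T" and pt: "upeval ?B T snd t p = \<zero>\<^bsub>T\<^esub>"
  proof -
    interpret u: ring_hom_cring "UP ?B" "UP T" "upmap snd" by (rule upmap_hom[OF p2])
    obtain k q where q: "q \<in> carrier (UP ?B)" "?c [^]\<^bsub>?B\<^esub> (k::nat) \<odot>\<^bsub>UP ?B\<^esub> ?g = p \<otimes>\<^bsub>UP ?B\<^esub> q"
      using division[OF gB(1) eg] by (elim exE bexE) (rule that; assumption)
    have ck: "?c [^]\<^bsub>?B\<^esub> k \<in> carrier ?B" using cB' by (rule p1.R.nat_pow_closed)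
    have gT: "monic_poly T (upmap snd ?g)"
      by (rule monic_upmap(1)[OF p2 _ mg(1)]) simp
    note gTc = monic_polyD(1)[OF gT]
    obtain n :: nat and a where a: "a \<in> {..<n} \<rightarrow> carrier T" "upmap snd ?g = (\<Otimes>\<^bsub>UP T\<^esub>i\<in>{..<n}. lin T (a i))"
      using ai_closedE[OF ai_closed T.is_cring gT] by metis
    have "snd ?c [^]\<^bsub>T\<^esub> k \<odot>\<^bsub>UP T\<^esub> upmap snd ?g = up_ring.monom (UP T) (snd ?c [^]\<^bsub>T\<^esub> k) 0 \<otimes>\<^bsub>UP T\<^esub> upmap snd ?g"
      using V.monom_mult_is_smult[OF T.nat_pow_closed[OF c2T] gTc] by simp
    also have "\<dots> = upmap snd (up_ring.monom (UP ?B) (?c [^]\<^bsub>?B\<^esub> k) 0 \<otimes>\<^bsub>UP ?B\<^esub> ?g)"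
      using u.hom_mult[OF U.monom_closed[OF ck] gB(1)] upmap_monom[OF p2 ck] by (simp only: ck2)
    also have "\<dots> = upmap snd p \<otimes>\<^bsub>UP T\<^esub> upmap snd q"
      using q U.monom_mult_is_smult[OF ck gB(1)] u.hom_mult[OF p(1) q(1)] by (simp only:)
    finally have "\<exists>i<n. upeval T T id (a i) (upmap snd p) = \<zero>\<^bsub>T\<^esub>"
      unfolding a(2) using dp d2 upmap_closed[OF p2 p(1)] upmap_closed[OF p2 q(1)]
      by (intro linear_factors_divisor_root[OF T.domain_axioms T.nat_pow_closed[OF c2T] c2k a(1)]) simp_all
    then obtain i where i: "i < n" "upeval T T id (a i) (upmap snd p) = \<zero>\<^bsub>T\<^esub>" by blast
    have idh: "ring_hom_cring T T id" by unfold_locales (simp add: ring_hom_def)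
    have "a i \<in> carrier T" using a i by auto
    then show thesis using that[of "a i"] i(2) eval_upmap[OF p2 idh p(1)] by simp
  qed
  interpret e2: ring_hom_cring "UP ?B" T "upeval ?B T snd t" by (rule eval_hom[OF p2 t])
  \<comment> \<open>Evaluating at \<open>s\<close> and \<open>t\<close> simultaneously makes the
    image the subring generated by \<open>B\<close> and the pair \<open>(s, t)\<close>.\<close>
  let ?e = "\<lambda>h. (upeval ?B S fst s h, upeval ?B T snd t h)"
  have "?e \<in> ring_hom (UP ?B) D"
    by (rule ring_hom_memI) (simp_all add: RDirProd_simps)
  then have "ring_hom_cring (UP ?B) D ?e"
    by (intro UnivPoly.ring_hom_cringI U.UP_cring D.is_cring)
  then interpret e: ring_hom_cring "UP ?B" D ?e .
  define B' where "B' = ?e ` carrier (UP ?B)"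
  have sB': "subring B' D" unfolding B'_def by (rule e.ring.img_is_subring[OF U.P.carrier_is_subring])
  have BB': "B \<subseteq> B'"
  proof
    fix b assume b: "b \<in> B"
    then have b': "b \<in> carrier ?B" by simp
    interpret W: UP_pre_univ_prop ?B S fst "UP ?B" by unfold_locales
    interpret W2: UP_pre_univ_prop ?B T snd "UP ?B" by unfold_locales
    have "?e (up_ring.monom (UP ?B) b 0) = b" using W.eval_const[OF s b'] W2.eval_const[OF t b'] by simp
    then show "b \<in> B'" unfolding B'_def by (rule image_eqI[OF sym U.monom_closed[OF b']])
  qed
  \<comment> \<open>If \<open>h\<close> kills \<open>s\<close>, a power of \<open>?c\<close> times
    \<open>h\<close> is a multiple of \<open>p\<close>. Evaluation at \<open>t\<close> gives zero,
    and the power of \<open>snd ?c\<close> cancels in the domain \<open>T\<close>.\<close>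
  have "t' = \<zero>\<^bsub>T\<^esub>" if "(\<zero>\<^bsub>S\<^esub>, t') \<in> B'" for t'
  proof -
    obtain h where h: "h \<in> carrier (UP ?B)" "upeval ?B S fst s h = \<zero>\<^bsub>S\<^esub>" "t' = upeval ?B T snd t h"
      using \<open>(\<zero>\<^bsub>S\<^esub>, t') \<in> B'\<close> unfolding B'_def by auto
    obtain k q where q: "q \<in> carrier (UP ?B)" "?c [^]\<^bsub>?B\<^esub> (k::nat) \<odot>\<^bsub>UP ?B\<^esub> h = p \<otimes>\<^bsub>UP ?B\<^esub> q"
      using division[OF h(1,2)] by (elim exE bexE) (rule that; assumption)
    have "snd (?c [^]\<^bsub>?B\<^esub> k) \<otimes>\<^bsub>T\<^esub> t' = upeval ?B T snd t p \<otimes>\<^bsub>T\<^esub> upeval ?B T snd t q"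
      using ev_smult[OF t p1.R.nat_pow_closed[OF cB'] h(1), of k] e2.hom_mult[OF p(1) q(1)] h(3) by (simp only: q(2))
    then have "snd ?c [^]\<^bsub>T\<^esub> k \<otimes>\<^bsub>T\<^esub> t' = \<zero>\<^bsub>T\<^esub>"
      using pt e2.hom_closed[OF q(1)] by (simp only: ck2 T.l_null)
    from T.integral[OF this T.nat_pow_closed[OF c2T]] show ?thesis
      using c2k e2.hom_closed[OF h(1)] unfolding h(3) by blast
  qed
  then have "partial_graph B'" unfolding partial_graph_def using sB' cB BB' by blast
  moreover have "s \<in> fst ` B'"
  proof -
    interpret W: UP_pre_univ_prop ?B S fst "UP ?B" by unfold_locales
    have "fst (?e (up_ring.monom (UP ?B) \<one>\<^bsub>?B\<^esub> 1)) = s" using W.eval_monom1[OF s] by simp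
    then show ?thesis unfolding B'_def by (rule image_eqI[OF sym imageI[OF U.monom_closed[OF p1.R.one_closed]]])
  qed
  ultimately show thesis using that BB' by blast
qed

text \<open>A maximal partial graph projects onto \<open>S\<close>, since otherwise it could be
  extended, so it is the graph of a homomorphism defined everywhere.\<close>

lemma exists_hom:
  obtains f where "ring_hom_cring S T f" and "\<And>r. r \<in> carrier R \<Longrightarrow> f (\<phi> r) = \<psi> r"
proof -
  have "\<exists>M\<in>Collect partial_graph. \<forall>Z\<in>Collect partial_graph. M \<subseteq> Z \<longrightarrow> Z = M"
  proof (rule subset_Zorn_nonempty)
    interpret c: ring_hom_cring R D \<chi>
      by (rule UnivPoly.ring_hom_cringI[OF phi.R.is_cring D.is_cring]) (auto simp: RDirProd_simps intro!: ring_hom_memI)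
    have "subring (\<chi> ` carrier R) D" by (rule c.ring.img_is_subring[OF phi.R.carrier_is_subring])
    \<comment> \<open>The image of \<open>R\<close> is single-valued as a relation because both
      kernels agree.\<close>
    moreover have "\<psi> r = \<zero>\<^bsub>T\<^esub>" if "r \<in> carrier R" "\<zero>\<^bsub>S\<^esub> = \<phi> r" for r
      using same_ker[OF that(1)] that(2)[symmetric] by blast
    ultimately have "partial_graph (\<chi> ` carrier R)" unfolding partial_graph_def by blast
    then show "Collect partial_graph \<noteq> {}" by blast
    fix C assume C: "C \<noteq> {}" "subset.chain (Collect partial_graph) C"
    have g: "partial_graph B" if "B \<in> C" for B using C(2) that by (auto simp: pred_on.chain_def)
    then have s: "subring B D" if "B \<in> C" for B using that unfolding partial_graph_def by blast
    have "subring (\<Union>C) D"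
      by (rule D.chain_Union_subring[OF C(1) s]) (use C(2) in \<open>auto simp: pred_on.chain_def\<close>)
    then have "partial_graph (\<Union>C)" unfolding partial_graph_def using g C(1) unfolding partial_graph_def by blast
    then show "\<Union>C \<in> Collect partial_graph" by blast
  qed
  then obtain B where B: "partial_graph B" and max: "\<And>Z. partial_graph Z \<Longrightarrow> B \<subseteq> Z \<Longrightarrow> Z = B" by blast
  have sB: "subring B D" and cB: "\<chi> ` carrier R \<subseteq> B" 
    and zB: "\<And>t. (\<zero>\<^bsub>S\<^esub>, t) \<in> B \<Longrightarrow> t = \<zero>\<^bsub>T\<^esub>"
    using B unfolding partial_graph_def by auto
  interpret p1: ring_hom_cring "D\<lparr>carrier := B\<rparr>" S fst by (rule fst_hom[OF sB])
  have "fst ` B = carrier S"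
  proof
    show "fst ` B \<subseteq> carrier S" using p1.hom_closed by auto
    show "carrier S \<subseteq> fst ` B"
    proof
      fix s assume "s \<in> carrier S"
      then obtain B' where "partial_graph B'" "B \<subseteq> B'" "s \<in> fst ` B'" using partial_graph_extend[OF B] by blast
      then show "s \<in> fst ` B" using max by blast
    qed
  qed
  then have ex: "\<exists>t. (s, t) \<in> B" if "s \<in> carrier S" for s using that by force
  have BD: "x \<in> carrier S" "y \<in> carrier T" if "(x, y) \<in> B" for x y
    using subringE(1)[OF sB] that by (auto simp: RDirProd_simps)
  \<comment> \<open>Subtracting two pairs with the same first coordinate reduces this to pairs that
    start with zero.\<close>
  have unique: "y = z" if "(x, y) \<in> B" "(x, z) \<in> B" for x y z
  proof -
    have "\<ominus>\<^bsub>D\<^esub> (x, z) = (\<ominus>\<^bsub>S\<^esub> x, \<ominus>\<^bsub>T\<^esub> z)"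
      using BD[OF that(2)] by (intro D.minus_equality) (auto simp: RDirProd_simps S.l_neg T.l_neg)
    then have "(x, y) \<oplus>\<^bsub>D\<^esub> (\<ominus>\<^bsub>S\<^esub> x, \<ominus>\<^bsub>T\<^esub> z) \<in> B"
      using subringE(5,7)[OF sB] that by metis
    then have "(\<zero>\<^bsub>S\<^esub>, y \<ominus>\<^bsub>T\<^esub> z) \<in> B"
      using BD[OF that(2)] by (simp add: RDirProd_simps S.r_neg T.minus_eq)
    then show ?thesis using zB T.minus_eq_zero_iff[OF BD(2)[OF that(1)] BD(2)[OF that(2)]] by blast
  qed
  define f where "f = (\<lambda>s. SOME t. (s, t) \<in> B)"
  have fB: "(s, f s) \<in> B" if "s \<in> carrier S" for s unfolding f_def using someI_ex[OF ex[OF that]] .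
  have feq: "f s = t" if "(s, t) \<in> B" for s t using unique[OF fB[OF BD(1)[OF that]] that] .
  have "f \<in> ring_hom S T"
  proof (rule ring_hom_memI)
    show "f x \<in> carrier T" if "x \<in> carrier S" for x using BD(2) fB that by blast
    show "f (x \<otimes>\<^bsub>S\<^esub> y) = f x \<otimes>\<^bsub>T\<^esub> f y" if "x \<in> carrier S" "y \<in> carrier S" for x y
      using subringE(6)[OF sB fB[OF that(1)] fB[OF that(2)]] by (intro feq) (simp add: RDirProd_simps)
    show "f (x \<oplus>\<^bsub>S\<^esub> y) = f x \<oplus>\<^bsub>T\<^esub> f y" if "x \<in> carrier S" "y \<in> carrier S" for x y
      using subringE(7)[OF sB fB[OF that(1)] fB[OF that(2)]] by (intro feq) (simp add: RDirProd_simps)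
    show "f \<one>\<^bsub>S\<^esub> = \<one>\<^bsub>T\<^esub>"
      using subringE(3)[OF sB] by (intro feq) (simp add: RDirProd_simps)
  qed
  then have "ring_hom_cring S T f" by (rule UnivPoly.ring_hom_cringI[OF S.is_cring T.is_cring])
  moreover have "f (\<phi> r) = \<psi> r" if "r \<in> carrier R" for r using cB that by (intro feq) auto
  ultimately show thesis using that by blast
qed

end

lemma kernel_primeideal:
  assumes "ring_hom_cring R T \<psi>" and "domain T"
  shows "primeideal {r \<in> carrier R. \<psi> r = \<zero>\<^bsub>T\<^esub>} R"
proof -
  interpret T: "domain" T by fact
  interpret f: ring_hom_cring R T \<psi> by fact
  have eq: "{r \<in> carrier R. \<psi> r = \<zero>\<^bsub>T\<^esub>} = a_kernel R T \<psi>" unfolding a_kernel_def' by simp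
  show ?thesis
  proof (rule primeidealI)
    show "ideal {r \<in> carrier R. \<psi> r = \<zero>\<^bsub>T\<^esub>} R" unfolding eq by (rule f.ring.kernel_is_ideal)
    have "\<psi> \<one>\<^bsub>R\<^esub> \<noteq> \<zero>\<^bsub>T\<^esub>" by simp
    then show "carrier R \<noteq> {r \<in> carrier R. \<psi> r = \<zero>\<^bsub>T\<^esub>}" using f.R.one_closed by blast
    fix a b assume ab: "a \<in> carrier R" "b \<in> carrier R" "a \<otimes>\<^bsub>R\<^esub> b \<in> {r \<in> carrier R. \<psi> r = \<zero>\<^bsub>T\<^esub>}"
    then show "a \<in> {r \<in> carrier R. \<psi> r = \<zero>\<^bsub>T\<^esub>} \<or> b \<in> {r \<in> carrier R. \<psi> r = \<zero>\<^bsub>T\<^esub>}"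
      using T.integral[OF _ f.hom_closed[OF ab(1)] f.hom_closed[OF ab(2)]] by simp
  qed (rule f.R.is_cring)
qed

text \<open>The kernel of \<open>\<psi>\<close> is a prime containing the kernel of
  \<open>\<phi>\<close>. Dividing \<open>S\<close> by a prime above it makes the kernels equal and
  the source a domain, which is the setting of \<open>integral_pair\<close>.\<close>

lemma exists_hom_into_ai_closed:
  assumes \<phi>: "ring_hom_cring R S \<phi>" and \<psi>: "ring_hom_cring R T \<psi>" and int: "integral_over R S \<phi>"
    and T: "domain T" "ai_closed T"
    and ker: "\<And>r. r \<in> carrier R \<Longrightarrow> \<phi> r = \<zero>\<^bsub>S\<^esub> \<Longrightarrow> \<psi> r = \<zero>\<^bsub>T\<^esub>"
  obtains f where "ring_hom_cring S T f" and "\<And>r. r \<in> carrier R \<Longrightarrow> f (\<phi> r) = \<psi> r"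
proof -
  interpret \<phi>: ring_hom_cring R S \<phi> by fact
  interpret \<psi>: ring_hom_cring R T \<psi> by fact
  interpret T: "domain" T by fact
  let ?M = "{r \<in> carrier R. \<psi> r = \<zero>\<^bsub>T\<^esub>}"
  have M: "r \<in> ?M \<longleftrightarrow> r \<in> carrier R \<and> \<psi> r = \<zero>\<^bsub>T\<^esub>" for r by simp
  have prime: "primeideal ?M R" by (rule kernel_primeideal[OF \<psi> T(1)])
  obtain Q where Q: "primeideal Q S" "\<And>r. r \<in> carrier R \<Longrightarrow> \<phi> r \<in> Q \<longleftrightarrow> r \<in> ?M"
  proof (rule lying_over[OF \<phi> int prime])
    show "r \<in> ?M" if "r \<in> carrier R" "\<phi> r = \<zero>\<^bsub>S\<^esub>" for r using ker[OF that] that(1) by simp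
  qed blast
  interpret Q: primeideal Q S by fact
  interpret SQ: "domain" "S Quot Q" by (rule Q.quotient_is_domain)
  have g: "ring_hom_cring S (S Quot Q) ((+>\<^bsub>S\<^esub>) Q)" by (rule Q.rcos_ring_hom_cring)
  have surj: "(+>\<^bsub>S\<^esub>) Q ` carrier S = carrier (S Quot Q)"
    unfolding FactRing_def A_RCOSETS_def' by auto
  interpret integral_pair R "S Quot Q" T "(+>\<^bsub>S\<^esub>) Q \<circ> \<phi>" \<psi>
  proof (intro integral_pair.intro integral_pair_axioms.intro)
    show "((+>\<^bsub>S\<^esub>) Q \<circ> \<phi>) r = \<zero>\<^bsub>S Quot Q\<^esub> \<longleftrightarrow> \<psi> r = \<zero>\<^bsub>T\<^esub>" if "r \<in> carrier R" for r
      using Q(2)[OF that] M Q.rcos_eq_zero_iff[OF \<phi>.hom_closed[OF that]] that by simp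
  qed (use SQ.domain_axioms T \<psi> ring_hom_cring_trans[OF \<phi> g] integral_over_surj_trans[OF \<phi> g surj int] in auto)
  obtain f where f: "ring_hom_cring (S Quot Q) T f" "\<And>r. r \<in> carrier R \<Longrightarrow> f (((+>\<^bsub>S\<^esub>) Q \<circ> \<phi>) r) = \<psi> r"
    by (rule exists_hom) (rule that)
  show thesis
    using that[OF ring_hom_cring_trans[OF g f(1)]] f(2) by simp
qed

section \<open>Fraction fields and algebraically closed fields\<close>

text \<open>The full class of \<open>a / s\<close> under cross multiplication, so that equality of
  fractions is equality of sets.\<close>

definition frac_of :: "('a, 'm) ring_scheme \<Rightarrow> 'a \<Rightarrow> 'a \<Rightarrow> ('a \<times> 'a) set"
  where "frac_of R a s =
    {(x, y). x \<in> carrier R \<and> y \<in> carrier R - {\<zero>\<^bsub>R\<^esub>} \<and> x \<otimes>\<^bsub>R\<^esub> s = a \<otimes>\<^bsub>R\<^esub> y}"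

definition frac_rep :: "('a, 'm) ring_scheme \<Rightarrow> ('a \<times> 'a) set \<Rightarrow> 'a \<times> 'a"
  where "frac_rep R Z =
    (SOME (a, s). a \<in> carrier R \<and> s \<in> carrier R - {\<zero>\<^bsub>R\<^esub>} \<and> Z = frac_of R a s)"

definition frac_field :: "('a, 'm) ring_scheme \<Rightarrow> ('a \<times> 'a) set ring"
  where "frac_field R =
    \<lparr>carrier = {Z. \<exists>a\<in>carrier R. \<exists>s\<in>carrier R - {\<zero>\<^bsub>R\<^esub>}. Z = frac_of R a s},
     monoid.mult = (\<lambda>Z W. case (frac_rep R Z, frac_rep R W) of ((a, s), (b, t)) \<Rightarrow>
       frac_of R (a \<otimes>\<^bsub>R\<^esub> b) (s \<otimes>\<^bsub>R\<^esub> t)),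
     one = frac_of R \<one>\<^bsub>R\<^esub> \<one>\<^bsub>R\<^esub>,
     zero = frac_of R \<zero>\<^bsub>R\<^esub> \<one>\<^bsub>R\<^esub>,
     add = (\<lambda>Z W. case (frac_rep R Z, frac_rep R W) of ((a, s), (b, t)) \<Rightarrow>
       frac_of R (a \<otimes>\<^bsub>R\<^esub> t \<oplus>\<^bsub>R\<^esub> b \<otimes>\<^bsub>R\<^esub> s) (s \<otimes>\<^bsub>R\<^esub> t))\<rparr>"

context "domain"
begin

abbreviation "fraction \<equiv> frac_of R"
abbreviation "numer_denom \<equiv> frac_rep R"
abbreviation "fraction_field \<equiv> frac_field R"

lemma fraction_eq_iff:
  assumes "a \<in> carrier R" "b \<in> carrier R" "s \<in> carrier R - {\<zero>}" "t \<in> carrier R - {\<zero>}"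
  shows "fraction a s = fraction b t \<longleftrightarrow> a \<otimes> t = b \<otimes> s"
proof
  assume "fraction a s = fraction b t"
  moreover have "(a, s) \<in> fraction a s" using assms unfolding frac_of_def by blast
  ultimately show "a \<otimes> t = b \<otimes> s" unfolding frac_of_def by blast
next
  have sub: "fraction a s \<subseteq> fraction b t"
    if c: "a \<in> carrier R" "b \<in> carrier R" "s \<in> carrier R - {\<zero>}" "t \<in> carrier R - {\<zero>}"
      and e: "a \<otimes> t = b \<otimes> s" for a b s t
  proof
    fix z assume "z \<in> fraction a s"
    then obtain x y where z: "z = (x, y)" "x \<in> carrier R" "y \<in> carrier R - {\<zero>}" "x \<otimes> s = a \<otimes> y"
      unfolding frac_of_def by blast
    have cr: "s \<in> carrier R" "t \<in> carrier R" "y \<in> carrier R" using c z by simp_all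
    have "s \<otimes> (x \<otimes> t) = (x \<otimes> s) \<otimes> t" using cr z(2) by (simp add: m_ac)
    also have "\<dots> = (a \<otimes> t) \<otimes> y" unfolding z(4) using cr c(1) by (simp add: m_ac)
    also have "\<dots> = s \<otimes> (b \<otimes> y)" unfolding e using cr c(2) by (simp add: m_ac)
    finally have "x \<otimes> t = b \<otimes> y" using m_lcancel[of s "x \<otimes> t" "b \<otimes> y"] c z by simp
    then show "z \<in> fraction b t" using z unfolding frac_of_def by blast
  qed
  assume "a \<otimes> t = b \<otimes> s"
  then show "fraction a s = fraction b t"
    using sub[OF assms] sub[OF assms(2,1,4,3)] by (intro equalityI) simp_all
qed

lemma numer_denom_fraction:
  assumes "a \<in> carrier R" "s \<in> carrier R - {\<zero>}"
  obtains b t where "numer_denom (fraction a s) = (b, t)" "b \<in> carrier R" "t \<in> carrier R - {\<zero>}" "a \<otimes> t = b \<otimes> s"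
proof -
  have "case (a, s) of (b, t) \<Rightarrow> b \<in> carrier R \<and> t \<in> carrier R - {\<zero>} \<and> fraction a s = fraction b t"
    using assms by simp
  from someI[of "\<lambda>(b, t). b \<in> carrier R \<and> t \<in> carrier R - {\<zero>} \<and> fraction a s = fraction b t", OF this]
  have "case numer_denom (fraction a s) of (b, t) \<Rightarrow> b \<in> carrier R \<and> t \<in> carrier R - {\<zero>} \<and> fraction a s = fraction b t"
    unfolding frac_rep_def .
  moreover obtain b t where bt: "numer_denom (fraction a s) = (b, t)" by (cases "numer_denom (fraction a s)")
  ultimately have "b \<in> carrier R" "t \<in> carrier R - {\<zero>}" "fraction a s = fraction b t" by simp_all
  then show thesis using that[OF bt] fraction_eq_iff[OF assms(1) _ assms(2)] by blast
qed

lemma denom_mult: "s \<in> carrier R - {\<zero>} \<Longrightarrow> t \<in> carrier R - {\<zero>} \<Longrightarrow> s \<otimes> t \<in> carrier R - {\<zero>}"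
  using integral[of s t] by auto

text \<open>Cross multiplication shows that the representatives chosen by \<open>frac_rep\<close> do
  not affect the result.\<close>

lemma fraction_mult:
  assumes "a \<in> carrier R" "b \<in> carrier R" "s \<in> carrier R - {\<zero>}" "t \<in> carrier R - {\<zero>}"
  shows "fraction a s \<otimes>\<^bsub>fraction_field\<^esub> fraction b t = fraction (a \<otimes> b) (s \<otimes> t)"
proof -
  obtain a' s' where 1: "numer_denom (fraction a s) = (a', s')" "a' \<in> carrier R" "s' \<in> carrier R - {\<zero>}" "a \<otimes> s' = a' \<otimes> s"
    using numer_denom_fraction[OF assms(1,3)] .
  obtain b' t' where 2: "numer_denom (fraction b t) = (b', t')" "b' \<in> carrier R" "t' \<in> carrier R - {\<zero>}" "b \<otimes> t' = b' \<otimes> t"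
    using numer_denom_fraction[OF assms(2,4)] .
  have cr: "s \<in> carrier R" "t \<in> carrier R" "s' \<in> carrier R" "t' \<in> carrier R" using 1 2 assms by simp_all
  note cr = cr assms(1,2) 1(2) 2(2)
  have "(a' \<otimes> b') \<otimes> (s \<otimes> t) = (a' \<otimes> s) \<otimes> (b' \<otimes> t)" using cr by (simp add: m_ac)
  also have "\<dots> = (a \<otimes> b) \<otimes> (s' \<otimes> t')" unfolding 1(4)[symmetric] 2(4)[symmetric] using cr by (simp add: m_ac)
  finally have "fraction (a' \<otimes> b') (s' \<otimes> t') = fraction (a \<otimes> b) (s \<otimes> t)"
    using fraction_eq_iff[OF _ _ denom_mult[OF 1(3) 2(3)] denom_mult[OF assms(3,4)]] 1 2 assms by simp
  then show ?thesis unfolding frac_field_def using 1(1) 2(1) by simp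
qed

lemma fraction_add:
  assumes "a \<in> carrier R" "b \<in> carrier R" "s \<in> carrier R - {\<zero>}" "t \<in> carrier R - {\<zero>}"
  shows "fraction a s \<oplus>\<^bsub>fraction_field\<^esub> fraction b t = fraction (a \<otimes> t \<oplus> b \<otimes> s) (s \<otimes> t)"
proof -
  obtain a' s' where 1: "numer_denom (fraction a s) = (a', s')" "a' \<in> carrier R" "s' \<in> carrier R - {\<zero>}" "a \<otimes> s' = a' \<otimes> s"
    using numer_denom_fraction[OF assms(1,3)] .
  obtain b' t' where 2: "numer_denom (fraction b t) = (b', t')" "b' \<in> carrier R" "t' \<in> carrier R - {\<zero>}" "b \<otimes> t' = b' \<otimes> t"
    using numer_denom_fraction[OF assms(2,4)] .
  have cr: "s \<in> carrier R" "t \<in> carrier R" "s' \<in> carrier R" "t' \<in> carrier R" using 1 2 assms by simp_all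
  note cr = cr assms(1,2) 1(2) 2(2)
  have "(a' \<otimes> t' \<oplus> b' \<otimes> s') \<otimes> (s \<otimes> t) = (a' \<otimes> s) \<otimes> (t \<otimes> t') \<oplus> (b' \<otimes> t) \<otimes> (s \<otimes> s')"
    using cr by (simp add: m_ac l_distr r_distr)
  also have "\<dots> = (a \<otimes> t \<oplus> b \<otimes> s) \<otimes> (s' \<otimes> t')"
    unfolding 1(4)[symmetric] 2(4)[symmetric] using cr by (simp add: m_ac l_distr r_distr)
  finally have "fraction (a' \<otimes> t' \<oplus> b' \<otimes> s') (s' \<otimes> t') = fraction (a \<otimes> t \<oplus> b \<otimes> s) (s \<otimes> t)"
    using fraction_eq_iff[OF _ _ denom_mult[OF 1(3) 2(3)] denom_mult[OF assms(3,4)]] 1 2 assms by simp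
  then show ?thesis unfolding frac_field_def using 1(1) 2(1) by simp
qed

lemma fraction_carrier:
  "Z \<in> carrier fraction_field \<longleftrightarrow> (\<exists>a\<in>carrier R. \<exists>s\<in>carrier R - {\<zero>}. Z = fraction a s)"
  unfolding frac_field_def by auto

lemma fraction_closed:
  "a \<in> carrier R \<Longrightarrow> s \<in> carrier R - {\<zero>} \<Longrightarrow> fraction a s \<in> carrier fraction_field"
  unfolding fraction_carrier by blast

lemma fraction_one: "\<one>\<^bsub>fraction_field\<^esub> = fraction \<one> \<one>" and fraction_zero: "\<zero>\<^bsub>fraction_field\<^esub> = fraction \<zero> \<one>"
  by (simp_all add: frac_field_def)

lemma fraction_eqI:
  assumes "a \<in> carrier R" "b \<in> carrier R" "s \<in> carrier R - {\<zero>}" "t \<in> carrier R - {\<zero>}" "a \<otimes> t = b \<otimes> s"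
  shows "fraction a s = fraction b t"
  using fraction_eq_iff assms by simp

lemma fraction_field_cring: "cring fraction_field"
proof (rule cringI)
  have o: "\<one> \<in> carrier R - {\<zero>}" by simp
  note dm = denom_mult
  show "abelian_group fraction_field"
  proof (rule abelian_groupI)
    show "\<zero>\<^bsub>fraction_field\<^esub> \<in> carrier fraction_field" unfolding fraction_zero by (rule fraction_closed) simp_all
    fix Z W V assume "Z \<in> carrier fraction_field" "W \<in> carrier fraction_field" "V \<in> carrier fraction_field"
    then obtain a s b t c u where z: "Z = fraction a s" "a \<in> carrier R" "s \<in> carrier R - {\<zero>}"
      "W = fraction b t" "b \<in> carrier R" "t \<in> carrier R - {\<zero>}"
      "V = fraction c u" "c \<in> carrier R" "u \<in> carrier R - {\<zero>}" unfolding fraction_carrier by metis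
    then have z': "s \<in> carrier R" "t \<in> carrier R" "u \<in> carrier R" by simp_all
    show "Z \<oplus>\<^bsub>fraction_field\<^esub> W \<in> carrier fraction_field"
      unfolding z fraction_add[OF z(2,5,3,6)] using z z' by (intro fraction_closed dm) simp_all
    show "(Z \<oplus>\<^bsub>fraction_field\<^esub> W) \<oplus>\<^bsub>fraction_field\<^esub> V = Z \<oplus>\<^bsub>fraction_field\<^esub> (W \<oplus>\<^bsub>fraction_field\<^esub> V)"
      unfolding z fraction_add[OF z(2,5,3,6)] fraction_add[OF z(5,8,6,9)] using z z' dm[OF z(3,6)] dm[OF z(6,9)]
      by (subst fraction_add fraction_add; (intro fraction_eqI dm)?; simp add: l_distr r_distr m_ac a_ac)+
    show "Z \<oplus>\<^bsub>fraction_field\<^esub> W = W \<oplus>\<^bsub>fraction_field\<^esub> Z"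
      unfolding z fraction_add[OF z(2,5,3,6)] fraction_add[OF z(5,2,6,3)] using z z' by (simp add: m_ac a_ac)
    show "\<zero>\<^bsub>fraction_field\<^esub> \<oplus>\<^bsub>fraction_field\<^esub> Z = Z"
      unfolding z fraction_zero fraction_add[OF zero_closed z(2) o z(3)] using z z' by simp
    have "fraction (\<ominus> a) s \<oplus>\<^bsub>fraction_field\<^esub> Z = \<zero>\<^bsub>fraction_field\<^esub>"
      unfolding z fraction_zero fraction_add[OF a_inv_closed[OF z(2)] z(2,3,3)]
      using z z' by (intro fraction_eqI dm o) (simp_all add: l_minus l_neg)
    then show "\<exists>Y\<in>carrier fraction_field. Y \<oplus>\<^bsub>fraction_field\<^esub> Z = \<zero>\<^bsub>fraction_field\<^esub>"
      using fraction_closed[OF a_inv_closed[OF z(2)] z(3)] by blast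
  qed
  show "comm_monoid fraction_field"
  proof (rule comm_monoidI)
    show "\<one>\<^bsub>fraction_field\<^esub> \<in> carrier fraction_field" unfolding fraction_one by (rule fraction_closed) simp_all
    fix Z W V assume "Z \<in> carrier fraction_field" "W \<in> carrier fraction_field" "V \<in> carrier fraction_field"
    then obtain a s b t c u where z: "Z = fraction a s" "a \<in> carrier R" "s \<in> carrier R - {\<zero>}"
      "W = fraction b t" "b \<in> carrier R" "t \<in> carrier R - {\<zero>}"
      "V = fraction c u" "c \<in> carrier R" "u \<in> carrier R - {\<zero>}" unfolding fraction_carrier by metis
    then have z': "s \<in> carrier R" "t \<in> carrier R" "u \<in> carrier R" by simp_all
    show "Z \<otimes>\<^bsub>fraction_field\<^esub> W \<in> carrier fraction_field"
      unfolding z fraction_mult[OF z(2,5,3,6)] using z z' by (intro fraction_closed dm) simp_all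
    show "(Z \<otimes>\<^bsub>fraction_field\<^esub> W) \<otimes>\<^bsub>fraction_field\<^esub> V = Z \<otimes>\<^bsub>fraction_field\<^esub> (W \<otimes>\<^bsub>fraction_field\<^esub> V)"
      unfolding z fraction_mult[OF z(2,5,3,6)] fraction_mult[OF z(5,8,6,9)]
        fraction_mult[OF m_closed[OF z(2,5)] z(8) dm[OF z(3,6)] z(9)]
        fraction_mult[OF z(2) m_closed[OF z(5,8)] z(3) dm[OF z(6,9)]] using z z' by (simp add: m_ac)
    show "Z \<otimes>\<^bsub>fraction_field\<^esub> W = W \<otimes>\<^bsub>fraction_field\<^esub> Z"
      unfolding z fraction_mult[OF z(2,5,3,6)] fraction_mult[OF z(5,2,6,3)] using z z' by (simp add: m_ac)
    show "\<one>\<^bsub>fraction_field\<^esub> \<otimes>\<^bsub>fraction_field\<^esub> Z = Z"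
      unfolding z fraction_one fraction_mult[OF one_closed z(2) o z(3)] using z z' by simp
  qed
  fix Z W V assume "Z \<in> carrier fraction_field" "W \<in> carrier fraction_field" "V \<in> carrier fraction_field"
  then obtain a s b t c u where z: "Z = fraction a s" "a \<in> carrier R" "s \<in> carrier R - {\<zero>}"
    "W = fraction b t" "b \<in> carrier R" "t \<in> carrier R - {\<zero>}"
    "V = fraction c u" "c \<in> carrier R" "u \<in> carrier R - {\<zero>}" unfolding fraction_carrier by metis
  then have z': "s \<in> carrier R" "t \<in> carrier R" "u \<in> carrier R" by simp_all
  have c: "a \<otimes> t \<oplus> b \<otimes> s \<in> carrier R" "a \<otimes> c \<in> carrier R" "b \<otimes> c \<in> carrier R" using z z' by simp_all
  show "(Z \<oplus>\<^bsub>fraction_field\<^esub> W) \<otimes>\<^bsub>fraction_field\<^esub> V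
      = Z \<otimes>\<^bsub>fraction_field\<^esub> V \<oplus>\<^bsub>fraction_field\<^esub> W \<otimes>\<^bsub>fraction_field\<^esub> V"
    unfolding z fraction_add[OF z(2,5,3,6)] fraction_mult[OF z(2,8,3,9)] fraction_mult[OF z(5,8,6,9)]
      fraction_mult[OF c(1) z(8) dm[OF z(3,6)] z(9)] fraction_add[OF c(2,3) dm[OF z(3,9)] dm[OF z(6,9)]]
    using z z' by (intro fraction_eqI dm) (simp_all add: l_distr r_distr m_ac)
qed

lemma fraction_field_field: "field fraction_field"
proof (rule cring.cring_fieldI2[OF fraction_field_cring])
  show "\<zero>\<^bsub>fraction_field\<^esub> \<noteq> \<one>\<^bsub>fraction_field\<^esub>"
    unfolding fraction_zero fraction_one by (subst fraction_eq_iff) simp_all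
  fix Z assume "Z \<in> carrier fraction_field" and nz: "Z \<noteq> \<zero>\<^bsub>fraction_field\<^esub>"
  then obtain a s where z: "Z = fraction a s" "a \<in> carrier R" "s \<in> carrier R - {\<zero>}"
    unfolding fraction_carrier by blast
  have "a \<noteq> \<zero>" using nz z fraction_eq_iff[of a \<zero> s \<one>] unfolding fraction_zero by simp
  then have a: "a \<in> carrier R - {\<zero>}" using z by simp
  have s: "s \<in> carrier R" using z by simp
  have "Z \<otimes>\<^bsub>fraction_field\<^esub> fraction s a = \<one>\<^bsub>fraction_field\<^esub>"
    unfolding z fraction_one fraction_mult[OF z(2) s z(3) a]
    by (rule fraction_eqI[OF _ _ denom_mult[OF z(3) a]]) (use z s in \<open>simp_all add: m_comm\<close>)
  then show "\<exists>W\<in>carrier fraction_field. Z \<otimes>\<^bsub>fraction_field\<^esub> W = \<one>\<^bsub>fraction_field\<^esub>"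
    using fraction_closed[OF s a] by blast
qed

lemma fraction_field_embedding:
  shows "ring_hom_cring R fraction_field (\<lambda>a. fraction a \<one>)"
    and "inj_on (\<lambda>a. fraction a \<one>) (carrier R)"
proof -
  have o: "\<one> \<in> carrier R - {\<zero>}" by simp
  show "ring_hom_cring R fraction_field (\<lambda>a. fraction a \<one>)"
  proof (rule UnivPoly.ring_hom_cringI[OF is_cring fraction_field_cring], rule ring_hom_memI)
    fix x y assume xy: "x \<in> carrier R" "y \<in> carrier R"
    show "fraction x \<one> \<in> carrier fraction_field" using fraction_closed[OF xy(1) o] .
    show "fraction (x \<otimes> y) \<one> = fraction x \<one> \<otimes>\<^bsub>fraction_field\<^esub> fraction y \<one>"
      unfolding fraction_mult[OF xy o o] by simp
    show "fraction (x \<oplus> y) \<one> = fraction x \<one> \<oplus>\<^bsub>fraction_field\<^esub> fraction y \<one>"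
      unfolding fraction_add[OF xy o o] using xy by simp
  qed (simp add: fraction_one)
  show "inj_on (\<lambda>a. fraction a \<one>) (carrier R)"
    by (rule inj_onI) (use fraction_eq_iff[OF _ _ o o] in simp)
qed

end

text \<open>Algebraic closedness is stated for list polynomials, so the coefficient function is
  turned into a list, a root is found there and carried back.\<close>

lemma (in algebraically_closed) root_closed: "root_closed L"
  unfolding root_closed_def
proof (intro allI impI)
  fix p assume p: "monic_poly L p" and d: "deg L p > 0"
  note pc = monic_polyD[OF p]
  have c: "p i \<in> carrier L" for i using pc(1) by (simp add: UP_carrier_iff)
  \<comment> \<open>List polynomials begin with the leading coefficient, hence the reversal.\<close>
  define l where "l = (\<lambda>n. map p (rev [0..<n]))"
  have ev: "local.eval (l n) x = (\<Oplus>i\<in>{..<n}. p i \<otimes> x [^] i)" if x: "x \<in> carrier L" for n x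
  proof (induct n)
    case 0
    then show ?case by (simp add: l_def)
  next
    case (Suc n)
    have "l (Suc n) = p n # l n" "length (l n) = n" by (simp_all add: l_def)
    then have "local.eval (l (Suc n)) x = p n \<otimes> x [^] n \<oplus> local.eval (l n) x" by simp
    then show ?case using Suc c x by (simp add: lessThan_Suc Pi_def)
  qed
  let ?n = "Suc (deg L p)"
  have l: "l ?n = p (deg L p) # l (deg L p)" by (simp add: l_def)
  have "l ?n \<in> carrier (poly_ring L)"
    unfolding univ_poly_carrier[symmetric] polynomial_def using pc(2) c by (auto simp: l_def)
  moreover from this have "splitted (l ?n)" by (rule roots_over_carrier)
  \<comment> \<open>A split polynomial has as many roots as its degree, which is one less than the
    length of the list.\<close>
  then have "size (roots (l ?n)) > 0" using d unfolding splitted_def by (simp add: l_def)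
  then obtain x where "x \<in># roots (l ?n)" using multi_nonempty_split by fastforce
  ultimately have "is_root (l ?n) x" using roots_mem_iff_is_root by blast
  then have x: "x \<in> carrier L" and "local.eval (l ?n) x = \<zero>" unfolding is_root_def by auto
  then have "(\<Oplus>i\<in>{..deg L p}. p i \<otimes> x [^] i) = \<zero>" using ev[OF x, of ?n] by (simp add: lessThan_Suc_atMost)
  moreover have "ring_hom_cring L L id" by unfold_locales (simp add: ring_hom_def)
  ultimately have "upeval L L id x p = \<zero>" using eval_eq_sum[OF _ pc(1) order.refl x] by simp
  then show "\<exists>a\<in>carrier L. upeval L L id a p = \<zero>" using x by blast
qed

text \<open>Compose the residue map with the embeddings into the fraction field and its algebraic
  closure; the latter two are injective, so the kernel is \<open>P\<close>. The long type is that of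
  the algebraic closure over fractions of cosets.\<close>

lemma exists_root_closed_field:
  assumes "primeideal P R"
  obtains L :: "((('a set \<times> 'a set) set list \<times> nat) multiset \<Rightarrow> ('a set \<times> 'a set) set) ring" and \<iota>
  where "field L" and "root_closed L" and "ring_hom_cring (R :: ('a, 'm) ring_scheme) L \<iota>"
    and "\<And>r. r \<in> carrier R \<Longrightarrow> \<iota> r = \<zero>\<^bsub>L\<^esub> \<longleftrightarrow> r \<in> P"
proof -
  interpret P: primeideal P R by fact
  interpret D: "domain" "R Quot P" by (rule P.quotient_is_domain)
  interpret F: field D.fraction_field by (rule D.fraction_field_field)
  interpret L: algebraic_closure F.alg_closure "F.indexed_const ` carrier D.fraction_field" by (rule F.alg_closureE)
  have h3: "ring_hom_cring D.fraction_field F.alg_closure F.indexed_const"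
    by (rule UnivPoly.ring_hom_cringI[OF F.is_cring L.is_cring F.alg_closureE(2)])
  note h = ring_hom_cring_trans[OF ring_hom_cring_trans[OF P.rcos_ring_hom_cring D.fraction_field_embedding(1)] h3]
  interpret h1: ring_hom_cring "R Quot P" D.fraction_field "\<lambda>a. D.fraction a \<one>\<^bsub>R Quot P\<^esub>"
    by (rule D.fraction_field_embedding)
  show thesis
  proof (rule that[OF L.field_axioms L.root_closed h])
    fix r assume r: "r \<in> carrier R"
    have hz: "F.indexed_const \<zero>\<^bsub>D.fraction_field\<^esub> = \<zero>\<^bsub>F.alg_closure\<^esub>"
      by (rule ring_hom_cring.hom_zero[OF h3])
    interpret q: ring_hom_cring R "R Quot P" "(+>\<^bsub>R\<^esub>) P" by (rule P.rcos_ring_hom_cring)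
    have "F.indexed_const (D.fraction (P +>\<^bsub>R\<^esub> r) \<one>\<^bsub>R Quot P\<^esub>) = \<zero>\<^bsub>F.alg_closure\<^esub>
        \<longleftrightarrow> D.fraction (P +>\<^bsub>R\<^esub> r) \<one>\<^bsub>R Quot P\<^esub> = \<zero>\<^bsub>D.fraction_field\<^esub>"
      unfolding hz[symmetric] by (rule inj_eq[OF F.indexed_const_is_inj])
    also have "\<dots> \<longleftrightarrow> D.fraction (P +>\<^bsub>R\<^esub> r) \<one>\<^bsub>R Quot P\<^esub> = D.fraction \<zero>\<^bsub>R Quot P\<^esub> \<one>\<^bsub>R Quot P\<^esub>"
      by (simp only: D.fraction_zero)
    also have "\<dots> \<longleftrightarrow> P +>\<^bsub>R\<^esub> r = \<zero>\<^bsub>R Quot P\<^esub>"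
      using inj_on_eq_iff[OF D.fraction_field_embedding(2) q.hom_closed[OF r] D.zero_closed] .
    also have "\<dots> \<longleftrightarrow> r \<in> P" by (rule P.rcos_eq_zero_iff[OF r])
    finally show "(F.indexed_const \<circ> ((\<lambda>a. D.fraction a \<one>\<^bsub>R Quot P\<^esub>) \<circ> (+>\<^bsub>R\<^esub>) P)) r = \<zero>\<^bsub>F.alg_closure\<^esub> \<longleftrightarrow> r \<in> P"
      unfolding comp_apply .
  qed
qed

section \<open>Finitely generated modules over a subring and Nakayama's lemma\<close>

primrec span_upto :: "('a, 'm) ring_scheme \<Rightarrow> 'a set \<Rightarrow> (nat \<Rightarrow> 'a) \<Rightarrow> nat \<Rightarrow> 'a set" where
  "span_upto R B m 0 = {\<zero>\<^bsub>R\<^esub>}"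
| "span_upto R B m (Suc n) = {x \<oplus>\<^bsub>R\<^esub> b \<otimes>\<^bsub>R\<^esub> m n |x b. x \<in> span_upto R B m n \<and> b \<in> B}"

context cring
begin

context
  fixes B m
  assumes B: "subring B R" and m: "\<And>i::nat. m i \<in> carrier R"
begin

lemmas Bcl = subringE[OF B]

lemma Bcarr: "b \<in> B \<Longrightarrow> b \<in> carrier R"
  using Bcl(1) by blast

lemma span_carrier: "x \<in> span_upto R B m n \<Longrightarrow> x \<in> carrier R"
  by (induct n arbitrary: x) (use Bcarr m in auto)

lemma span_add: "x \<in> span_upto R B m n \<Longrightarrow> y \<in> span_upto R B m n \<Longrightarrow> x \<oplus> y \<in> span_upto R B m n"
proof (induct n arbitrary: x y)
  case (Suc n)
  then obtain x' b y' c where e: "x = x' \<oplus> b \<otimes> m n" "x' \<in> span_upto R B m n" "b \<in> B"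
    "y = y' \<oplus> c \<otimes> m n" "y' \<in> span_upto R B m n" "c \<in> B" by auto
  note cr = span_carrier[OF e(2)] span_carrier[OF e(5)] Bcarr[OF e(3)] Bcarr[OF e(6)] m[of n]
  have "x \<oplus> y = (x' \<oplus> y') \<oplus> (b \<oplus> c) \<otimes> m n" unfolding e using cr by (simp add: l_distr a_ac)
  then show ?case using Suc(1)[OF e(2,5)] Bcl(7)[OF e(3,6)] by auto
qed simp

lemma span_mult: "x \<in> span_upto R B m n \<Longrightarrow> c \<in> B \<Longrightarrow> c \<otimes> x \<in> span_upto R B m n"
proof (induct n arbitrary: x)
  case 0
  then show ?case using Bcarr by simp
next
  case (Suc n)
  then obtain x' b where e: "x = x' \<oplus> b \<otimes> m n" "x' \<in> span_upto R B m n" "b \<in> B" by auto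
  note cr = span_carrier[OF e(2)] Bcarr[OF e(3)] Bcarr[OF Suc(3)] m[of n]
  have "c \<otimes> x = c \<otimes> x' \<oplus> (c \<otimes> b) \<otimes> m n" unfolding e using cr by (simp add: r_distr m_assoc)
  then show ?case using Suc(1)[OF e(2) Suc(3)] Bcl(6)[OF Suc(3) e(3)] by auto
qed

lemma span_annihilated:
  assumes "v \<in> carrier R" and "\<And>j. j < n \<Longrightarrow> v \<otimes> m j = \<zero>" and "x \<in> span_upto R B m n"
  shows "v \<otimes> x = \<zero>"
  using assms(2,3)
proof (induct n arbitrary: x)
  case 0
  then show ?case using assms(1) by simp
next
  case (Suc n)
  then obtain x' b where e: "x = x' \<oplus> b \<otimes> m n" "x' \<in> span_upto R B m n" "b \<in> B" by auto
  note cr = span_carrier[OF e(2)] Bcarr[OF e(3)] assms(1) m[of n]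
  have "v \<otimes> x = v \<otimes> x' \<oplus> b \<otimes> (v \<otimes> m n)" unfolding e using cr by (simp add: r_distr m_ac)
  then show ?case using Suc(1)[OF Suc(2) e(2)] Suc(2)[of n] cr by simp
qed

text \<open>Induction on the number of generators replaces the usual determinant.\<close>

lemma nakayama:
  assumes w: "w \<in> B"
    and "u \<in> {\<one> \<oplus> w \<otimes> c |c. c \<in> B}"
    and "\<And>j. j < n \<Longrightarrow> \<exists>x\<in>span_upto R B m n. u \<otimes> m j = w \<otimes> x"
  shows "\<exists>c\<in>B. \<forall>j<n. (\<one> \<oplus> w \<otimes> c) \<otimes> m j = \<zero>"
  using assms(2,3)
proof (induct n arbitrary: u)
  case 0
  then show ?case using Bcl(2) by blast
next
  case (Suc n)
  let ?U = "{\<one> \<oplus> w \<otimes> c |c. c \<in> B}"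
  note wc = Bcarr[OF w]
  obtain z where z: "z \<in> span_upto R B m (Suc n)" "u \<otimes> m n = w \<otimes> z" using Suc(3)[of n] by blast
  then obtain x b where xb: "z = x \<oplus> b \<otimes> m n" "x \<in> span_upto R B m n" "b \<in> B" by auto
  obtain a where a: "u = \<one> \<oplus> w \<otimes> a" "a \<in> B" using Suc(2) by blast
  note cr = span_carrier[OF xb(2)] Bcarr[OF xb(3)] Bcarr[OF a(2)] wc m[of n]
  \<comment> \<open>This is \<open>u - w b\<close>, where \<open>b\<close> is the coefficient of
    \<open>m n\<close> in \<open>z\<close>: moving that term to the left expresses
    \<open>u' \<otimes> m n\<close> by the earlier generators alone.\<close>
  define u' where "u' = \<one> \<oplus> w \<otimes> (a \<oplus> \<ominus> b)"
  have u'B: "a \<oplus> \<ominus> b \<in> B" by (rule Bcl(7)[OF a(2) Bcl(5)[OF xb(3)]])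
  have uB: "u \<in> B" "u' \<in> B" unfolding a u'_def by (intro Bcl(7) Bcl(3) Bcl(6) w a(2) u'B)+
  note cu = Bcarr[OF uB(1)] Bcarr[OF uB(2)]
  have u'm: "u' \<otimes> m n = w \<otimes> x"
  proof -
    have "u' \<otimes> m n = u \<otimes> m n \<ominus> w \<otimes> (b \<otimes> m n)" unfolding a(1) u'_def using cr
      by (simp add: l_distr r_distr m_ac a_ac r_minus l_minus minus_eq)
    also have "\<dots> = w \<otimes> x" unfolding z(2) xb(1) using cr by (simp add: r_distr minus_eq a_assoc r_neg)
    finally show ?thesis .
  qed
  have "u' \<otimes> u = \<one> \<oplus> w \<otimes> ((a \<oplus> \<ominus> b) \<oplus> a \<oplus> w \<otimes> ((a \<oplus> \<ominus> b) \<otimes> a))"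
    unfolding a(1) u'_def using cr Bcarr[OF u'B] by (simp add: l_distr r_distr m_ac a_ac del: a_inv_closed)
  moreover have "(a \<oplus> \<ominus> b) \<oplus> a \<oplus> w \<otimes> ((a \<oplus> \<ominus> b) \<otimes> a) \<in> B"
    by (intro Bcl(7) Bcl(6) u'B a(2) w)
  ultimately have U: "u' \<otimes> u \<in> ?U" by blast
  \<comment> \<open>Multiplying by \<open>u'\<close> eliminates \<open>m n\<close> from the relation
    of \<open>m j\<close>, which is the hypothesis for \<open>n\<close> generators.\<close>
  have "\<exists>y\<in>span_upto R B m n. (u' \<otimes> u) \<otimes> m j = w \<otimes> y" if j: "j < n" for j
  proof -
    obtain y where "y \<in> span_upto R B m (Suc n)" and y: "u \<otimes> m j = w \<otimes> y" using Suc(3)[of j] j by auto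
    then obtain x' c where e: "y = x' \<oplus> c \<otimes> m n" "x' \<in> span_upto R B m n" "c \<in> B" by auto
    note cr' = span_carrier[OF e(2)] Bcarr[OF e(3)] m[of j]
    have "(u' \<otimes> u) \<otimes> m j = u' \<otimes> (w \<otimes> y)" using cu cr' by (simp add: m_assoc flip: y)
    also have "\<dots> = w \<otimes> (u' \<otimes> x' \<oplus> c \<otimes> (u' \<otimes> m n))" unfolding e using cr cr' cu
      by (simp add: r_distr m_ac)
    also have "\<dots> = w \<otimes> (u' \<otimes> x' \<oplus> (c \<otimes> w) \<otimes> x)" unfolding u'm using cr cr' by (simp add: m_assoc)
    finally show ?thesis
      using span_add[OF span_mult[OF e(2) uB(2)] span_mult[OF xb(2) Bcl(6)[OF e(3) w]]] by blast
  qed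
  from Suc(1)[OF U this] obtain c where c: "c \<in> B" "\<forall>j<n. (\<one> \<oplus> w \<otimes> c) \<otimes> m j = \<zero>" by blast
  let ?v = "\<one> \<oplus> w \<otimes> c"
  note vc = Bcarr[OF c(1)]
  have v: "?v \<in> carrier R" using wc vc by simp
  \<comment> \<open>Since \<open>?v\<close> kills the first \<open>n\<close> generators and
    \<open>u' \<otimes> m n\<close> lies in their span, \<open>?v \<otimes> u'\<close> kills the
    last one too.\<close>
  have "(?v \<otimes> u') \<otimes> m j = \<zero>" if j: "j < Suc n" for j
  proof (cases "j = n")
    case True
    have "(?v \<otimes> u') \<otimes> m n = w \<otimes> (?v \<otimes> x)" using v cu cr u'm by (metis m_assoc m_lcomm)
    then show ?thesis using span_annihilated[OF v _ xb(2)] c(2) True wc by simp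
  next
    case False
    have "(?v \<otimes> u') \<otimes> m j = u' \<otimes> (?v \<otimes> m j)" using v cu m by (metis m_assoc m_comm)
    then show ?thesis using c(2) j False cu by simp
  qed
  moreover have "?v \<otimes> u' = \<one> \<oplus> w \<otimes> ((a \<oplus> \<ominus> b) \<oplus> c \<oplus> w \<otimes> (c \<otimes> (a \<oplus> \<ominus> b)))"
    unfolding u'_def using cr vc Bcarr[OF u'B] by (simp add: l_distr r_distr m_ac a_ac del: a_inv_closed)
  moreover have "(a \<oplus> \<ominus> b) \<oplus> c \<oplus> w \<otimes> (c \<otimes> (a \<oplus> \<ominus> b)) \<in> B"
    by (intro Bcl(7) Bcl(6) u'B c(1) w)
  ultimately show ?case by metis
qed

end

end

section \<open>Integral closure in a field\<close>

lemma subring_incl_hom: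
  assumes "cring L" and "subring B L"
  shows "ring_hom_cring (L\<lparr>carrier := B\<rparr>) L id"
proof -
  interpret L: cring L by fact
  have "cring (L\<lparr>carrier := B\<rparr>)"
    using L.subcring_iff[OF subringE(1)[OF assms(2)]] L.subcringI'[OF assms(2)] by simp
  then show ?thesis
    by (rule UnivPoly.ring_hom_cringI[OF _ L.is_cring])
      (use subringE(1)[OF assms(2)] in \<open>auto intro!: ring_hom_memI\<close>)
qed

text \<open>Over a subring that contains the inverse \<open>w\<close> of \<open>x\<close>, integrality of \<open>x\<close>
  amounts to membership.\<close>

lemma integral_if_polynomial_in_inverse:
  assumes \<iota>: "ring_hom_cring R L \<iota>" and nt: "\<one>\<^bsub>L\<^esub> \<noteq> \<zero>\<^bsub>L\<^esub>"
    and x: "x \<in> carrier L" and w: "w \<in> carrier L" "x \<otimes>\<^bsub>L\<^esub> w = \<one>\<^bsub>L\<^esub>"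
    and q: "q \<in> carrier (UP R)" "x = upeval R L \<iota> w q"
  obtains p where "monic_poly R p" and "upeval R L \<iota> x p = \<zero>\<^bsub>L\<^esub>"
proof -
  interpret i: ring_hom_cring R L \<iota> by fact
  interpret U: UP_cring R "UP R" by unfold_locales simp
  let ?n = "deg R q"
  have qc: "q k \<in> carrier R" for k using q(1) by (simp add: UP_carrier_iff)
  have nR: "\<one>\<^bsub>R\<^esub> \<noteq> \<zero>\<^bsub>R\<^esub>" using nt i.hom_one i.hom_zero by metis
  \<comment> \<open>Multiplying \<open>x = q(w)\<close> by the \<open>?n\<close>-th power of
    \<open>x\<close> turns powers of \<open>w\<close> into powers of \<open>x\<close> with the
    coefficients reversed; \<open>p\<close> is the resulting monic relation of degree
    \<open>Suc ?n\<close>.\<close>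
  define p where "p = (\<lambda>k. if k = Suc ?n then \<one>\<^bsub>R\<^esub> else if k \<le> ?n then \<ominus>\<^bsub>R\<^esub> q (?n - k) else \<zero>\<^bsub>R\<^esub>)"
  have pc: "p \<in> carrier (UP R)" 
    unfolding UP_carrier_iff p_def using qc by (auto intro!: exI[of _ "Suc ?n"])
  have pk: "p k \<in> carrier R" for k using pc by (simp add: UP_carrier_iff)
  have d: "deg R p = Suc ?n"
  proof (rule antisym)
    show "deg R p \<le> Suc ?n" by (rule U.deg_aboveI[OF _ pc]) (simp add: coeff_UP[OF pc], simp add: p_def)
    show "Suc ?n \<le> deg R p" by (rule U.deg_belowI[OF _ pc]) (simp add: coeff_UP[OF pc], simp add: p_def nR)
  qed
  have m: "monic_poly R p" unfolding monic_poly_def d coeff_UP[OF pc] using pc by (simp add: p_def)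
  let ?g = "\<lambda>k. \<iota> (q k) \<otimes>\<^bsub>L\<^esub> w [^]\<^bsub>L\<^esub> k"
  have gc: "?g k \<in> carrier L" for k using qc w by simp
  have xn: "x [^]\<^bsub>L\<^esub> ?n \<in> carrier L" using x by simp
  have pow: "x [^]\<^bsub>L\<^esub> (k::nat) \<otimes>\<^bsub>L\<^esub> w [^]\<^bsub>L\<^esub> k = \<one>\<^bsub>L\<^esub>" for k
    using i.S.nat_pow_distrib[OF x w(1), of k] w(2) by simp
  have "\<iota> (p k) \<otimes>\<^bsub>L\<^esub> x [^]\<^bsub>L\<^esub> k = (\<ominus>\<^bsub>L\<^esub> (x [^]\<^bsub>L\<^esub> ?n)) \<otimes>\<^bsub>L\<^esub> ?g (?n - k)" if k: "k \<le> ?n" for k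
  proof -
    have "x [^]\<^bsub>L\<^esub> ?n = x [^]\<^bsub>L\<^esub> k \<otimes>\<^bsub>L\<^esub> x [^]\<^bsub>L\<^esub> (?n - k)"
      using i.S.nat_pow_mult[OF x, of k "?n - k"] k by simp
    then have "x [^]\<^bsub>L\<^esub> ?n \<otimes>\<^bsub>L\<^esub> w [^]\<^bsub>L\<^esub> (?n - k) = x [^]\<^bsub>L\<^esub> k"
      using pow[of "?n - k"] x w by (simp add: i.S.m_assoc)
    moreover have "(\<ominus>\<^bsub>L\<^esub> (x [^]\<^bsub>L\<^esub> ?n)) \<otimes>\<^bsub>L\<^esub> ?g (?n - k)
        = \<ominus>\<^bsub>L\<^esub> (\<iota> (q (?n - k)) \<otimes>\<^bsub>L\<^esub> (x [^]\<^bsub>L\<^esub> ?n \<otimes>\<^bsub>L\<^esub> w [^]\<^bsub>L\<^esub> (?n - k)))"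
      using xn w(1) i.hom_closed[OF qc[of "?n - k"]] by (simp add: i.S.l_minus i.S.r_minus i.S.m_lcomm)
    moreover have "\<iota> (p k) = \<ominus>\<^bsub>L\<^esub> \<iota> (q (?n - k))" using k qc by (simp add: p_def)
    ultimately show ?thesis using x i.hom_closed[OF qc[of "?n - k"]] by (simp add: i.S.l_minus)
  qed
  then have "(\<Oplus>\<^bsub>L\<^esub>k\<in>{..?n}. \<iota> (p k) \<otimes>\<^bsub>L\<^esub> x [^]\<^bsub>L\<^esub> k)
      = (\<Oplus>\<^bsub>L\<^esub>k\<in>{..?n}. (\<ominus>\<^bsub>L\<^esub> (x [^]\<^bsub>L\<^esub> ?n)) \<otimes>\<^bsub>L\<^esub> ?g (?n - k))"
    by (intro i.S.finsum_cong' refl) (use xn w(1) i.hom_closed[OF qc] in auto)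
  also have "\<dots> = (\<ominus>\<^bsub>L\<^esub> (x [^]\<^bsub>L\<^esub> ?n)) \<otimes>\<^bsub>L\<^esub> (\<Oplus>\<^bsub>L\<^esub>k\<in>{..?n}. ?g (?n - k))"
    by (rule i.S.finsum_rdistr[symmetric]) (use xn gc in auto)
  also have "(\<Oplus>\<^bsub>L\<^esub>k\<in>{..?n}. ?g (?n - k)) = (\<Oplus>\<^bsub>L\<^esub>k\<in>(\<lambda>k. ?n - k) ` {..?n}. ?g k)"
    by (rule i.S.add.finprod_reindex[symmetric]) (use gc in \<open>auto simp: inj_on_def\<close>)
  also have "(\<lambda>k. ?n - k) ` {..?n} = {..?n}"
  proof
    show "{..?n} \<subseteq> (\<lambda>k. ?n - k) ` {..?n}"
    proof
      fix k assume "k \<in> {..?n}"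
      then show "k \<in> (\<lambda>k. ?n - k) ` {..?n}" by (intro image_eqI[of _ _ "?n - k"]) auto
    qed
  qed auto
  also have "(\<Oplus>\<^bsub>L\<^esub>k\<in>{..?n}. ?g k) = x"
    unfolding q(2) by (rule eval_eq_sum[OF \<iota> q(1) order.refl w(1), symmetric])
  finally have s: "(\<Oplus>\<^bsub>L\<^esub>k\<in>{..?n}. \<iota> (p k) \<otimes>\<^bsub>L\<^esub> x [^]\<^bsub>L\<^esub> k) = \<ominus>\<^bsub>L\<^esub> (x [^]\<^bsub>L\<^esub> ?n) \<otimes>\<^bsub>L\<^esub> x" .
  have "upeval R L \<iota> x p = (\<Oplus>\<^bsub>L\<^esub>k\<in>{..Suc ?n}. \<iota> (p k) \<otimes>\<^bsub>L\<^esub> x [^]\<^bsub>L\<^esub> k)"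
    by (rule eval_eq_sum[OF \<iota> pc _ x]) (simp add: d)
  also have "\<dots> = \<iota> (p (Suc ?n)) \<otimes>\<^bsub>L\<^esub> x [^]\<^bsub>L\<^esub> Suc ?n \<oplus>\<^bsub>L\<^esub> (\<Oplus>\<^bsub>L\<^esub>k\<in>{..?n}. \<iota> (p k) \<otimes>\<^bsub>L\<^esub> x [^]\<^bsub>L\<^esub> k)"
    using pk x by (intro i.S.finsum_Suc) auto
  also have "\<dots> = x [^]\<^bsub>L\<^esub> Suc ?n \<oplus>\<^bsub>L\<^esub> \<ominus>\<^bsub>L\<^esub> (x [^]\<^bsub>L\<^esub> ?n) \<otimes>\<^bsub>L\<^esub> x"
    unfolding s using x by (simp add: p_def)
  also have "\<dots> = \<zero>\<^bsub>L\<^esub>" using x by (simp add: i.S.l_minus i.S.r_neg)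
  finally show thesis using that m by blast
qed

definition integrally_closed_in :: "('a, 'm) ring_scheme \<Rightarrow> 'a set \<Rightarrow> bool"
  where "integrally_closed_in L B \<longleftrightarrow> subring B L \<and>
    (\<forall>y\<in>carrier L. \<forall>p. monic_poly (L\<lparr>carrier := B\<rparr>) p \<longrightarrow>
      upeval (L\<lparr>carrier := B\<rparr>) L id y p = \<zero>\<^bsub>L\<^esub> \<longrightarrow> y \<in> B)"

text \<open>Division by the monic relation \<open>p\<close> of \<open>y\<close> leaves remainders of
  smaller degree, so finitely many powers of \<open>y\<close> span \<open>B[y]\<close>.\<close>

lemma eval_mem_span:
  assumes "cring L" and B: "subring B L" and y: "y \<in> carrier L"
    and p: "monic_poly (L\<lparr>carrier := B\<rparr>) p" "upeval (L\<lparr>carrier := B\<rparr>) L id y p = \<zero>\<^bsub>L\<^esub>"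
      "deg (L\<lparr>carrier := B\<rparr>) p > 0"
    and h: "h \<in> carrier (UP (L\<lparr>carrier := B\<rparr>))"
  shows "upeval (L\<lparr>carrier := B\<rparr>) L id y h
    \<in> span_upto L B (\<lambda>i. y [^]\<^bsub>L\<^esub> i) (deg (L\<lparr>carrier := B\<rparr>) p)"
proof -
  interpret L: cring L by fact
  let ?B = "L\<lparr>carrier := B\<rparr>"
  let ?n = "deg ?B p"
  note inc = subring_incl_hom[OF assms(1) B]
  interpret i: ring_hom_cring ?B L id by (rule inc)
  interpret U: UP_cring ?B "UP ?B" by unfold_locales simp
  interpret e: ring_hom_cring "UP ?B" L "upeval ?B L id y" by (rule eval_hom[OF inc y])
  note pc = monic_polyD[OF p(1)]
  have "p \<noteq> \<zero>\<^bsub>UP ?B\<^esub>" using p(3) by auto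
  \<comment> \<open>Pseudo-division multiplies by a power of the leading coefficient, which is one
    here.\<close>
  from U.long_div_theorem[OF pc(1) h this, unfolded coeff_UP[OF pc(1)] pc(2)]
  obtain q r k where q: "q \<in> carrier (UP ?B)" "r \<in> carrier (UP ?B)"
    and "\<one>\<^bsub>?B\<^esub> [^]\<^bsub>?B\<^esub> (k::nat) \<odot>\<^bsub>UP ?B\<^esub> h = p \<otimes>\<^bsub>UP ?B\<^esub> q \<oplus>\<^bsub>UP ?B\<^esub> r"
    and r: "r = \<zero>\<^bsub>UP ?B\<^esub> \<or> deg ?B r < ?n"
    by (elim exE conjE) (rule that; assumption)
  then have hq: "h = p \<otimes>\<^bsub>UP ?B\<^esub> q \<oplus>\<^bsub>UP ?B\<^esub> r" using h by (simp only: i.R.nat_pow_one U.UP_smult_one)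
  have "upeval ?B L id y h = upeval ?B L id y p \<otimes>\<^bsub>L\<^esub> upeval ?B L id y q \<oplus>\<^bsub>L\<^esub> upeval ?B L id y r"
    unfolding hq using pc(1) q by (simp only: e.hom_add e.hom_mult U.UP_mult_closed)
  also have "\<dots> = upeval ?B L id y r"
    unfolding p(2) using e.hom_closed[OF q(1)] e.hom_closed[OF q(2)] by (simp only: L.l_null L.l_zero)
  also have "deg ?B r \<le> ?n - 1" using r p(3) by auto
  then have "upeval ?B L id y r = (\<Oplus>\<^bsub>L\<^esub>i\<in>{..?n - 1}. id (r i) \<otimes>\<^bsub>L\<^esub> y [^]\<^bsub>L\<^esub> i)"
    by (rule eval_eq_sum[OF inc q(2) _ y])
  also have "{..?n - 1} = {..<?n}" using p(3) by auto
  also have "(\<Oplus>\<^bsub>L\<^esub>i\<in>{..<k}. id (r i) \<otimes>\<^bsub>L\<^esub> y [^]\<^bsub>L\<^esub> i) \<in> span_upto L B (\<lambda>i. y [^]\<^bsub>L\<^esub> i) k" for k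
  proof (induct k)
    case (Suc k)
    have rB: "r i \<in> B" for i using q(2) unfolding UP_carrier_iff by simp
    then have rL: "r i \<in> carrier L" for i using subringE(1)[OF B] by blast
    have "(\<Oplus>\<^bsub>L\<^esub>i\<in>{..<Suc k}. id (r i) \<otimes>\<^bsub>L\<^esub> y [^]\<^bsub>L\<^esub> i)
        = (\<Oplus>\<^bsub>L\<^esub>i\<in>{..<k}. id (r i) \<otimes>\<^bsub>L\<^esub> y [^]\<^bsub>L\<^esub> i) \<oplus>\<^bsub>L\<^esub> r k \<otimes>\<^bsub>L\<^esub> y [^]\<^bsub>L\<^esub> k"
      unfolding lessThan_Suc using rL y by (subst L.finsum_insert) (auto simp: L.a_comm Pi_def)
    then show ?case using Suc rB[of k] by auto
  qed simp
  finally show ?thesis .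
qed

text \<open>If \<open>x\<close> is not integral, then it is not a polynomial in its inverse \<open>w\<close>; a subring that
  contains \<open>w\<close> and is maximal with respect to avoiding \<open>x\<close> is integrally closed, since
  otherwise Nakayama's lemma applies to a finite module on which \<open>w\<close> acts surjectively.\<close>

lemma exists_integrally_closed_avoiding:
  assumes "field L" and \<iota>: "ring_hom_cring R L \<iota>" and x: "x \<in> carrier L"
    and nonint: "\<And>p. monic_poly R p \<Longrightarrow> upeval R L \<iota> x p \<noteq> \<zero>\<^bsub>L\<^esub>"
  obtains B where "integrally_closed_in L B" and "\<iota> ` carrier R \<subseteq> B" and "x \<notin> B"
proof -
  interpret L: field L by fact
  interpret i: ring_hom_cring R L \<iota> by fact
  interpret W: UP_pre_univ_prop R L \<iota> "UP R" by unfold_locales simp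
  have nR: "\<one>\<^bsub>R\<^esub> \<noteq> \<zero>\<^bsub>R\<^esub>" using L.one_not_zero i.hom_one i.hom_zero by metis
  have "x \<noteq> \<zero>\<^bsub>L\<^esub>"
  proof
    assume "x = \<zero>\<^bsub>L\<^esub>"
    then have "upeval R L \<iota> x (up_ring.monom (UP R) \<one>\<^bsub>R\<^esub> 1) = \<zero>\<^bsub>L\<^esub>" using W.eval_monom1[OF x] by simp
    moreover have "monic_poly R (up_ring.monom (UP R) \<one>\<^bsub>R\<^esub> 1)"
      unfolding monic_poly_def using W.deg_monom[OF nR, of 1] by simp
    ultimately show False using nonint by blast
  qed
  then have "x \<in> Units L" using x L.field_Units by blast
  define w where "w = inv\<^bsub>L\<^esub> x"
  have w: "w \<in> carrier L" "x \<otimes>\<^bsub>L\<^esub> w = \<one>\<^bsub>L\<^esub>"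
    using \<open>x \<in> Units L\<close> by (simp_all add: w_def)
  interpret e: ring_hom_cring "UP R" L "upeval R L \<iota> w" by (rule eval_hom[OF \<iota> w(1)])
  \<comment> \<open>This is \<open>R[w]\<close>. It avoids \<open>x\<close>, because otherwise
    \<open>x\<close> would be a polynomial in its inverse and thus integral.\<close>
  let ?A = "upeval R L \<iota> w ` carrier (UP R)"
  have sA: "subring ?A L" by (rule e.ring.img_is_subring[OF W.P.carrier_is_subring])
  have xA: "x \<notin> ?A"
    using integral_if_polynomial_in_inverse[OF \<iota> L.one_not_zero x w] nonint by blast
  have wA: "w \<in> ?A"
    using W.eval_monom1[OF w(1)] W.monom_closed[of "\<one>\<^bsub>R\<^esub>" 1] by (metis image_eqI i.R.one_closed)
  have \<iota>A: "\<iota> ` carrier R \<subseteq> ?A"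
  proof
    fix z assume "z \<in> \<iota> ` carrier R"
    then obtain r where r: "r \<in> carrier R" "z = \<iota> r" by blast
    then show "z \<in> ?A" using W.eval_const[OF w(1) r(1)] W.monom_closed[OF r(1)] by (metis image_eqI)
  qed
  let ?S = "{B. subring B L \<and> ?A \<subseteq> B \<and> x \<notin> B}"
  have "\<exists>M\<in>?S. \<forall>Z\<in>?S. M \<subseteq> Z \<longrightarrow> Z = M"
  proof (rule subset_Zorn_nonempty)
    show "?S \<noteq> {}" using sA xA by blast
    fix C assume C: "C \<noteq> {}" "subset.chain ?S C"
    then have S: "\<And>B. B \<in> C \<Longrightarrow> subring B L \<and> ?A \<subseteq> B \<and> x \<notin> B" by (auto simp: pred_on.chain_def)
    have "subring (\<Union>C) L"
      by (rule L.chain_Union_subring[OF C(1)]) (use S C(2) in \<open>auto simp: pred_on.chain_def, blast\<close>)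
    moreover have "?A \<subseteq> \<Union>C" using S C(1) by blast
    moreover have "x \<notin> \<Union>C" using S by blast
    ultimately show "\<Union>C \<in> ?S" by blast
  qed
  then obtain B where B: "subring B L" "?A \<subseteq> B" "x \<notin> B"
    and max: "\<And>Z. subring Z L \<Longrightarrow> B \<subseteq> Z \<Longrightarrow> x \<notin> Z \<Longrightarrow> Z = B" by (smt (verit) mem_Collect_eq order.trans)
  let ?B = "L\<lparr>carrier := B\<rparr>"
  note inc = subring_incl_hom[OF L.is_cring B(1)]
  interpret b: ring_hom_cring ?B L id by (rule inc)
  interpret V: UP_pre_univ_prop ?B L id "UP ?B" by unfold_locales
  have "y \<in> B" if y: "y \<in> carrier L" and p: "monic_poly ?B p" "upeval ?B L id y p = \<zero>\<^bsub>L\<^esub>" for y p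
  proof (rule ccontr)
    assume yB: "y \<notin> B"
    interpret e: ring_hom_cring "UP ?B" L "upeval ?B L id y" by (rule eval_hom[OF inc y])
    have d: "deg ?B p > 0"
    proof (rule ccontr)
      assume "\<not> ?thesis"
      then have "p = \<one>\<^bsub>UP ?B\<^esub>" using monic_deg_0[OF b.R.is_cring p(1)] by simp
      then show False using p(2) e.hom_one L.one_not_zero by simp
    qed
    let ?Z = "upeval ?B L id y ` carrier (UP ?B)"
    have sZ: "subring ?Z L" by (rule e.ring.img_is_subring[OF V.P.carrier_is_subring])
    have BZ: "B \<subseteq> ?Z"
    proof
      fix z assume "z \<in> B"
      then have z: "z \<in> carrier ?B" by simp
      show "z \<in> ?Z" by (rule image_eqI[OF _ V.monom_closed[OF z, of 0]]) (simp add: V.eval_const[OF y z])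
    qed
    have yZ: "y \<in> ?Z"
      by (rule image_eqI[OF _ V.monom_closed[OF b.R.one_closed, of 1]]) (rule V.eval_monom1[OF y, symmetric])
    \<comment> \<open>\<open>?Z\<close> is \<open>B[y]\<close>, a proper enlargement of
      \<open>B\<close>, so it contains \<open>x\<close> by maximality.\<close>
    have xZ: "x \<in> ?Z" using max[OF sZ BZ] yZ yB by blast
    have wB: "w \<in> B" using wA B(2) by blast
    let ?m = "\<lambda>j. y [^]\<^bsub>L\<^esub> (j::nat)"
    have mc: "?m j \<in> carrier L" for j using y by simp
    have mZ: "?m j \<in> ?Z" for j
    proof (induct j)
      case 0
      then show ?case using subringE(3)[OF sZ] by (simp only: L.nat_pow_0)
    next
      case (Suc j)
      then show ?case using subringE(6)[OF sZ Suc yZ] by (simp only: L.nat_pow_Suc)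
    qed
    have "\<exists>s\<in>span_upto L B ?m (deg ?B p). \<one>\<^bsub>L\<^esub> \<otimes>\<^bsub>L\<^esub> ?m j = w \<otimes>\<^bsub>L\<^esub> s" for j
    proof -
      obtain h where h: "h \<in> carrier (UP ?B)" "x \<otimes>\<^bsub>L\<^esub> ?m j = upeval ?B L id y h"
        using subringE(6)[OF sZ xZ mZ[of j]] by blast
      \<comment> \<open>Since \<open>x\<close> lies in \<open>B[y]\<close>, every power of
        \<open>y\<close> is \<open>w\<close> times an element of \<open>B[y]\<close>: this is the
        surjectivity of \<open>w\<close> that Nakayama's lemma requires.\<close>
      have "\<one>\<^bsub>L\<^esub> \<otimes>\<^bsub>L\<^esub> ?m j = w \<otimes>\<^bsub>L\<^esub> (x \<otimes>\<^bsub>L\<^esub> ?m j)"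
        using w x mc[of j] by (metis L.m_assoc L.m_comm)
      then show ?thesis using eval_mem_span[OF L.is_cring B(1) y p d h(1)] unfolding h(2) by blast
    qed
    moreover have "\<one>\<^bsub>L\<^esub> \<in> {\<one>\<^bsub>L\<^esub> \<oplus>\<^bsub>L\<^esub> w \<otimes>\<^bsub>L\<^esub> c |c. c \<in> B}"
      using w subringE(2)[OF B(1)] by (auto intro!: exI[of _ "\<zero>\<^bsub>L\<^esub>"])
    ultimately obtain c where c: "c \<in> B" "\<forall>j<deg ?B p. (\<one>\<^bsub>L\<^esub> \<oplus>\<^bsub>L\<^esub> w \<otimes>\<^bsub>L\<^esub> c) \<otimes>\<^bsub>L\<^esub> ?m j = \<zero>\<^bsub>L\<^esub>"
      using L.nakayama[where m = ?m and u = "\<one>\<^bsub>L\<^esub>" and n = "deg ?B p", OF B(1) mc wB] by blast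
    have cL: "c \<in> carrier L" using c(1) subringE(1)[OF B(1)] by blast
    \<comment> \<open>The power with exponent zero is one, so the annihilating factor itself
      vanishes. Multiplying it by \<open>x\<close> gives \<open>x = -c\<close>, which lies in
      \<open>B\<close>.\<close>
    have "\<one>\<^bsub>L\<^esub> \<oplus>\<^bsub>L\<^esub> w \<otimes>\<^bsub>L\<^esub> c = \<zero>\<^bsub>L\<^esub>" using c(2)[rule_format, OF d] w cL by simp
    then have "x \<otimes>\<^bsub>L\<^esub> (\<one>\<^bsub>L\<^esub> \<oplus>\<^bsub>L\<^esub> w \<otimes>\<^bsub>L\<^esub> c) = \<zero>\<^bsub>L\<^esub>" using x by simp
    then have "x \<oplus>\<^bsub>L\<^esub> c = \<zero>\<^bsub>L\<^esub>" using x w cL by (simp add: L.r_distr L.m_assoc[symmetric])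
    then have "x = \<ominus>\<^bsub>L\<^esub> c" using x cL L.minus_equality by metis
    then show False using subringE(5)[OF B(1) c(1)] B(3) by simp
  qed
  then have "integrally_closed_in L B" unfolding integrally_closed_in_def using B(1) by blast
  moreover have "\<iota> ` carrier R \<subseteq> B" using \<iota>A B(2) by blast
  ultimately show thesis using that B(3) by blast
qed

text \<open>\<open>S\<close> is the intersection of all integrally closed subrings that contain the
  image of \<open>R\<close>. A root in \<open>L\<close> of a monic polynomial over \<open>S\<close>
  lies in each of them, and an element that is not integral over \<open>R\<close> is avoided by one
  of them.\<close>

lemma exists_integral_closure:
  assumes "field L" and rc: "root_closed L" and \<iota>: "ring_hom_cring R L \<iota>"
  obtains S where "subring S L" and "\<iota> ` carrier R \<subseteq> S" and "root_closed (L\<lparr>carrier := S\<rparr>)"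
    and "ring_hom_cring R (L\<lparr>carrier := S\<rparr>) \<iota>" and "integral_over R (L\<lparr>carrier := S\<rparr>) \<iota>"
proof -
  interpret L: field L by fact
  interpret i: ring_hom_cring R L \<iota> by fact
  let ?F = "{B. integrally_closed_in L B \<and> \<iota> ` carrier R \<subseteq> B}"
  define S where "S = \<Inter>?F"
  \<comment> \<open>\<open>L\<close> itself belongs to the family, so the intersection is not
    empty.\<close>
  have "integrally_closed_in L (carrier L)"
    unfolding integrally_closed_in_def using L.carrier_is_subring by blast
  then have ne: "?F \<noteq> {}" by (auto simp: Pi_def)
  have sS: "subring S L" unfolding S_def
    by (rule L.subring_Inter[OF _ ne]) (auto simp: integrally_closed_in_def)
  have iS: "\<iota> ` carrier R \<subseteq> S" unfolding S_def by blast
  let ?S = "L\<lparr>carrier := S\<rparr>"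
  note inc = subring_incl_hom[OF L.is_cring sS]
  interpret s: ring_hom_cring ?S L id by (rule inc)
  have h: "ring_hom_cring R ?S \<iota>"
    by (rule UnivPoly.ring_hom_cringI[OF i.R.is_cring s.R.is_cring])
      (use iS in \<open>auto intro!: ring_hom_memI\<close>)
  have "root_closed ?S" unfolding root_closed_def
  proof (intro allI impI)
    fix p assume p: "monic_poly ?S p" "deg ?S p > 0"
    note pc = monic_polyD(1)[OF p(1)]
    have up: "upmap id p = p" unfolding upmap_def by simp
    note m = monic_upmap[OF inc L.one_not_zero p(1), unfolded up]
    obtain y where y: "y \<in> carrier L" "upeval L L id y p = \<zero>\<^bsub>L\<^esub>"
      using rc m p(2) unfolding root_closed_def by metis
    have idh: "ring_hom_cring L L id" by unfold_locales (simp add: ring_hom_def)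
    have "y \<in> B" if B: "B \<in> ?F" for B
    proof -
      have sB: "subring B L" using B unfolding integrally_closed_in_def by blast
      note incB = subring_incl_hom[OF L.is_cring sB]
      interpret b: ring_hom_cring "L\<lparr>carrier := B\<rparr>" L id by (rule incB)
      have "S \<subseteq> B" unfolding S_def using B by blast
      then have sb: "ring_hom_cring ?S (L\<lparr>carrier := B\<rparr>) id"
        by (intro UnivPoly.ring_hom_cringI s.R.is_cring b.R.is_cring) (auto intro!: ring_hom_memI)
      have pB: "monic_poly (L\<lparr>carrier := B\<rparr>) p"
        using monic_upmap(1)[OF sb _ p(1), unfolded up] L.one_not_zero by simp
      have "upeval (L\<lparr>carrier := B\<rparr>) L id y p = \<zero>\<^bsub>L\<^esub>"
        using eval_upmap[OF incB idh monic_polyD(1)[OF pB] y(1), unfolded up] y(2) by simp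
      then show ?thesis using B pB y(1) unfolding integrally_closed_in_def by blast
    qed
    then have yS: "y \<in> carrier ?S" unfolding S_def by simp
    have idS: "ring_hom_cring ?S ?S id" by unfold_locales (simp add: ring_hom_def)
    have "upeval ?S ?S id y p = \<zero>\<^bsub>L\<^esub>"
      using hom_eval[OF idS inc pc yS] eval_upmap[OF inc idh pc y(1), unfolded up] y(2) by simp
    then show "\<exists>a\<in>carrier ?S. upeval ?S ?S id a p = \<zero>\<^bsub>?S\<^esub>" using yS by auto
  qed
  moreover have "integral_over R ?S \<iota>" unfolding integral_over_def
  proof (rule ccontr)
    assume "\<not> (\<forall>s\<in>carrier ?S. \<exists>p. monic_poly R p \<and> upeval R ?S \<iota> s p = \<zero>\<^bsub>?S\<^esub>)"
    then obtain x where x: "x \<in> carrier ?S" and n: "\<And>p. monic_poly R p \<Longrightarrow> upeval R ?S \<iota> x p \<noteq> \<zero>\<^bsub>?S\<^esub>" by blast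
    have xL: "x \<in> carrier L" using x subringE(1)[OF sS] by auto
    have "upeval R L \<iota> x p \<noteq> \<zero>\<^bsub>L\<^esub>" if p: "monic_poly R p" for p
      using n[OF p] hom_eval[OF h inc monic_polyD(1)[OF p] x] by simp
    then obtain B where "integrally_closed_in L B" "\<iota> ` carrier R \<subseteq> B" "x \<notin> B"
      using exists_integrally_closed_avoiding[OF \<open>field L\<close> \<iota> xL] by blast
    then show False using x unfolding S_def by auto
  qed
  ultimately show thesis using that sS iS h by blast
qed

section \<open>Transport along isomorphisms and cardinality bounds\<close>

text \<open>Both directions are named because polynomials and ideals are pulled back while roots are
  pushed forward.\<close>

definition ring_iso_pair :: "('a, 'm) ring_scheme \<Rightarrow> ('b, 'n) ring_scheme \<Rightarrow> ('a \<Rightarrow> 'b) \<Rightarrow> ('b \<Rightarrow> 'a) \<Rightarrow> bool"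
  where "ring_iso_pair S T h k \<longleftrightarrow> ring_hom_cring S T h \<and> ring_hom_cring T S k \<and>
    (\<forall>s\<in>carrier S. k (h s) = s) \<and> (\<forall>t\<in>carrier T. h (k t) = t)"

lemma ring_iso_pair_image_ring:
  assumes "cring S" and inj: "inj_on h (carrier S)"
  shows "ring_iso_pair S (image_ring h S) h (inv_into (carrier S) h)"
proof -
  interpret S: cring S by fact
  let ?T = "image_ring h S"
  interpret T: ring ?T by (rule S.inj_imp_image_ring_is_ring[OF inj])
  have iso: "h \<in> ring_iso S ?T" by (rule inj_imp_image_ring_iso[OF inj])
  then have hom: "h \<in> ring_hom S ?T" unfolding ring_iso_def by blast
  note h = ring_hom_memE[OF hom]
  have car: "carrier ?T = h ` carrier S" by (rule image_ring_carrier)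
  have cT: "cring ?T"
  proof
    fix x y assume "x \<in> carrier ?T" "y \<in> carrier ?T"
    then obtain a b where "a \<in> carrier S" "b \<in> carrier S" "x = h a" "y = h b" unfolding car by blast
    then show "x \<otimes>\<^bsub>?T\<^esub> y = y \<otimes>\<^bsub>?T\<^esub> x" using h(2) S.m_comm by metis
  qed
  let ?k = "inv_into (carrier S) h"
  have kh: "?k (h s) = s" if "s \<in> carrier S" for s using inv_into_f_f[OF inj that] .
  have "?k \<in> ring_hom ?T S"
  proof (rule ring_hom_memI)
    show "?k \<one>\<^bsub>?T\<^esub> = \<one>\<^bsub>S\<^esub>" using kh[of "\<one>\<^bsub>S\<^esub>"] h(4) by simp
    fix x y assume "x \<in> carrier ?T" "y \<in> carrier ?T"
    then obtain a b where ab: "a \<in> carrier S" "b \<in> carrier S" "x = h a" "y = h b" unfolding car by blast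
    show "?k x \<in> carrier S" using ab kh by simp
    show "?k (x \<otimes>\<^bsub>?T\<^esub> y) = ?k x \<otimes>\<^bsub>S\<^esub> ?k y"
      unfolding ab(3,4) h(2)[OF ab(1,2), symmetric] using kh ab by simp
    show "?k (x \<oplus>\<^bsub>?T\<^esub> y) = ?k x \<oplus>\<^bsub>S\<^esub> ?k y"
      unfolding ab(3,4) h(3)[OF ab(1,2), symmetric] using kh ab by simp
  qed
  then show ?thesis unfolding ring_iso_pair_def
    using UnivPoly.ring_hom_cringI[OF S.is_cring cT hom] UnivPoly.ring_hom_cringI[OF cT S.is_cring] kh
    by (auto simp: car)
qed

lemma monic_deg_pos_nontrivial:
  assumes "cring S" and "monic_poly S p" and "deg S p > 0"
  shows "\<one>\<^bsub>S\<^esub> \<noteq> \<zero>\<^bsub>S\<^esub>"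
proof -
  interpret S: cring S by fact
  interpret U: UP_cring S "UP S" by unfold_locales simp
  note c = monic_polyD[OF assms(2)]
  show ?thesis using U.lcoeff_nonzero_deg[of p] c assms(3) by (auto simp: coeff_UP)
qed

lemma root_closed_iso:
  assumes iso: "ring_iso_pair S T h k" and rc: "root_closed S"
  shows "root_closed T"
  unfolding root_closed_def
proof (intro allI impI)
  have h: "ring_hom_cring S T h" and k: "ring_hom_cring T S k"
    and kh: "\<And>s. s \<in> carrier S \<Longrightarrow> k (h s) = s" and hk: "\<And>t. t \<in> carrier T \<Longrightarrow> h (k t) = t"
    using iso unfolding ring_iso_pair_def by auto
  interpret h: ring_hom_cring S T h by (rule h)
  interpret k: ring_hom_cring T S k by (rule k)
  fix p assume p: "monic_poly T p" "deg T p > 0"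
  note pc = monic_polyD(1)[OF p(1)]
  have "\<one>\<^bsub>T\<^esub> \<noteq> \<zero>\<^bsub>T\<^esub>" by (rule monic_deg_pos_nontrivial[OF h.S.is_cring p])
  then have nt: "\<one>\<^bsub>S\<^esub> \<noteq> \<zero>\<^bsub>S\<^esub>" using h.hom_one h.hom_zero by metis
  note m = monic_upmap[OF k nt p(1)]
  obtain a where a: "a \<in> carrier S" "upeval S S id a (upmap k p) = \<zero>\<^bsub>S\<^esub>"
    using rc m p(2) unfolding root_closed_def by metis
  have "h (k (p n)) = p n" for n using pc hk unfolding UP_carrier_iff by blast
  then have hp: "upmap h (upmap k p) = p" unfolding upmap_def by simp
  have idS: "ring_hom_cring S S id" by unfold_locales (simp add: ring_hom_def)
  have idT: "ring_hom_cring T T id" by unfold_locales (simp add: ring_hom_def)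
  note q = monic_polyD(1)[OF m(1)]
  have "upeval T T id (h a) p = upeval S T h (h a) (upmap k p)"
    using eval_upmap[OF h idT q h.hom_closed[OF a(1)]] unfolding hp by simp
  also have "\<dots> = h (upeval S S id a (upmap k p))" using hom_eval[OF idS h q a(1)] by simp
  finally have "upeval T T id (h a) p = \<zero>\<^bsub>T\<^esub>" using a(2) by simp
  then show "\<exists>a\<in>carrier T. upeval T T id a p = \<zero>\<^bsub>T\<^esub>" using h.hom_closed[OF a(1)] by blast
qed

lemma ring_iso_pair_surj:
  assumes "ring_iso_pair S T h k" shows "h ` carrier S = carrier T"
proof -
  interpret h: ring_hom_cring S T h using assms unfolding ring_iso_pair_def by blast
  interpret k: ring_hom_cring T S k using assms unfolding ring_iso_pair_def by blast
  show ?thesis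
  proof
    show "carrier T \<subseteq> h ` carrier S"
    proof
      fix t assume t: "t \<in> carrier T"
      then have "t = h (k t)" using assms unfolding ring_iso_pair_def by simp
      then show "t \<in> h ` carrier S" using k.hom_closed[OF t] by blast
    qed
  qed auto
qed

lemma domain_iso:
  assumes iso: "ring_iso_pair S T h k" and "domain S"
  shows "domain T"
proof -
  have k: "ring_hom_cring T S k" and hk: "\<And>t. t \<in> carrier T \<Longrightarrow> h (k t) = t"
    using iso unfolding ring_iso_pair_def by auto
  interpret k: ring_hom_cring T S k by (rule k)
  have "inj_on k (carrier T)" using hk by (rule inj_on_inverseI)
  then show ?thesis using k.ring.inj_on_domain assms(2) by blast
qed

lemma is_aic_iso:
  assumes iso: "ring_iso_pair S T h k" and "root_closed S" and i: "integral_over R S \<phi>" and t: "tight_extension R S \<phi>"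
  shows "is_aic R T (h \<circ> \<phi>)"
proof -
  have h: "ring_hom_cring S T h" and k: "ring_hom_cring T S k"
    and kh: "\<And>s. s \<in> carrier S \<Longrightarrow> k (h s) = s" and hk: "\<And>t. t \<in> carrier T \<Longrightarrow> h (k t) = t"
    using iso unfolding ring_iso_pair_def by auto
  interpret h: ring_hom_cring S T h by (rule h)
  interpret k: ring_hom_cring T S k by (rule k)
  have \<phi>: "ring_hom_cring R S \<phi>" and inj: "inj_on \<phi> (carrier R)"
    using t unfolding tight_extension_def ring_extension_def by auto
  interpret f: ring_hom_cring R S \<phi> by (rule \<phi>)
  have "inj_on h (carrier S)" using kh by (rule inj_on_inverseI)
  then have "inj_on (h \<circ> \<phi>) (carrier R)"
    using inj f.hom_closed by (intro comp_inj_on) (auto intro: inj_on_subset)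
  then have ext: "ring_extension R T (h \<circ> \<phi>)"
    unfolding ring_extension_def using ring_hom_cring_trans[OF \<phi> h] by blast
  have "J \<inter> (h \<circ> \<phi>) ` carrier R \<noteq> {\<zero>\<^bsub>T\<^esub>}" if J: "ideal J T" "J \<noteq> {\<zero>\<^bsub>T\<^esub>}" for J
  proof
    assume e: "J \<inter> (h \<circ> \<phi>) ` carrier R = {\<zero>\<^bsub>T\<^esub>}"
    interpret J: ideal J T by fact
    let ?J = "{s \<in> carrier S. h s \<in> J}"
    have "ideal ?J S" by (rule h.ring.ideal_vimage[OF J(1)])
    moreover have "?J \<noteq> {\<zero>\<^bsub>S\<^esub>}"
    proof
      assume 1: "?J = {\<zero>\<^bsub>S\<^esub>}"
      have "x = \<zero>\<^bsub>T\<^esub>" if x: "x \<in> J" for x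
      proof -
        have "k x \<in> ?J" using hk[OF J.Icarr[OF x]] k.hom_closed[OF J.Icarr[OF x]] x by simp
        then have "k x = \<zero>\<^bsub>S\<^esub>" unfolding 1 by simp
        then show ?thesis using hk[OF J.Icarr[OF x]] h.hom_zero by simp
      qed
      then show False using J(2) J.zero_closed by blast
    qed
    ultimately have 2: "?J \<inter> \<phi> ` carrier R \<noteq> {\<zero>\<^bsub>S\<^esub>}" using t unfolding tight_extension_def by blast
    have "\<zero>\<^bsub>S\<^esub> \<in> ?J \<inter> \<phi> ` carrier R"
      using J.zero_closed f.hom_zero f.R.zero_closed by (auto intro: rev_image_eqI)
    then obtain r where r: "r \<in> carrier R" "h (\<phi> r) \<in> J" "\<phi> r \<noteq> \<zero>\<^bsub>S\<^esub>" using 2 by blast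
    then have "h (\<phi> r) = \<zero>\<^bsub>T\<^esub>" using e by auto
    then have "\<phi> r = \<zero>\<^bsub>S\<^esub>" using kh[OF f.hom_closed[OF r(1)]] k.hom_zero by simp
    then show False using r(3) by blast
  qed
  then have "tight_extension R T (h \<circ> \<phi>)" unfolding tight_extension_def using ext by blast
  moreover have "integral_over R T (h \<circ> \<phi>)"
    by (rule integral_over_surj_trans[OF \<phi> h ring_iso_pair_surj[OF iso] i])
  moreover have "ai_closed T"
    using root_closed_imp_ai_closed[OF h.S.is_cring root_closed_iso[OF iso \<open>root_closed S\<close>]] .
  ultimately show ?thesis unfolding is_aic_def integral_extension_def integral_over_def using ext by blast
qed

text \<open>Iterating a pairing function is injective only on lists of equal length, so the length
  is recorded as well.\<close>

lemma lists_lepoll_infinite: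
  assumes "infinite (UNIV :: 'b set)"
  shows "(UNIV :: 'b list set) \<lesssim> (UNIV :: 'b set)"
proof -
  obtain g :: "'b \<times> 'b \<Rightarrow> 'b" where g: "inj g"
    using card_of_Times_same_infinite[OF assms, THEN ordIso_imp_ordLeq, unfolded card_of_ordLeq[symmetric]]
    by auto
  obtain z :: "nat \<Rightarrow> 'b" where z: "inj z" using infinite_countable_subset[OF assms] by blast
  define fold where "fold = (\<lambda>xs. foldr (\<lambda>x y. g (x, y)) xs (z 0))"
  have f: "xs = ys" if "length xs = length ys" "fold xs = fold ys" for xs ys
    using that by (induct xs ys rule: list_induct2) (use injD[OF g] in \<open>auto simp: fold_def\<close>)
  have "inj (\<lambda>xs. g (z (length xs), fold xs))"
  proof (rule injI)
    fix xs ys assume "g (z (length xs), fold xs) = g (z (length ys), fold ys)"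
    then have "z (length xs) = z (length ys)" "fold xs = fold ys" using injD[OF g] by auto
    then show "xs = ys" using f injD[OF z] by blast
  qed
  then show ?thesis unfolding lepoll_def by blast
qed

text \<open>A polynomial is determined by the list of its coefficients up to its degree.\<close>

lemma UP_lepoll:
  assumes inf: "infinite (UNIV :: 'b set)" and "cring R" and R: "carrier R \<lesssim> (UNIV :: 'b set)"
  shows "carrier (UP R) \<lesssim> (UNIV :: 'b set)"
proof -
  interpret R: cring R by fact
  interpret U: UP_cring R "UP R" by unfold_locales simp
  let ?l = "\<lambda>p. map p [0..<Suc (deg R p)]"
  have "inj_on ?l (carrier (UP R))"
  proof (rule inj_onI)
    fix p q assume p: "p \<in> carrier (UP R)" and q: "q \<in> carrier (UP R)" and e: "?l p = ?l q"
    have d: "deg R p = deg R q" using arg_cong[OF e, of length] by simp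
    show "p = q"
    proof
      fix n
      show "p n = q n"
      proof (cases "n \<le> deg R p")
        case True
        then show ?thesis using arg_cong[OF e, of "\<lambda>l. l ! n"] d by (simp del: upt_Suc)
      next
        case False
        then show ?thesis using U.deg_aboveD[of p n] U.deg_aboveD[of q n] p q d by (simp add: coeff_UP)
      qed
    qed
  qed
  moreover have "?l ` carrier (UP R) \<subseteq> lists (carrier R)" by (auto simp: UP_carrier_iff)
  ultimately have "carrier (UP R) \<lesssim> lists (carrier R)" unfolding lepoll_def by blast
  also have "lists (carrier R) \<lesssim> lists (UNIV :: 'b set)" by (rule lists_lepoll_mono[OF R])
  also have "lists (UNIV :: 'b set) \<lesssim> (UNIV :: 'b set)" using lists_lepoll_infinite[OF inf] by simp
  finally show ?thesis .
qed

text \<open>An element is encoded by a monic polynomial over \<open>R\<close> that it satisfies and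
  its number among the roots. There are finitely many roots because the polynomial splits over the
  domain \<open>S\<close>.\<close>

lemma integral_lepoll:
  assumes inf: "infinite (UNIV :: 'b set)" and R: "carrier R \<lesssim> (UNIV :: 'b set)"
    and \<phi>: "ring_hom_cring R S \<phi>" and "domain S" and ac: "ai_closed S" and int: "integral_over R S \<phi>"
  shows "carrier S \<lesssim> (UNIV :: 'b set)"
proof -
  interpret S: "domain" S by fact
  interpret f: ring_hom_cring R S \<phi> by fact
  have idS: "ring_hom_cring S S id" by unfold_locales (simp add: ring_hom_def)
  define roots where "roots p = {s \<in> carrier S. upeval R S \<phi> s p = \<zero>\<^bsub>S\<^esub>}" for p
  have fin: "finite (roots p)" if p: "monic_poly R p" for p
  proof -
    note m = monic_upmap(1)[OF \<phi> S.one_not_zero p]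
    obtain n :: nat and a where a: "a \<in> {..<n} \<rightarrow> carrier S" "upmap \<phi> p = (\<Otimes>\<^bsub>UP S\<^esub>i\<in>{..<n}. lin S (a i))"
      using ai_closedE[OF ac S.is_cring m] by metis
    have l: "(\<lambda>i. lin S (a i)) \<in> {..<n} \<rightarrow> carrier (UP S)"
      using a(1) lin_closed[OF S.is_cring] by blast
    have "s \<in> a ` {..<n}" if s: "s \<in> roots p" for s
    proof -
      have sc: "s \<in> carrier S" using s unfolding roots_def by blast
      interpret e: ring_hom_cring "UP S" S "upeval S S id s" by (rule eval_hom[OF idS sc])
      have l': "(\<lambda>i. upeval S S id s (lin S (a i))) \<in> {..<n} \<rightarrow> carrier S"
        using l e.hom_closed by blast
      have "upeval S S id s (upmap \<phi> p) = \<zero>\<^bsub>S\<^esub>"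
        using eval_upmap[OF \<phi> idS monic_polyD(1)[OF p] sc] s unfolding roots_def by simp
      then have "(\<Otimes>\<^bsub>S\<^esub>i\<in>{..<n}. upeval S S id s (lin S (a i))) = \<zero>\<^bsub>S\<^esub>"
        unfolding a(2) e.hom_finprod'[OF l] .
      then obtain i where i: "i < n" "upeval S S id s (lin S (a i)) = \<zero>\<^bsub>S\<^esub>"
        using S.finprod_zero_iff[OF _ l'] by auto
      have ai: "a i \<in> carrier S" using a(1) i(1) by auto
      then have "s = a i" using i(2) eval_lin[OF idS sc ai] S.minus_eq_zero_iff[OF sc ai] by simp
      then show ?thesis using i(1) by blast
    qed
    then have "roots p \<subseteq> a ` {..<n}" by blast
    then show ?thesis by (rule finite_subset) simp
  qed
  define P where "P s = (SOME p. monic_poly R p \<and> upeval R S \<phi> s p = \<zero>\<^bsub>S\<^esub>)" for s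
  have P: "monic_poly R (P s)" "s \<in> roots (P s)" if "s \<in> carrier S" for s
    using someI_ex[of "\<lambda>p. monic_poly R p \<and> upeval R S \<phi> s p = \<zero>\<^bsub>S\<^esub>"] int that
    unfolding P_def integral_over_def roots_def by blast+
  let ?e = "\<lambda>s. (P s, to_nat_on (roots (P s)) s)"
  have "inj_on ?e (carrier S)"
  proof (rule inj_onI)
    fix s t assume st: "s \<in> carrier S" "t \<in> carrier S" and e: "?e s = ?e t"
    then have p: "P s = P t" and n: "to_nat_on (roots (P s)) s = to_nat_on (roots (P s)) t" by auto
    have "countable (roots (P s))" using fin[OF P(1)[OF st(1)]] by (rule countable_finite)
    then show "s = t" using n P(2)[OF st(1)] P(2)[OF st(2)] unfolding p[symmetric] by simp
  qed
  moreover have "?e ` carrier S \<subseteq> carrier (UP R) \<times> (UNIV :: nat set)"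
    using P(1) monic_polyD(1) by blast
  ultimately have "carrier S \<lesssim> carrier (UP R) \<times> (UNIV :: nat set)" unfolding lepoll_def by blast
  also have "carrier (UP R) \<times> (UNIV :: nat set) \<lesssim> (UNIV :: 'b set) \<times> (UNIV :: 'b set)"
    using UP_lepoll[OF inf f.R.is_cring R] inf by (intro times_lepoll_mono) (simp_all add: infinite_le_lepoll)
  also have "(UNIV :: 'b set) \<times> (UNIV :: 'b set) \<lesssim> (UNIV :: 'b set)"
    unfolding lepoll_def using card_of_Times_same_infinite[OF inf, THEN ordIso_imp_ordLeq]
    unfolding card_of_ordLeq[symmetric] .
  finally show ?thesis .
qed

lemma transfer_ring:
  assumes "cring S" and "carrier S \<lesssim> (UNIV :: 'b set)"
  obtains T :: "'b ring" and h k where "ring_iso_pair S T h k"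
proof -
  obtain h :: "_ \<Rightarrow> 'b" where "inj_on h (carrier S)" using assms(2) unfolding lepoll_def by blast
  then show thesis using ring_iso_pair_image_ring[OF assms(1)] that by blast
qed

text \<open>The algebraically closed field need not fit into \<open>'b\<close>, but the integral
  closure of \<open>R\<close> inside it does. The result serves both for the factors and for the
  residue domain along which two factors are glued.\<close>

lemma exists_residue_closure:
  fixes R :: "('a, 'm) ring_scheme"
  assumes inf: "infinite (UNIV :: 'b set)" and R: "carrier R \<lesssim> (UNIV :: 'b set)" and P: "primeideal P R"
  obtains S :: "'b ring" and \<phi> where "ring_hom_cring R S \<phi>" and "domain S" and "root_closed S"
    and "integral_over R S \<phi>" and "\<And>r. r \<in> carrier R \<Longrightarrow> \<phi> r = \<zero>\<^bsub>S\<^esub> \<longleftrightarrow> r \<in> P"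
proof -
  obtain L :: "((('a set \<times> 'a set) set list \<times> nat) multiset \<Rightarrow> ('a set \<times> 'a set) set) ring" and \<iota>
    where L: "field L" "root_closed L" "ring_hom_cring R L \<iota>" "\<And>r. r \<in> carrier R \<Longrightarrow> \<iota> r = \<zero>\<^bsub>L\<^esub> \<longleftrightarrow> r \<in> P"
    using exists_root_closed_field[OF P] by metis
  obtain S where S: "subring S L" "root_closed (L\<lparr>carrier := S\<rparr>)"
    "ring_hom_cring R (L\<lparr>carrier := S\<rparr>) \<iota>" "integral_over R (L\<lparr>carrier := S\<rparr>) \<iota>"
    using exists_integral_closure[OF L(1-3)] by metis
  interpret L: field L by (rule L(1))
  let ?S = "L\<lparr>carrier := S\<rparr>"
  have dom: "domain ?S" by (rule L.subring_is_domain[OF S(1)])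
  interpret S: "domain" ?S by (rule dom)
  interpret f: ring_hom_cring R ?S \<iota> by (rule S(3))
  have "carrier ?S \<lesssim> (UNIV :: 'b set)"
    by (rule integral_lepoll[OF inf R S(3) dom root_closed_imp_ai_closed[OF S.is_cring S(2)] S(4)])
  then obtain T :: "'b ring" and h k where iso: "ring_iso_pair ?S T h k"
    using transfer_ring[OF S.is_cring] by blast
  have h: "ring_hom_cring ?S T h" and k: "ring_hom_cring T ?S k" and kh: "\<And>s. s \<in> carrier ?S \<Longrightarrow> k (h s) = s"
    using iso unfolding ring_iso_pair_def by auto
  interpret h: ring_hom_cring ?S T h by (rule h)
  interpret k: ring_hom_cring T ?S k by (rule k)
  have "(h \<circ> \<iota>) r = \<zero>\<^bsub>T\<^esub> \<longleftrightarrow> r \<in> P" if r: "r \<in> carrier R" for r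
  proof -
    have "h (\<iota> r) = \<zero>\<^bsub>T\<^esub> \<longleftrightarrow> \<iota> r = \<zero>\<^bsub>?S\<^esub>"
      using kh[OF f.hom_closed[OF r]] k.hom_zero h.hom_zero by metis
    then show ?thesis using L(4)[OF r] by simp
  qed
  then show thesis
    using that[OF ring_hom_cring_trans[OF S(3) h] domain_iso[OF iso dom] root_closed_iso[OF iso S(2)]
        integral_over_surj_trans[OF S(3) h ring_iso_pair_surj[OF iso] S(4)]] by blast
qed

section \<open>Products of absolute integral closures of residue domains\<close>

text \<open>Only the product of the two top coefficients survives in the convolution. Stated for the
  sum of the degrees, it holds even with zero divisors.\<close>

lemma coeff_mult_top:
  assumes "cring R" and p: "p \<in> carrier (UP R)" and q: "q \<in> carrier (UP R)"
  shows "(p \<otimes>\<^bsub>UP R\<^esub> q) (deg R p + deg R q) = p (deg R p) \<otimes>\<^bsub>R\<^esub> q (deg R q)"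
proof -
  interpret R: cring R by fact
  interpret U: UP_cring R "UP R" by unfold_locales simp
  let ?m = "deg R p" and ?n = "deg R q"
  have pc: "p i \<in> carrier R" "q i \<in> carrier R" for i using p q by (auto simp: UP_carrier_iff)
  have z: "p i \<otimes>\<^bsub>R\<^esub> q (?m + ?n - i) = (if ?m = i then p i \<otimes>\<^bsub>R\<^esub> q (?m + ?n - i) else \<zero>\<^bsub>R\<^esub>)"
    if "i \<le> ?m + ?n" for i
  proof (cases "i = ?m")
    case False
    then consider "?m < i" | "?n < ?m + ?n - i" using that by linarith
    then show ?thesis
    proof cases
      case 1
      then have "p i = \<zero>\<^bsub>R\<^esub>" using U.deg_aboveD[OF 1 p] p by (simp add: coeff_UP)
      then show ?thesis using pc by simp
    next
      case 2
      then have "q (?m + ?n - i) = \<zero>\<^bsub>R\<^esub>" using U.deg_aboveD[OF 2 q] q by (simp add: coeff_UP)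
      then show ?thesis using pc False by simp
    qed
  qed simp
  have "(p \<otimes>\<^bsub>UP R\<^esub> q) (?m + ?n) = (\<Oplus>\<^bsub>R\<^esub>i\<in>{..?m + ?n}. p i \<otimes>\<^bsub>R\<^esub> q (?m + ?n - i))"
    using U.coeff_mult[OF p q, of "?m + ?n"] p q by (simp add: coeff_UP del: U.coeff_mult)
  also have "\<dots> = (\<Oplus>\<^bsub>R\<^esub>i\<in>{..?m + ?n}. if ?m = i then p i \<otimes>\<^bsub>R\<^esub> q (?m + ?n - i) else \<zero>\<^bsub>R\<^esub>)"
    by (rule R.finsum_cong') (use z pc in auto)
  also have "\<dots> = p ?m \<otimes>\<^bsub>R\<^esub> q (?m + ?n - ?m)"
    by (rule R.add.finprod_singleton) (use pc in auto)
  finally show ?thesis by simp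
qed

lemma monic_mult:
  assumes R: "cring R" and p: "monic_poly R p" and q: "monic_poly R q"
  shows "monic_poly R (p \<otimes>\<^bsub>UP R\<^esub> q)"
proof -
  interpret R: cring R by fact
  interpret U: UP_cring R "UP R" by unfold_locales simp
  note pc = monic_polyD[OF p] and qc = monic_polyD[OF q]
  have c: "p \<otimes>\<^bsub>UP R\<^esub> q \<in> carrier (UP R)" using pc qc by simp
  have top: "(p \<otimes>\<^bsub>UP R\<^esub> q) (deg R p + deg R q) = \<one>\<^bsub>R\<^esub>"
    using coeff_mult_top[OF R pc(1) qc(1)] pc qc by simp
  show ?thesis
  proof (cases "\<one>\<^bsub>R\<^esub> = \<zero>\<^bsub>R\<^esub>")
    \<comment> \<open>Over the trivial ring all coefficients are equal to one, whatever the degree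
      of the product.\<close>
    case True
    then have "x = \<one>\<^bsub>R\<^esub>" if "x \<in> carrier R" for x using that R.one_zeroD by auto
    then show ?thesis unfolding monic_poly_def coeff_UP[OF c] using c by (simp add: UP_carrier_iff)
  next
    case False
    have "deg R (p \<otimes>\<^bsub>UP R\<^esub> q) = deg R p + deg R q"
    proof (rule antisym)
      show "deg R p + deg R q \<le> deg R (p \<otimes>\<^bsub>UP R\<^esub> q)"
        by (rule U.deg_belowI[OF _ c]) (unfold coeff_UP[OF c] top, rule False)
    qed (rule U.deg_mult_ring[OF pc(1) qc(1)])
    then show ?thesis unfolding monic_poly_def coeff_UP[OF c] using c top by simp
  qed
qed

lemma monic_one:
  assumes "cring R" shows "monic_poly R \<one>\<^bsub>UP R\<^esub>"
proof -
  interpret R: cring R by fact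
  interpret U: UP_cring R "UP R" by unfold_locales simp
  show ?thesis unfolding monic_poly_def by simp
qed

lemma monic_finprod:
  assumes R: "cring R" and "finite A" and "\<And>x. x \<in> A \<Longrightarrow> monic_poly R (f x)"
  shows "monic_poly R (\<Otimes>\<^bsub>UP R\<^esub>x\<in>A. f x)"
  using assms(2,3)
proof (induct A)
  interpret R: cring R by fact
  interpret U: UP_cring R "UP R" by unfold_locales simp
  {
    case empty
    then show ?case using monic_one[OF R] by simp
  next
    case (insert x A)
    then have "f y \<in> carrier (UP R)" if "y \<in> insert x A" for y using monic_polyD(1) that by blast
    then have "(\<Otimes>\<^bsub>UP R\<^esub>x\<in>insert x A. f x) = f x \<otimes>\<^bsub>UP R\<^esub> (\<Otimes>\<^bsub>UP R\<^esub>x\<in>A. f x)"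
      using insert(1,2) by (intro U.P.finprod_insert) auto
    then show ?case using monic_mult[OF R] insert by simp
  }
qed

lemma eval_cong:
  assumes f: "ring_hom_cring R S f" and g: "ring_hom_cring R S g" and "\<And>r. r \<in> carrier R \<Longrightarrow> f r = g r"
    and p: "p \<in> carrier (UP R)" and s: "s \<in> carrier S"
  shows "upeval R S f s p = upeval R S g s p"
proof -
  interpret g: ring_hom_cring R S g by fact
  have c: "p i \<in> carrier R" for i using p by (simp add: UP_carrier_iff)
  show ?thesis
    unfolding eval_eq_sum[OF f p order.refl s] eval_eq_sum[OF g p order.refl s]
    by (rule g.S.finsum_cong') (use assms(3) c s in auto)
qed

text \<open>Data shared by both directions. The closures \<open>S P\<close> are arbitrary choices.
  An empty \<open>I\<close> is allowed; \<open>Inter_zero\<close> then makes \<open>R\<close>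
  trivial.\<close>

locale prime_family = R?: cring R for R :: "('a, 'm) ring_scheme" (structure) +
  fixes I :: "'a set set" and S :: "'a set \<Rightarrow> 'b ring" and \<phi> :: "'a set \<Rightarrow> 'a \<Rightarrow> 'b"
  assumes finite: "finite I" and prime: "P \<in> I \<Longrightarrow> primeideal P R"
    and Inter_zero: "r \<in> carrier R \<Longrightarrow> (\<And>P. P \<in> I \<Longrightarrow> r \<in> P) \<Longrightarrow> r = \<zero>"
    and antichain: "P \<in> I \<Longrightarrow> Q \<in> I \<Longrightarrow> P \<subseteq> Q \<Longrightarrow> P = Q"
    and hom: "P \<in> I \<Longrightarrow> ring_hom_cring R (S P) (\<phi> P)" and dom: "P \<in> I \<Longrightarrow> domain (S P)"
    and closed: "P \<in> I \<Longrightarrow> root_closed (S P)" and int: "P \<in> I \<Longrightarrow> integral_over R (S P) (\<phi> P)"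
    and ker: "P \<in> I \<Longrightarrow> r \<in> carrier R \<Longrightarrow> \<phi> P r = \<zero>\<^bsub>S P\<^esub> \<longleftrightarrow> r \<in> P"
begin

text \<open>Extensional functions are used so that equality can be tested on \<open>I\<close>
  alone.\<close>

definition W :: "('a set \<Rightarrow> 'b) ring"
  where "W = \<lparr>carrier = (\<Pi>\<^sub>E P\<in>I. carrier (S P)),
    monoid.mult = (\<lambda>x y. \<lambda>P\<in>I. x P \<otimes>\<^bsub>S P\<^esub> y P), one = (\<lambda>P\<in>I. \<one>\<^bsub>S P\<^esub>),
    zero = (\<lambda>P\<in>I. \<zero>\<^bsub>S P\<^esub>), add = (\<lambda>x y. \<lambda>P\<in>I. x P \<oplus>\<^bsub>S P\<^esub> y P)\<rparr>"

lemma S_cring: "P \<in> I \<Longrightarrow> cring (S P)"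
  using dom unfolding domain_def by blast

lemma S_ai_closed: "P \<in> I \<Longrightarrow> ai_closed (S P)"
  using root_closed_imp_ai_closed[OF S_cring closed] .

lemma W_simps [simp]:
  "carrier W = (\<Pi>\<^sub>E P\<in>I. carrier (S P))"
  "P \<in> I \<Longrightarrow> (x \<otimes>\<^bsub>W\<^esub> y) P = x P \<otimes>\<^bsub>S P\<^esub> y P"
  "P \<in> I \<Longrightarrow> (x \<oplus>\<^bsub>W\<^esub> y) P = x P \<oplus>\<^bsub>S P\<^esub> y P"
  "P \<in> I \<Longrightarrow> \<one>\<^bsub>W\<^esub> P = \<one>\<^bsub>S P\<^esub>"
  "P \<in> I \<Longrightarrow> \<zero>\<^bsub>W\<^esub> P = \<zero>\<^bsub>S P\<^esub>"
  by (simp_all add: W_def)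

lemma W_eqI: "x \<in> carrier W \<Longrightarrow> y \<in> carrier W \<Longrightarrow> (\<And>P. P \<in> I \<Longrightarrow> x P = y P) \<Longrightarrow> x = y"
  by (auto intro: PiE_ext)

lemma W_at: "x \<in> carrier W \<Longrightarrow> P \<in> I \<Longrightarrow> x P \<in> carrier (S P)"
  by auto

lemma W_cring: "cring W"
proof -
  have add: "x \<oplus>\<^bsub>W\<^esub> y \<in> carrier W" if "x \<in> carrier W" "y \<in> carrier W" for x y
    using W_at[OF that(1)] W_at[OF that(2)] cring.cring_simprules(1)[OF S_cring] unfolding W_def by auto
  have mult: "x \<otimes>\<^bsub>W\<^esub> y \<in> carrier W" if "x \<in> carrier W" "y \<in> carrier W" for x y
    using W_at[OF that(1)] W_at[OF that(2)] cring.cring_simprules(5)[OF S_cring] unfolding W_def by auto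
  have zero: "\<zero>\<^bsub>W\<^esub> \<in> carrier W" using cring.cring_simprules(2)[OF S_cring] unfolding W_def by auto
  have one: "\<one>\<^bsub>W\<^esub> \<in> carrier W" using cring.cring_simprules(6)[OF S_cring] unfolding W_def by auto
  show ?thesis
  proof (rule cringI)
    show "abelian_group W"
    proof (rule abelian_groupI)
      fix x y z assume x: "x \<in> carrier W" and y: "y \<in> carrier W" and z: "z \<in> carrier W"
      show "x \<oplus>\<^bsub>W\<^esub> y \<oplus>\<^bsub>W\<^esub> z = x \<oplus>\<^bsub>W\<^esub> (y \<oplus>\<^bsub>W\<^esub> z)"
        by (rule W_eqI[OF add[OF add[OF x y] z] add[OF x add[OF y z]]])
          (use x y z cring.cring_simprules(7)[OF S_cring] W_at in \<open>simp del: W_simps(1)\<close>)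
      show "x \<oplus>\<^bsub>W\<^esub> y = y \<oplus>\<^bsub>W\<^esub> x"
        by (rule W_eqI[OF add[OF x y] add[OF y x]])
          (use x y cring.cring_simprules(10)[OF S_cring] W_at in \<open>simp del: W_simps(1)\<close>)
      show "\<zero>\<^bsub>W\<^esub> \<oplus>\<^bsub>W\<^esub> x = x"
        by (rule W_eqI[OF add[OF zero x] x])
          (use x cring.cring_simprules(8)[OF S_cring] W_at in \<open>simp del: W_simps(1)\<close>)
      define y where "y = (\<lambda>P\<in>I. \<ominus>\<^bsub>S P\<^esub> x P)"
      have y: "y \<in> carrier W"
        using W_at[OF x] cring.cring_simprules(3)[OF S_cring] unfolding y_def by auto
      have "y \<oplus>\<^bsub>W\<^esub> x = \<zero>\<^bsub>W\<^esub>"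
        by (rule W_eqI[OF add[OF y x] zero])
          (use x cring.cring_simprules(9)[OF S_cring] W_at in \<open>simp add: y_def del: W_simps(1)\<close>)
      then show "\<exists>y\<in>carrier W. y \<oplus>\<^bsub>W\<^esub> x = \<zero>\<^bsub>W\<^esub>" using y by blast
    qed (fact add zero)+
    show "comm_monoid W"
    proof (rule comm_monoidI)
      fix x y z assume x: "x \<in> carrier W" and y: "y \<in> carrier W" and z: "z \<in> carrier W"
      show "x \<otimes>\<^bsub>W\<^esub> y \<otimes>\<^bsub>W\<^esub> z = x \<otimes>\<^bsub>W\<^esub> (y \<otimes>\<^bsub>W\<^esub> z)"
        by (rule W_eqI[OF mult[OF mult[OF x y] z] mult[OF x mult[OF y z]]])
          (use x y z cring.cring_simprules(11)[OF S_cring] W_at in \<open>simp del: W_simps(1)\<close>)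
      show "x \<otimes>\<^bsub>W\<^esub> y = y \<otimes>\<^bsub>W\<^esub> x"
        by (rule W_eqI[OF mult[OF x y] mult[OF y x]])
          (use x y cring.cring_simprules(14)[OF S_cring] W_at in \<open>simp del: W_simps(1)\<close>)
      show "\<one>\<^bsub>W\<^esub> \<otimes>\<^bsub>W\<^esub> x = x"
        by (rule W_eqI[OF mult[OF one x] x])
          (use x cring.cring_simprules(12)[OF S_cring] W_at in \<open>simp del: W_simps(1)\<close>)
    qed (fact mult one)+
    fix x y z assume x: "x \<in> carrier W" and y: "y \<in> carrier W" and z: "z \<in> carrier W"
    show "(x \<oplus>\<^bsub>W\<^esub> y) \<otimes>\<^bsub>W\<^esub> z = x \<otimes>\<^bsub>W\<^esub> z \<oplus>\<^bsub>W\<^esub> y \<otimes>\<^bsub>W\<^esub> z"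
      by (rule W_eqI[OF mult[OF add[OF x y] z] add[OF mult[OF x z] mult[OF y z]]])
        (use x y z cring.cring_simprules(13)[OF S_cring] W_at in \<open>simp del: W_simps(1)\<close>)
  qed
qed

interpretation W: cring W by (rule W_cring)

lemma proj_hom:
  assumes "subring T W" and P: "P \<in> I"
  shows "ring_hom_cring (W\<lparr>carrier := T\<rparr>) (S P) (\<lambda>x. x P)"
proof (rule UnivPoly.ring_hom_cringI[OF _ S_cring[OF P]])
  show "cring (W\<lparr>carrier := T\<rparr>)" using subring_incl_hom[OF W_cring assms(1)] by (simp add: ring_hom_cring_def)
  show "(\<lambda>x. x P) \<in> ring_hom (W\<lparr>carrier := T\<rparr>) (S P)"
    by (rule ring_hom_memI) (use subringE(1)[OF assms(1)] P W_at in \<open>auto simp del: W_simps(1)\<close>)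
qed

definition \<Phi> :: "'a \<Rightarrow> 'a set \<Rightarrow> 'b"
  where "\<Phi> r = (\<lambda>P\<in>I. \<phi> P r)"

lemma \<Phi>_at [simp]: "P \<in> I \<Longrightarrow> \<Phi> r P = \<phi> P r"
  by (simp add: \<Phi>_def)

lemma \<Phi>_hom: "ring_hom_cring R W \<Phi>"
proof (rule UnivPoly.ring_hom_cringI[OF R.is_cring W_cring], rule ring_hom_memI)
  have c: "\<Phi> r \<in> carrier W" if "r \<in> carrier R" for r
    using ring_hom_closed[OF ring_hom_cring.homh[OF hom] that] by (auto simp: \<Phi>_def)
  show "\<Phi> \<one> = \<one>\<^bsub>W\<^esub>"
    by (rule W_eqI[OF c W.one_closed]) (use ring_hom_one[OF ring_hom_cring.homh[OF hom]] in auto)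
  fix x y assume xy: "x \<in> carrier R" "y \<in> carrier R"
  show "\<Phi> x \<in> carrier W" by (rule c[OF xy(1)])
  show "\<Phi> (x \<otimes> y) = \<Phi> x \<otimes>\<^bsub>W\<^esub> \<Phi> y"
    by (rule W_eqI[OF c W.m_closed[OF c c]]) (use xy ring_hom_mult[OF ring_hom_cring.homh[OF hom]] in auto)
  show "\<Phi> (x \<oplus> y) = \<Phi> x \<oplus>\<^bsub>W\<^esub> \<Phi> y"
    by (rule W_eqI[OF c W.a_closed[OF c c]]) (use xy ring_hom_add[OF ring_hom_cring.homh[OF hom]] in auto)
qed

lemma \<Phi>_inj: "inj_on \<Phi> (carrier R)"
proof (rule inj_onI)
  fix r s assume rs: "r \<in> carrier R" "s \<in> carrier R" and e: "\<Phi> r = \<Phi> s"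
  have "r \<ominus> s = \<zero>"
  proof (rule Inter_zero)
    fix P assume P: "P \<in> I"
    interpret f: ring_hom_cring R "S P" "\<phi> P" by (rule hom[OF P])
    have "\<phi> P r = \<phi> P s" using fun_cong[OF e, of P] P by simp
    then have "\<phi> P (r \<ominus> s) = \<zero>\<^bsub>S P\<^esub>"
      using rs f.hom_closed[OF rs(2)] by (simp add: a_minus_def f.S.r_neg)
    then show "r \<ominus> s \<in> P" using ker[OF P R.minus_closed[OF rs]] by blast
  qed (use rs in simp)
  then show "r = s" using minus_eq_zero_iff[OF rs] by blast
qed

text \<open>By the antichain property every other member has an element outside \<open>P\<close>;
  the product of these stays outside \<open>P\<close> because \<open>P\<close> is prime.\<close>

lemma separating_element:
  assumes P: "P \<in> I"
  obtains x where "x \<in> carrier R" and "x \<notin> P" and "\<And>Q. Q \<in> I \<Longrightarrow> Q \<noteq> P \<Longrightarrow> x \<in> Q"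
proof -
  interpret P: primeideal P R by (rule prime[OF P])
  have "\<exists>x\<in>carrier R. x \<notin> P \<and> (\<forall>Q\<in>F. x \<in> Q)" if "finite F" "F \<subseteq> I - {P}" for F
    using that
  proof (induct F)
    case empty
    have "\<one> \<notin> P" using P.one_imp_carrier P.I_notcarr by blast
    then show ?case by blast
  next
    case (insert Q F)
    then obtain x where x: "x \<in> carrier R" "x \<notin> P" "\<forall>Q\<in>F. x \<in> Q" by auto
    have Q: "Q \<in> I" "Q \<noteq> P" using insert by auto
    then obtain y where y: "y \<in> Q" "y \<notin> P" using antichain[OF Q(1) P] by blast
    interpret Q: primeideal Q R by (rule prime[OF Q(1)])
    have yc: "y \<in> carrier R" by (rule Q.Icarr[OF y(1)])
    have "x \<otimes> y \<notin> P" using P.I_prime[OF x(1) yc] x(2) y(2) by blast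
    moreover have "x \<otimes> y \<in> Q'" if Q': "Q' \<in> insert Q F" for Q'
    proof (cases "Q' = Q")
      case True
      then show ?thesis using Q.I_l_closed[OF y(1) x(1)] by simp
    next
      case False
      then have "Q' \<in> I" "x \<in> Q'" using Q' insert x by auto
      then interpret Q': primeideal Q' R using prime by blast
      show ?thesis by (rule Q'.I_r_closed[OF \<open>x \<in> Q'\<close> yc])
    qed
    ultimately show ?case using x(1) yc m_closed by blast
  qed
  from this[of "I - {P}"] show thesis using finite that by blast
qed

section \<open>Rings between the image of \<open>R\<close> and the product\<close>

context
  fixes T
  assumes T: "subring T W" and \<Phi>T: "\<Phi> ` carrier R \<subseteq> T"
begin

abbreviation "WT \<equiv> W\<lparr>carrier := T\<rparr>"

interpretation T: cring WT
  using subring_incl_hom[OF W_cring T] by (simp add: ring_hom_cring_def)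

lemma sub_hom: "ring_hom_cring R WT \<Phi>"
  by (rule UnivPoly.ring_hom_cringI[OF R.is_cring T.is_cring])
    (use \<Phi>T ring_hom_cring.homh[OF \<Phi>_hom] in \<open>auto simp: ring_hom_def\<close>)

lemma eval_at:
  assumes "s \<in> T" and "p \<in> carrier (UP R)" and P: "P \<in> I"
  shows "upeval R WT \<Phi> s p P = upeval R (S P) (\<phi> P) (s P) p"
proof -
  have s: "s \<in> carrier WT" using assms(1) by simp
  have sP: "s P \<in> carrier (S P)" using subringE(1)[OF T] assms(1) W_at[OF _ P] by blast
  have "upeval R WT \<Phi> s p P = upeval R (S P) ((\<lambda>x. x P) \<circ> \<Phi>) (s P) p"
    by (rule hom_eval[OF sub_hom proj_hom[OF T P] assms(2) s])
  also have "\<dots> = upeval R (S P) (\<phi> P) (s P) p"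
    by (rule eval_cong[OF ring_hom_cring_trans[OF sub_hom proj_hom[OF T P]] hom[OF P] _ assms(2) sP])
      (use P in simp)
  finally show ?thesis .
qed

text \<open>The product of monic equations for the finitely many components vanishes in every
  component.\<close>

lemma sub_integral: "integral_over R WT \<Phi>"
  unfolding integral_over_def
proof
  fix s assume s: "s \<in> carrier WT"
  have sW: "s \<in> carrier W" using s subringE(1)[OF T] by auto
  interpret U: UP_cring R "UP R" by unfold_locales simp
  have "\<forall>P\<in>I. \<exists>p. monic_poly R p \<and> upeval R (S P) (\<phi> P) (s P) p = \<zero>\<^bsub>S P\<^esub>"
    using int W_at[OF sW] unfolding integral_over_def by blast
  then obtain p where p: "\<And>P. P \<in> I \<Longrightarrow> monic_poly R (p P)"
    "\<And>P. P \<in> I \<Longrightarrow> upeval R (S P) (\<phi> P) (s P) (p P) = \<zero>\<^bsub>S P\<^esub>" by metis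
  let ?q = "\<Otimes>\<^bsub>UP R\<^esub>P\<in>I. p P"
  have m: "monic_poly R ?q" by (rule monic_finprod[OF R.is_cring finite p(1)])
  have pc: "p \<in> I \<rightarrow> carrier (UP R)" using monic_polyD(1)[OF p(1)] by blast
  have "upeval R WT \<Phi> s ?q = \<zero>\<^bsub>WT\<^esub>"
  proof -
    have "upeval R WT \<Phi> s ?q \<in> carrier WT" by (rule eval_closed[OF sub_hom s monic_polyD(1)[OF m]])
    then have c: "upeval R WT \<Phi> s ?q \<in> carrier W" using subringE(1)[OF T] by auto
    have "upeval R WT \<Phi> s ?q = \<zero>\<^bsub>W\<^esub>"
    proof (rule W_eqI[OF c W.zero_closed])
      fix P assume P: "P \<in> I"
      interpret D: "domain" "S P" by (rule dom[OF P])
      interpret e: ring_hom_cring "UP R" "S P" "upeval R (S P) (\<phi> P) (s P)"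
        by (rule eval_hom[OF hom[OF P] W_at[OF sW P]])
      have "upeval R (S P) (\<phi> P) (s P) ?q = (\<Otimes>\<^bsub>S P\<^esub>Q\<in>I. upeval R (S P) (\<phi> P) (s P) (p Q))"
        by (rule e.hom_finprod'[OF pc])
      also have "\<dots> = \<zero>\<^bsub>S P\<^esub>"
        using D.finprod_zero_iff[OF finite, of "\<lambda>Q. upeval R (S P) (\<phi> P) (s P) (p Q)"] pc P p(2)[OF P] by auto
      finally show "upeval R WT \<Phi> s ?q P = \<zero>\<^bsub>W\<^esub> P"
        using eval_at[OF _ monic_polyD(1)[OF m] P, of s] s P by simp
    qed
    then show ?thesis by simp
  qed
  then show "\<exists>p. monic_poly R p \<and> upeval R WT \<Phi> s p = \<zero>\<^bsub>WT\<^esub>" using m by blast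
qed

lemma sub_tight: "tight_extension R WT \<Phi>"
  unfolding tight_extension_def ring_extension_def
proof (intro conjI allI impI)
  interpret F: ring_hom_cring R WT \<Phi> by (rule sub_hom)
  fix J assume J: "ideal J WT" "J \<noteq> {\<zero>\<^bsub>WT\<^esub>}"
  interpret J: ideal J WT by fact
  obtain s where s: "s \<in> J" "s \<noteq> \<zero>\<^bsub>WT\<^esub>" using J(2) J.zero_closed by blast
  have sT: "s \<in> carrier WT" by (rule J.Icarr[OF s(1)])
  have sW: "s \<in> carrier W" using sT subringE(1)[OF T] by auto
  obtain P where P: "P \<in> I" "s P \<noteq> \<zero>\<^bsub>S P\<^esub>" using W_eqI[OF sW W.zero_closed] s(2) by auto
  interpret D: "domain" "S P" by (rule dom[OF P(1)])
  interpret f: ring_hom_cring R "S P" "\<phi> P" by (rule hom[OF P(1)])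
  note sP = W_at[OF sW P(1)]
  obtain p where p: "monic_poly R p" "upeval R (S P) (\<phi> P) (s P) p = \<zero>\<^bsub>S P\<^esub>"
    using int[OF P(1)] sP unfolding integral_over_def by blast
  have "\<phi> P (p (deg R p)) \<noteq> \<zero>\<^bsub>S P\<^esub>" using monic_polyD[OF p(1)] by simp
  then obtain r q where r: "r \<in> carrier R" "q \<in> carrier (UP R)" "\<phi> P r \<noteq> \<zero>\<^bsub>S P\<^esub>"
    "\<phi> P r \<oplus>\<^bsub>S P\<^esub> s P \<otimes>\<^bsub>S P\<^esub> upeval R (S P) (\<phi> P) (s P) q = \<zero>\<^bsub>S P\<^esub>"
    using integral_const_term[OF hom[OF P(1)] dom[OF P(1)] sP P(2) monic_polyD(1)[OF p(1)] _ p(2)] by metis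
  \<comment> \<open>The cofactor is a polynomial in \<open>s\<close> over \<open>R\<close>, so it
    lies in \<open>T\<close> and not merely in \<open>W\<close>; this keeps the product in
    \<open>J\<close>.\<close>
  let ?u = "upeval R WT \<Phi> s q"
  have u: "?u \<in> carrier WT" by (rule eval_closed[OF sub_hom sT r(2)])
  have uP: "?u P = upeval R (S P) (\<phi> P) (s P) q" using eval_at[OF _ r(2) P(1)] sT by simp
  have uPc: "?u P \<in> carrier (S P)" unfolding uP by (rule eval_closed[OF hom[OF P(1)] sP r(2)])
  obtain x where x: "x \<in> carrier R" "x \<notin> P" "\<And>Q. Q \<in> I \<Longrightarrow> Q \<noteq> P \<Longrightarrow> x \<in> Q"
    by (rule separating_element[OF P(1)]) (rule that)
  have sJ: "s \<otimes>\<^bsub>WT\<^esub> ?u \<in> J" by (rule J.I_r_closed[OF s(1) u])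
  define z where "z = \<Phi> x \<otimes>\<^bsub>WT\<^esub> (s \<otimes>\<^bsub>WT\<^esub> ?u)"
  have zJ: "z \<in> J" unfolding z_def by (rule J.I_l_closed[OF sJ F.hom_closed[OF x(1)]])
  have "\<phi> P r \<oplus>\<^bsub>S P\<^esub> s P \<otimes>\<^bsub>S P\<^esub> ?u P = \<zero>\<^bsub>S P\<^esub>" using r(4) unfolding uP .
  then have su: "s P \<otimes>\<^bsub>S P\<^esub> ?u P = \<ominus>\<^bsub>S P\<^esub> \<phi> P r"
    using D.minus_equality[of "s P \<otimes>\<^bsub>S P\<^esub> ?u P" "\<phi> P r"] D.m_closed[OF sP uPc] f.hom_closed[OF r(1)]
    by (simp add: D.a_comm)
  have c: "\<ominus> (x \<otimes> r) \<in> carrier R" using x r by simp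
  have zW: "z \<in> carrier W" using J.Icarr[OF zJ] subringE(1)[OF T] by auto
  have cW: "\<Phi> (\<ominus> (x \<otimes> r)) \<in> carrier W" using ring_hom_closed[OF ring_hom_cring.homh[OF \<Phi>_hom] c] .
  \<comment> \<open>At \<open>P\<close> both sides are \<open>-\<phi> P (x r)\<close> by the choice
    of \<open>r\<close>; at the other members \<open>x\<close> makes both sides vanish.\<close>
  have z: "z = \<Phi> (\<ominus> (x \<otimes> r))"
  proof (rule W_eqI[OF zW cW])
    fix Q assume Q: "Q \<in> I"
    interpret g: ring_hom_cring R "S Q" "\<phi> Q" by (rule hom[OF Q])
    have eq: "z Q = \<phi> Q x \<otimes>\<^bsub>S Q\<^esub> (s Q \<otimes>\<^bsub>S Q\<^esub> ?u Q)" using Q by (simp add: z_def)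
    show "z Q = \<Phi> (\<ominus> (x \<otimes> r)) Q"
    proof (cases "Q = P")
      case True
      have "\<phi> P (\<ominus> (x \<otimes> r)) = \<ominus>\<^bsub>S P\<^esub> (\<phi> P x \<otimes>\<^bsub>S P\<^esub> \<phi> P r)" using x(1) r(1) by simp
      then show ?thesis using eq f.hom_closed[OF x(1)] f.hom_closed[OF r(1)]
        unfolding True su \<Phi>_at[OF P(1)] by (simp add: D.r_minus)
    next
      case False
      have x0: "\<phi> Q x = \<zero>\<^bsub>S Q\<^esub>" using ker[OF Q x(1)] x(3)[OF Q False] by blast
      have "s Q \<otimes>\<^bsub>S Q\<^esub> ?u Q \<in> carrier (S Q)"
        using W_at[OF sW Q] W_at[OF _ Q, of ?u] u subringE(1)[OF T] by (intro g.S.m_closed) auto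
      then have "z Q = \<zero>\<^bsub>S Q\<^esub>" unfolding eq x0 by simp
      moreover have "\<phi> Q (\<ominus> (x \<otimes> r)) = \<zero>\<^bsub>S Q\<^esub>" using x(1) r(1) x0 by simp
      ultimately show ?thesis using Q by simp
    qed
  qed
  have "\<phi> P x \<noteq> \<zero>\<^bsub>S P\<^esub>" using ker[OF P(1) x(1)] x(2) by blast
  then have "\<phi> P (x \<otimes> r) \<noteq> \<zero>\<^bsub>S P\<^esub>"
    using r(1,3) x(1) D.integral[of "\<phi> P x" "\<phi> P r"] by auto
  then have "\<phi> P (\<ominus> (x \<otimes> r)) \<noteq> \<zero>\<^bsub>S P\<^esub>"
    using f.hom_closed[of "x \<otimes> r"] x(1) r(1) by (metis D.minus_minus D.minus_zero f.hom_a_inv m_closed)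
  then have "z P \<noteq> \<zero>\<^bsub>S P\<^esub>" unfolding z using P by simp
  then have "z \<noteq> \<zero>\<^bsub>WT\<^esub>" using P by auto
  moreover have "z \<in> J \<inter> \<Phi> ` carrier R" using zJ z c by blast
  ultimately show "J \<inter> \<Phi> ` carrier R \<noteq> {\<zero>\<^bsub>WT\<^esub>}" by blast
qed (fact sub_hom \<Phi>_inj)+

text \<open>A root in the product is assembled from roots in the factors; membership in \<open>T\<close> is left to
  the choice of these roots.\<close>

lemma root_of_roots:
  assumes p: "p \<in> carrier (UP WT)" and a: "a \<in> T"
    and "\<And>P. P \<in> I \<Longrightarrow> upeval WT (S P) (\<lambda>x. x P) (a P) p = \<zero>\<^bsub>S P\<^esub>"
  shows "upeval WT WT id a p = \<zero>\<^bsub>WT\<^esub>"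
proof -
  have idT: "ring_hom_cring WT WT id" by unfold_locales (simp add: ring_hom_def)
  have aT: "a \<in> carrier WT" using a by simp
  have "upeval WT WT id a p \<in> carrier WT" by (rule eval_closed[OF idT aT p])
  then have c: "upeval WT WT id a p \<in> carrier W" using subringE(1)[OF T] by auto
  have "upeval WT WT id a p = \<zero>\<^bsub>W\<^esub>"
  proof (rule W_eqI[OF c W.zero_closed])
    fix P assume P: "P \<in> I"
    show "upeval WT WT id a p P = \<zero>\<^bsub>W\<^esub> P"
      using hom_eval[OF idT proj_hom[OF T P] p aT] assms(3)[OF P] P by simp
  qed
  then show ?thesis by simp
qed

lemma factor_root:
  assumes p: "monic_poly WT p" "deg WT p > 0" and P: "P \<in> I"
  obtains a where "a \<in> carrier (S P)" and "upeval WT (S P) (\<lambda>x. x P) a p = \<zero>\<^bsub>S P\<^esub>"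
proof -
  interpret D: "domain" "S P" by (rule dom[OF P])
  have idS: "ring_hom_cring (S P) (S P) id" by unfold_locales (simp add: ring_hom_def)
  note m = monic_upmap[OF proj_hom[OF T P] D.one_not_zero p(1)]
  obtain a where "a \<in> carrier (S P)" "upeval (S P) (S P) id a (upmap (\<lambda>x. x P) p) = \<zero>\<^bsub>S P\<^esub>"
    using closed[OF P] m p(2) unfolding root_closed_def by metis
  then show thesis
    using that eval_upmap[OF proj_hom[OF T P] idS monic_polyD(1)[OF p(1)]] by (simp add: comp_def)
qed

end

lemma W_root_closed: "root_closed W"
proof -
  note cT = W.carrier_is_subring
  have \<Phi>W: "\<Phi> ` carrier R \<subseteq> carrier W" using ring_hom_closed[OF ring_hom_cring.homh[OF \<Phi>_hom]] by blast
  have WW: "W\<lparr>carrier := carrier W\<rparr> = W" by simp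
  show ?thesis unfolding root_closed_def
  proof (intro allI impI)
    fix p assume p: "monic_poly W p" "deg W p > 0"
    have "\<forall>P\<in>I. \<exists>a\<in>carrier (S P). upeval W (S P) (\<lambda>x. x P) a p = \<zero>\<^bsub>S P\<^esub>"
      using factor_root[OF cT \<Phi>W, unfolded WW, OF p] by blast
    then obtain a where a: "\<And>P. P \<in> I \<Longrightarrow> a P \<in> carrier (S P)"
      "\<And>P. P \<in> I \<Longrightarrow> upeval W (S P) (\<lambda>x. x P) (a P) p = \<zero>\<^bsub>S P\<^esub>" by metis
    define b where "b = restrict a I"
    have b: "b \<in> carrier W" unfolding b_def using a(1) by auto
    have "upeval W W id b p = \<zero>\<^bsub>W\<^esub>"
      by (rule root_of_roots[OF cT \<Phi>W, unfolded WW, OF monic_polyD(1)[OF p(1)] b]) (simp add: b_def a)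
    then show "\<exists>a\<in>carrier W. upeval W W id a p = \<zero>\<^bsub>W\<^esub>" using b by blast
  qed
qed

end

section \<open>Comaximality and uniqueness\<close>

text \<open>The sum of the \<open>e i \<otimes> x i\<close> works, since \<open>e i\<close> is one
  modulo \<open>J i\<close> and zero modulo the others. The \<open>e i\<close> themselves need only
  be idempotent modulo the ideals.\<close>

lemma (in cring) chinese_remainder_idempotents:
  assumes I: "finite I" and J: "\<And>i. i \<in> I \<Longrightarrow> ideal (J i) R"
    and e: "\<And>i. i \<in> I \<Longrightarrow> e i \<in> carrier R" "\<And>i. i \<in> I \<Longrightarrow> \<one> \<ominus> e i \<in> J i"
      "\<And>i j. i \<in> I \<Longrightarrow> j \<in> I \<Longrightarrow> i \<noteq> j \<Longrightarrow> e i \<in> J j"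
    and x: "\<And>i. i \<in> I \<Longrightarrow> x i \<in> carrier R"
  obtains y where "y \<in> carrier R" and "\<And>i. i \<in> I \<Longrightarrow> y \<ominus> x i \<in> J i"
proof -
  define y where "y = (\<Oplus>i\<in>I. e i \<otimes> x i)"
  have c: "(\<lambda>i. e i \<otimes> x i) \<in> I \<rightarrow> carrier R" using e(1) x by auto
  have "y \<ominus> x i \<in> J i" if i: "i \<in> I" for i
  proof -
    interpret Ji: ideal "J i" R by (rule J[OF i])
    let ?z = "\<Oplus>j\<in>I - {i}. e j \<otimes> x j"
    have z: "?z \<in> J i"
      by (rule Ji.finsum_mem) (use e(3)[OF _ i] x Ji.I_r_closed in auto)
    have "I = insert i (I - {i})" using i by blast
    then have "y = (\<Oplus>j\<in>insert i (I - {i}). e j \<otimes> x j)" unfolding y_def by simp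
    also have "\<dots> = e i \<otimes> x i \<oplus> ?z"
      by (rule finsum_insert) (use I c i in auto)
    finally have "y \<ominus> x i = ?z \<oplus> \<ominus> ((\<one> \<ominus> e i) \<otimes> x i)"
      using Ji.Icarr[OF z] e(1)[OF i] x[OF i] by (simp add: minus_eq l_distr l_minus minus_add a_ac)
    moreover have "(\<one> \<ominus> e i) \<otimes> x i \<in> J i" by (rule Ji.I_r_closed[OF e(2)[OF i] x[OF i]])
    ultimately show ?thesis using z Ji.a_closed Ji.a_inv_closed by simp
  qed
  moreover have "y \<in> carrier R" unfolding y_def using c by (rule finsum_closed)
  ultimately show thesis using that by blast
qed

text \<open>Pairwise comaximality expressed by elements, since elements can be carried along ring
  homomorphisms and plugged into the Chinese remainder theorem.\<close>

definition comaximal :: "('a, 'm) ring_scheme \<Rightarrow> 'a set set \<Rightarrow> bool"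
  where "comaximal R I \<longleftrightarrow>
    (\<forall>P\<in>I. \<exists>e\<in>carrier R. \<one>\<^bsub>R\<^esub> \<ominus>\<^bsub>R\<^esub> e \<in> P \<and> (\<forall>Q\<in>I. Q \<noteq> P \<longrightarrow> e \<in> Q))"

text \<open>If \<open>P\<close> were properly contained in \<open>Q\<close>, then \<open>Q\<close>
  would contain both \<open>e\<close> and \<open>1 - e\<close>.\<close>

lemma comaximal_antichain:
  assumes "comaximal R I" and prime: "\<And>P. P \<in> I \<Longrightarrow> primeideal P R" and PQ: "P \<in> I" "Q \<in> I" "P \<subseteq> Q"
  shows "P = Q"
proof (rule ccontr)
  assume "P \<noteq> Q"
  then obtain e where e: "e \<in> carrier R" "\<one>\<^bsub>R\<^esub> \<ominus>\<^bsub>R\<^esub> e \<in> P" "e \<in> Q"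
    using assms(1) PQ unfolding comaximal_def by metis
  interpret R: cring R by (rule primeideal.axioms(2)[OF prime[OF PQ(2)]])
  interpret Q: primeideal Q R by (rule prime[OF PQ(2)])
  have "(\<one>\<^bsub>R\<^esub> \<ominus>\<^bsub>R\<^esub> e) \<oplus>\<^bsub>R\<^esub> e \<in> Q" using e PQ(3) by (intro Q.a_closed) auto
  moreover have "(\<one>\<^bsub>R\<^esub> \<ominus>\<^bsub>R\<^esub> e) \<oplus>\<^bsub>R\<^esub> e = \<one>\<^bsub>R\<^esub>" using e(1) by (simp add: R.minus_eq R.a_assoc R.l_neg)
  ultimately show False using Q.one_imp_carrier Q.I_notcarr by simp
qed

text \<open>The witness is a product over the other primes: writing \<open>1 = a + b\<close> with
  \<open>a\<close> in \<open>P\<close> and \<open>b\<close> in \<open>Q\<close> supplies the factor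
  \<open>b\<close>.\<close>

lemma comaximal_if_pairwise:
  assumes "cring R" and fin: "finite I" and prime: "\<And>P. P \<in> I \<Longrightarrow> primeideal P R"
    and pw: "\<And>P Q. P \<in> I \<Longrightarrow> Q \<in> I \<Longrightarrow> P \<noteq> Q \<Longrightarrow> \<one>\<^bsub>R\<^esub> \<in> P <+>\<^bsub>R\<^esub> Q"
  shows "comaximal R I"
  unfolding comaximal_def
proof
  interpret cring R by fact
  fix P assume P: "P \<in> I"
  interpret P: primeideal P R by (rule prime[OF P])
  have "\<exists>e\<in>carrier R. \<one>\<^bsub>R\<^esub> \<ominus>\<^bsub>R\<^esub> e \<in> P \<and> (\<forall>Q\<in>F. e \<in> Q)" if "finite F" "F \<subseteq> I - {P}" for F
    using that
  proof (induct F)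
    case empty
    then show ?case by (intro bexI[of _ "\<one>\<^bsub>R\<^esub>"]) (simp_all add: minus_eq r_neg)
  next
    case (insert Q F)
    then obtain e where e: "e \<in> carrier R" "\<one>\<^bsub>R\<^esub> \<ominus>\<^bsub>R\<^esub> e \<in> P" "\<forall>Q\<in>F. e \<in> Q" by auto
    have Q: "Q \<in> I" "P \<noteq> Q" using insert by auto
    interpret Q: primeideal Q R by (rule prime[OF Q(1)])
    obtain a b where ab: "a \<in> P" "b \<in> Q" "\<one>\<^bsub>R\<^esub> = a \<oplus>\<^bsub>R\<^esub> b" using pw[OF P Q] unfolding set_add_def' by blast
    have c: "a \<in> carrier R" "b \<in> carrier R" using P.Icarr Q.Icarr ab by auto
    \<comment> \<open>Replacing \<open>e\<close> by \<open>e b\<close> changes \<open>1 - e\<close>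
      only by \<open>e a\<close>, which lies in \<open>P\<close>.\<close>
    have "\<one>\<^bsub>R\<^esub> \<ominus>\<^bsub>R\<^esub> e \<otimes>\<^bsub>R\<^esub> b = (\<one>\<^bsub>R\<^esub> \<ominus>\<^bsub>R\<^esub> e) \<oplus>\<^bsub>R\<^esub> e \<otimes>\<^bsub>R\<^esub> a"
    proof -
      have "e = e \<otimes>\<^bsub>R\<^esub> (a \<oplus>\<^bsub>R\<^esub> b)" using e(1) by (simp flip: ab(3))
      also have "\<dots> = e \<otimes>\<^bsub>R\<^esub> a \<oplus>\<^bsub>R\<^esub> e \<otimes>\<^bsub>R\<^esub> b" using e(1) c by (simp add: r_distr)
      finally have e': "e = e \<otimes>\<^bsub>R\<^esub> a \<oplus>\<^bsub>R\<^esub> e \<otimes>\<^bsub>R\<^esub> b" .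
      have "(\<one>\<^bsub>R\<^esub> \<ominus>\<^bsub>R\<^esub> (e \<otimes>\<^bsub>R\<^esub> a \<oplus>\<^bsub>R\<^esub> e \<otimes>\<^bsub>R\<^esub> b)) \<oplus>\<^bsub>R\<^esub> e \<otimes>\<^bsub>R\<^esub> a = \<one>\<^bsub>R\<^esub> \<ominus>\<^bsub>R\<^esub> e \<otimes>\<^bsub>R\<^esub> b"
        using e(1) c by algebra
      then show ?thesis using e' by simp
    qed
    also have "\<dots> \<in> P" using P.a_closed[OF e(2) P.I_l_closed[OF ab(1) e(1)]] .
    finally have 1: "\<one>\<^bsub>R\<^esub> \<ominus>\<^bsub>R\<^esub> e \<otimes>\<^bsub>R\<^esub> b \<in> P" .
    have 2: "e \<otimes>\<^bsub>R\<^esub> b \<in> Q'" if Q': "Q' \<in> insert Q F" for Q'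
    proof (cases "Q' = Q")
      case True
      then show ?thesis using Q.I_l_closed[OF ab(2) e(1)] by simp
    next
      case False
      then have "Q' \<in> I" "e \<in> Q'" using Q' insert e by auto
      then show ?thesis using ideal.I_r_closed[OF primeideal.axioms(1)[OF prime] _ c(2)] by blast
    qed
    show ?case using 1 2 e(1) c(2) m_closed by blast
  qed
  from this[of "I - {P}"] show "\<exists>e\<in>carrier R. \<one>\<^bsub>R\<^esub> \<ominus>\<^bsub>R\<^esub> e \<in> P \<and> (\<forall>Q\<in>I. Q \<noteq> P \<longrightarrow> e \<in> Q)"
    using fin by (metis DiffI finite_Diff order_refl singletonD)
qed

section \<open>The product as an absolute integral closure, uniqueness, and the glued ring\<close>

context prime_family
begin

interpretation W: cring W by (rule W_cring)

lemma \<Phi>_image: "\<Phi> ` carrier R \<subseteq> carrier W"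
  using ring_hom_closed[OF ring_hom_cring.homh[OF \<Phi>_hom]] by blast

text \<open>An enumeration of the finite set \<open>I\<close> embeds \<open>W\<close> into the lists
  over \<open>'b\<close>.\<close>

lemma W_lepoll:
  assumes inf: "infinite (UNIV :: 'b set)"
  shows "carrier W \<lesssim> (UNIV :: 'b set)"
proof -
  obtain l where l: "set l = I" using finite_list[OF finite] by blast
  have "inj_on (\<lambda>x. map x l) (carrier W)"
    by (rule inj_onI, rule W_eqI) (use l in auto)
  then have "carrier W \<lesssim> (UNIV :: 'b list set)" unfolding lepoll_def by blast
  also have "(UNIV :: 'b list set) \<lesssim> (UNIV :: 'b set)" by (rule lists_lepoll_infinite[OF inf])
  finally show ?thesis .
qed

text \<open>Intermediate rings consist of functions on \<open>I\<close>; those that are root closed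
  are copied into \<open>'b\<close> so that \<open>aic_exists_uniquely\<close> applies to
  them.\<close>

lemma exists_aic:
  assumes inf: "infinite (UNIV :: 'b set)" and T: "subring T W" "\<Phi> ` carrier R \<subseteq> T" "root_closed (W\<lparr>carrier := T\<rparr>)"
  obtains Z :: "'b ring" and h k where "ring_iso_pair (W\<lparr>carrier := T\<rparr>) Z h k" and "is_aic R Z (h \<circ> \<Phi>)"
proof -
  have c: "cring (W\<lparr>carrier := T\<rparr>)"
    using subring_incl_hom[OF W_cring T(1)] by (simp add: ring_hom_cring_def)
  have "carrier (W\<lparr>carrier := T\<rparr>) \<lesssim> carrier W" using subringE(1)[OF T(1)] by (simp add: subset_imp_lepoll del: W_simps(1))
  also note W_lepoll[OF inf]
  finally obtain Z :: "'b ring" and h k where i: "ring_iso_pair (W\<lparr>carrier := T\<rparr>) Z h k"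
    using transfer_ring[OF c] by blast
  show thesis by (rule that[OF i is_aic_iso[OF i T(3) sub_integral[OF T(1,2)] sub_tight[OF T(1,2)]]])
qed

lemma aic_iso_W:
  assumes com: "comaximal R I" and aic: "is_aic R Z \<psi>"
  obtains f where "f \<in> ring_iso Z W" and "\<And>r. r \<in> carrier R \<Longrightarrow> f (\<psi> r) = \<Phi> r"
proof -
  have ac: "ai_closed Z" and \<psi>: "ring_hom_cring R Z \<psi>" and inj: "inj_on \<psi> (carrier R)"
    and iz: "integral_over R Z \<psi>" and tight: "\<And>J. ideal J Z \<Longrightarrow> J \<noteq> {\<zero>\<^bsub>Z\<^esub>} \<Longrightarrow> J \<inter> \<psi> ` carrier R \<noteq> {\<zero>\<^bsub>Z\<^esub>}"
    using aic unfolding is_aic_def integral_extension_def tight_extension_def ring_extension_def integral_over_def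
    by blast+
  interpret \<psi>: ring_hom_cring R Z \<psi> by fact
  have ker0: "r = \<zero>" if "r \<in> carrier R" "\<psi> r = \<zero>\<^bsub>Z\<^esub>" for r
    using inj_onD[OF inj, of r \<zero>] that by simp
  have "\<exists>f. ring_hom_cring Z (S P) f \<and> (\<forall>r\<in>carrier R. f (\<psi> r) = \<phi> P r)" if P: "P \<in> I" for P
  proof -
    have "\<phi> P r = \<zero>\<^bsub>S P\<^esub>" if r: "r \<in> carrier R" "\<psi> r = \<zero>\<^bsub>Z\<^esub>" for r
      using ker0[OF r] ring_hom_zero[OF ring_hom_cring.homh[OF hom[OF P]] R.ring_axioms cring.axioms(1)[OF S_cring[OF P]]] by simp
    then show ?thesis
      using exists_hom_into_ai_closed[OF \<psi> hom[OF P] iz dom[OF P] S_ai_closed[OF P]] by metis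
  qed
  then obtain f where f: "\<And>P. P \<in> I \<Longrightarrow> ring_hom_cring Z (S P) (f P)"
    "\<And>P r. P \<in> I \<Longrightarrow> r \<in> carrier R \<Longrightarrow> f P (\<psi> r) = \<phi> P r" by metis
  define F where "F z = (\<lambda>P\<in>I. f P z)" for z
  note fh = ring_hom_cring.homh[OF f(1)]
  have Fc: "F z \<in> carrier W" if "z \<in> carrier Z" for z
    unfolding F_def using ring_hom_closed[OF fh that] by auto
  have "F \<in> ring_hom Z W"
  proof (rule ring_hom_memI)
    show "F \<one>\<^bsub>Z\<^esub> = \<one>\<^bsub>W\<^esub>"
      by (rule W_eqI[OF Fc W.one_closed]) (use ring_hom_one[OF fh] in \<open>auto simp: F_def\<close>)
    fix x y assume xy: "x \<in> carrier Z" "y \<in> carrier Z"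
    show "F x \<in> carrier W" by (rule Fc[OF xy(1)])
    show "F (x \<otimes>\<^bsub>Z\<^esub> y) = F x \<otimes>\<^bsub>W\<^esub> F y"
      by (rule W_eqI[OF Fc W.m_closed[OF Fc Fc]]) (use xy ring_hom_mult[OF fh] in \<open>auto simp: F_def\<close>)
    show "F (x \<oplus>\<^bsub>Z\<^esub> y) = F x \<oplus>\<^bsub>W\<^esub> F y"
      by (rule W_eqI[OF Fc W.a_closed[OF Fc Fc]]) (use xy ring_hom_add[OF fh] in \<open>auto simp: F_def\<close>)
  qed
  then have Fh: "ring_hom_cring Z W F" by (rule UnivPoly.ring_hom_cringI[OF \<psi>.S.is_cring W_cring])
  interpret F: ring_hom_cring Z W F by (rule Fh)
  have F\<psi>: "F (\<psi> r) = \<Phi> r" if r: "r \<in> carrier R" for r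
    unfolding F_def \<Phi>_def using f(2)[OF _ r] by auto
  \<comment> \<open>The composite of \<open>\<psi>\<close> and \<open>F\<close> is the injective
    \<open>\<Phi>\<close>, so the kernel meets the image of \<open>R\<close> only in zero and
    tightness applies.\<close>
  have "a_kernel Z W F = {\<zero>\<^bsub>Z\<^esub>}"
  proof (rule ccontr)
    assume k: "a_kernel Z W F \<noteq> {\<zero>\<^bsub>Z\<^esub>}"
    have "x = \<zero>\<^bsub>Z\<^esub>" if x: "x \<in> a_kernel Z W F \<inter> \<psi> ` carrier R" for x
    proof -
      obtain r where r: "r \<in> carrier R" "x = \<psi> r" "F x = \<zero>\<^bsub>W\<^esub>" using x unfolding a_kernel_def' by blast
      then have "\<Phi> r = \<Phi> \<zero>" using F\<psi>[OF r(1)] F\<psi>[OF R.zero_closed] F.hom_zero \<psi>.hom_zero by simp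
      then have "r = \<zero>" using inj_onD[OF \<Phi>_inj] r(1) R.zero_closed by blast
      then show ?thesis using r(2) by simp
    qed
    moreover have "\<zero>\<^bsub>Z\<^esub> \<in> a_kernel Z W F \<inter> \<psi> ` carrier R"
      using \<psi>.hom_zero R.zero_closed F.hom_zero unfolding a_kernel_def' by (auto intro: rev_image_eqI)
    ultimately have "a_kernel Z W F \<inter> \<psi> ` carrier R = {\<zero>\<^bsub>Z\<^esub>}" by blast
    then show False using tight[OF F.ring.kernel_is_ideal k] by blast
  qed
  then have inj: "inj_on F (carrier Z)" by (rule F.ring.trivial_ker_imp_inj)
  have "w \<in> F ` carrier Z" if w: "w \<in> carrier W" for w
  proof -
    \<comment> \<open>The component is a root of a monic polynomial over \<open>R\<close>, which
      splits already in \<open>Z\<close>; hence one of the roots there maps to it.\<close>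
    have "\<exists>s\<in>carrier Z. w P = f P s" if P: "P \<in> I" for P
    proof -
      interpret D: "domain" "S P" by (rule dom[OF P])
      interpret fP: ring_hom_cring Z "S P" "f P" by (rule f(1)[OF P])
      have nt: "\<one>\<^bsub>Z\<^esub> \<noteq> \<zero>\<^bsub>Z\<^esub>" using fP.hom_one fP.hom_zero D.one_not_zero by metis
      obtain p where p: "monic_poly R p" "upeval R (S P) (\<phi> P) (w P) p = \<zero>\<^bsub>S P\<^esub>"
        using int[OF P] W_at[OF w P] unfolding integral_over_def by blast
      have "upeval Z (S P) (f P) (w P) (upmap \<psi> p) = upeval R (S P) (f P \<circ> \<psi>) (w P) p"
        by (rule eval_upmap[OF \<psi> f(1)[OF P] monic_polyD(1)[OF p(1)] W_at[OF w P]])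
      also have "\<dots> = upeval R (S P) (\<phi> P) (w P) p"
        by (rule eval_cong[OF ring_hom_cring_trans[OF \<psi> f(1)[OF P]] hom[OF P] _ monic_polyD(1)[OF p(1)] W_at[OF w P]])
          (use f(2)[OF P] in simp)
      finally have "upeval Z (S P) (f P) (w P) (upmap \<psi> p) = \<zero>\<^bsub>S P\<^esub>" using p(2) by simp
      from root_lift[OF ac f(1)[OF P] dom[OF P] monic_upmap(1)[OF \<psi> nt p(1)] W_at[OF w P] this]
      show ?thesis by metis
    qed
    then obtain s where s: "\<And>P. P \<in> I \<Longrightarrow> s P \<in> carrier Z" "\<And>P. P \<in> I \<Longrightarrow> w P = f P (s P)" by metis
    obtain e where e: "\<And>P. P \<in> I \<Longrightarrow> e P \<in> carrier R" "\<And>P. P \<in> I \<Longrightarrow> \<one> \<ominus> e P \<in> P"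
      "\<And>P Q. P \<in> I \<Longrightarrow> Q \<in> I \<Longrightarrow> Q \<noteq> P \<Longrightarrow> e P \<in> Q"
      using com unfolding comaximal_def by metis
    \<comment> \<open>On the image of \<open>R\<close> the map \<open>f P\<close> acts as
      \<open>\<phi> P\<close>, so the elements \<open>e P\<close> separate the kernels of the maps
      \<open>f P\<close> and the preimages \<open>s P\<close> can be patched together.\<close>
    let ?J = "\<lambda>P. a_kernel Z (S P) (f P)"
    obtain y where y: "y \<in> carrier Z" "\<And>P. P \<in> I \<Longrightarrow> y \<ominus>\<^bsub>Z\<^esub> s P \<in> ?J P"
    proof (rule \<psi>.S.chinese_remainder_idempotents[OF finite, of ?J "\<lambda>P. \<psi> (e P)" s])
      fix P assume P: "P \<in> I"
      interpret fP: ring_hom_cring Z "S P" "f P" by (rule f(1)[OF P])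
      show "ideal (?J P) Z" by (rule fP.ring.kernel_is_ideal)
      show "\<psi> (e P) \<in> carrier Z" using e(1)[OF P] by simp
      show "s P \<in> carrier Z" by (rule s(1)[OF P])
      have m: "\<one> \<ominus> e P \<in> carrier R" using e(1)[OF P] by simp
      have "\<one>\<^bsub>Z\<^esub> \<ominus>\<^bsub>Z\<^esub> \<psi> (e P) = \<psi> (\<one> \<ominus> e P)" using e(1)[OF P] by (simp add: minus_eq \<psi>.S.minus_eq)
      moreover have "f P (\<psi> (\<one> \<ominus> e P)) = \<zero>\<^bsub>S P\<^esub>" using f(2)[OF P m] ker[OF P m] e(2)[OF P] by simp
      ultimately show "\<one>\<^bsub>Z\<^esub> \<ominus>\<^bsub>Z\<^esub> \<psi> (e P) \<in> ?J P" using \<psi>.hom_closed[OF m] unfolding a_kernel_def' by simp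
      fix Q assume Q: "Q \<in> I" "P \<noteq> Q"
      have "f Q (\<psi> (e P)) = \<zero>\<^bsub>S Q\<^esub>"
        using f(2)[OF Q(1) e(1)[OF P]] ker[OF Q(1) e(1)[OF P]] e(3)[OF P Q(1)] Q(2) by simp
      then show "\<psi> (e P) \<in> ?J Q" using e(1)[OF P] unfolding a_kernel_def' by simp
    qed blast
    have "F y = w"
    proof (rule W_eqI[OF Fc[OF y(1)] w])
      fix P assume P: "P \<in> I"
      interpret fP: ring_hom_cring Z "S P" "f P" by (rule f(1)[OF P])
      have "f P (y \<ominus>\<^bsub>Z\<^esub> s P) = \<zero>\<^bsub>S P\<^esub>" using y(2)[OF P] unfolding a_kernel_def' by blast
      then have "f P y \<ominus>\<^bsub>S P\<^esub> f P (s P) = \<zero>\<^bsub>S P\<^esub>" using y(1) s(1)[OF P] by (simp add: \<psi>.S.minus_eq fP.S.minus_eq)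
      then have "f P y = f P (s P)"
        using fP.S.minus_eq_zero_iff[OF fP.hom_closed[OF y(1)] fP.hom_closed[OF s(1)[OF P]]] by blast
      then show "F y P = w P" using s(2)[OF P] P by (simp add: F_def)
    qed
    then show ?thesis using y(1) by blast
  qed
  then have "F ` carrier Z = carrier W" using Fc by blast
  then have "F \<in> ring_iso Z W" unfolding ring_iso_def bij_betw_def using F.homh inj by blast
  then show thesis using that F\<psi> by blast
qed

lemma unique_if_comaximal:
  assumes inf: "infinite (UNIV :: 'b set)" and com: "comaximal R I"
  shows "aic_exists_uniquely TYPE('b) R"
  unfolding aic_exists_uniquely_def
proof (intro conjI allI impI)
  have WW: "W\<lparr>carrier := carrier W\<rparr> = W" by simp
  obtain Z :: "'b ring" and h k where "is_aic R Z (h \<circ> \<Phi>)"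
    using exists_aic[OF inf W.carrier_is_subring \<Phi>_image, unfolded WW, OF W_root_closed] by blast
  then show "\<exists>(Z :: 'b ring) \<psi>. is_aic R Z \<psi>" by blast
  fix Y Z :: "'b ring" and \<psi> \<chi>
  assume Y: "is_aic R Y \<psi>" and Z: "is_aic R Z \<chi>"
  obtain f where f: "f \<in> ring_iso Y W" "\<And>r. r \<in> carrier R \<Longrightarrow> f (\<psi> r) = \<Phi> r" using aic_iso_W[OF com Y] by blast
  obtain g where g: "g \<in> ring_iso Z W" "\<And>r. r \<in> carrier R \<Longrightarrow> g (\<chi> r) = \<Phi> r" using aic_iso_W[OF com Z] by blast
  have \<chi>: "ring_hom_cring R Z \<chi>"
    using Z unfolding is_aic_def integral_extension_def ring_extension_def by blast
  interpret \<chi>: ring_hom_cring R Z \<chi> by fact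
  let ?g = "inv_into (carrier Z) g"
  have "?g \<circ> f \<in> ring_iso Y Z"
    by (rule ring_iso_set_trans[OF f(1) ring_iso_set_sym[OF \<chi>.S.ring_axioms g(1)]])
  moreover have "(?g \<circ> f) (\<psi> r) = \<chi> r" if r: "r \<in> carrier R" for r
  proof -
    have "inj_on g (carrier Z)" using g(1) unfolding ring_iso_def bij_betw_def by blast
    then show ?thesis using f(2)[OF r] g(2)[OF r] inv_into_f_f[of g "carrier Z" "\<chi> r"] \<chi>.hom_closed[OF r] by simp
  qed
  ultimately show "algebra_isomorphic R Y \<psi> Z \<chi>" unfolding algebra_isomorphic_def by blast
qed

text \<open>The fibre product of the factors at \<open>P1\<close> and \<open>P2\<close> over the
  common target of \<open>\<theta>1\<close> and \<open>\<theta>2\<close>, times the remaining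
  factors.\<close>

definition glued_along :: "'a set \<Rightarrow> 'a set \<Rightarrow> ('b \<Rightarrow> 'c) \<Rightarrow> ('b \<Rightarrow> 'c) \<Rightarrow> ('a set \<Rightarrow> 'b) set"
  where "glued_along P1 P2 \<theta>1 \<theta>2 = {s \<in> carrier W. \<theta>1 (s P1) = \<theta>2 (s P2)}"

context
  fixes P1 P2 :: "'a set" and k :: "('c, 'n) ring_scheme" and \<theta>1 \<theta>2 :: "'b \<Rightarrow> 'c"
  assumes P1: "P1 \<in> I" and P2: "P2 \<in> I" and P12: "P1 \<noteq> P2" and k: "domain k"
    and \<theta>1: "ring_hom_cring (S P1) k \<theta>1" and \<theta>2: "ring_hom_cring (S P2) k \<theta>2"
    and glue: "\<And>r. r \<in> carrier R \<Longrightarrow> \<theta>1 (\<phi> P1 r) = \<theta>2 (\<phi> P2 r)"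
begin

abbreviation "glued \<equiv> glued_along P1 P2 \<theta>1 \<theta>2"

interpretation t1: ring_hom_cring "S P1" k \<theta>1 by (rule \<theta>1)
interpretation t2: ring_hom_cring "S P2" k \<theta>2 by (rule \<theta>2)

lemma glued_subring: "subring glued W"
proof (rule W.subringI)
  show "glued \<subseteq> carrier W" unfolding glued_along_def by blast
  show "\<one>\<^bsub>W\<^esub> \<in> glued" unfolding glued_along_def using W.one_closed P1 P2 by simp
  fix s assume s: "s \<in> glued"
  then have sW: "s \<in> carrier W" and e: "\<theta>1 (s P1) = \<theta>2 (s P2)" unfolding glued_along_def by auto
  have at: "(\<ominus>\<^bsub>W\<^esub> s) P = \<ominus>\<^bsub>S P\<^esub> s P" if P: "P \<in> I" for P
  proof -
    have WW: "W\<lparr>carrier := carrier W\<rparr> = W" by simp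
    interpret p: ring_hom_cring W "S P" "\<lambda>x. x P"
      by (rule proj_hom[OF W.carrier_is_subring P, unfolded WW])
    show ?thesis using p.hom_a_inv[OF sW] .
  qed
  have "\<theta>1 ((\<ominus>\<^bsub>W\<^esub> s) P1) = \<theta>2 ((\<ominus>\<^bsub>W\<^esub> s) P2)"
    unfolding at[OF P1] at[OF P2] using t1.hom_a_inv[OF W_at[OF sW P1]] t2.hom_a_inv[OF W_at[OF sW P2]] e by simp
  then show "\<ominus>\<^bsub>W\<^esub> s \<in> glued" unfolding glued_along_def using W.a_inv_closed[OF sW] by blast
next
  fix s u assume s: "s \<in> glued" and u: "u \<in> glued"
  have sW: "s \<in> carrier W" and e: "\<theta>1 (s P1) = \<theta>2 (s P2)" using s unfolding glued_along_def by auto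
  have uW: "u \<in> carrier W" and e': "\<theta>1 (u P1) = \<theta>2 (u P2)" using u unfolding glued_along_def by auto
  show "s \<otimes>\<^bsub>W\<^esub> u \<in> glued" unfolding glued_along_def
    using W.m_closed[OF sW uW] P1 P2 e e' t1.hom_mult[OF W_at[OF sW P1] W_at[OF uW P1]]
      t2.hom_mult[OF W_at[OF sW P2] W_at[OF uW P2]] by (simp del: W_simps(1))
  show "s \<oplus>\<^bsub>W\<^esub> u \<in> glued" unfolding glued_along_def
    using W.a_closed[OF sW uW] P1 P2 e e' t1.hom_add[OF W_at[OF sW P1] W_at[OF uW P1]]
      t2.hom_add[OF W_at[OF sW P2] W_at[OF uW P2]] by (simp del: W_simps(1))
qed

lemma \<Phi>_glued: "\<Phi> ` carrier R \<subseteq> glued"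
  using \<Phi>_image P1 P2 glue unfolding glued_along_def by auto

lemma glued_root_closed: "root_closed (W\<lparr>carrier := glued\<rparr>)"
  unfolding root_closed_def
proof (intro allI impI)
  let ?T = "W\<lparr>carrier := glued\<rparr>"
  fix p assume p: "monic_poly ?T p" "deg ?T p > 0"
  note pc = monic_polyD(1)[OF p(1)]
  note pr = proj_hom[OF glued_subring]
  have "\<forall>P\<in>I. \<exists>a\<in>carrier (S P). upeval ?T (S P) (\<lambda>x. x P) a p = \<zero>\<^bsub>S P\<^esub>"
    using factor_root[OF glued_subring \<Phi>_glued p] by blast
  then obtain a where a: "\<And>P. P \<in> I \<Longrightarrow> a P \<in> carrier (S P)"
    "\<And>P. P \<in> I \<Longrightarrow> upeval ?T (S P) (\<lambda>x. x P) (a P) p = \<zero>\<^bsub>S P\<^esub>" by metis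
  interpret D2: "domain" "S P2" by (rule dom[OF P2])
  let ?p2 = "upmap (\<lambda>x. x P2) p"
  \<comment> \<open>The image in \<open>k\<close> of the root chosen at \<open>P1\<close>; the root
    at \<open>P2\<close> must have the same image.\<close>
  let ?t = "\<theta>1 (a P1)"
  have t: "?t \<in> carrier k" using a(1)[OF P1] by simp
  have "upeval (S P2) k \<theta>2 ?t ?p2 = upeval ?T k (\<theta>2 \<circ> (\<lambda>x. x P2)) ?t p"
    by (rule eval_upmap[OF pr[OF P2] \<theta>2 pc t])
  \<comment> \<open>The coefficients of \<open>p\<close> are glued, so both routes from
    \<open>?T\<close> to \<open>k\<close> give the same polynomial.\<close>
  also have "\<dots> = upeval ?T k (\<theta>1 \<circ> (\<lambda>x. x P1)) ?t p"
    by (rule eval_cong[OF ring_hom_cring_trans[OF pr[OF P2] \<theta>2] ring_hom_cring_trans[OF pr[OF P1] \<theta>1] _ pc t])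
      (simp add: glued_along_def)
  also have "\<dots> = \<theta>1 (upeval ?T (S P1) (\<lambda>x. x P1) (a P1) p)"
    by (rule hom_eval[OF pr[OF P1] \<theta>1 pc a(1)[OF P1], symmetric])
  finally have "upeval (S P2) k \<theta>2 ?t ?p2 = \<zero>\<^bsub>k\<^esub>" unfolding a(2)[OF P1] by simp
  then obtain b where b: "b \<in> carrier (S P2)" "?t = \<theta>2 b" "upeval (S P2) (S P2) id b ?p2 = \<zero>\<^bsub>S P2\<^esub>"
    using root_lift[OF S_ai_closed[OF P2] \<theta>2 k monic_upmap(1)[OF pr[OF P2] D2.one_not_zero p(1)] t] by metis
  have id2: "ring_hom_cring (S P2) (S P2) id" by unfold_locales (simp add: ring_hom_def)
  have b0: "upeval ?T (S P2) (\<lambda>x. x P2) b p = \<zero>\<^bsub>S P2\<^esub>"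
    using b(3) eval_upmap[OF pr[OF P2] id2 pc b(1)] by (simp add: comp_def)
  \<comment> \<open>Only the component at \<open>P2\<close> is replaced, which leaves the roots
    elsewhere unchanged.\<close>
  define c where "c = (\<lambda>P\<in>I. if P = P2 then b else a P)"
  have "c \<in> carrier W" unfolding c_def using a(1) b(1) by auto
  then have cT: "c \<in> glued" unfolding glued_along_def using P1 P2 P12 b(2) by (simp add: c_def)
  have "upeval ?T ?T id c p = \<zero>\<^bsub>?T\<^esub>"
    by (rule root_of_roots[OF glued_subring \<Phi>_glued pc cT]) (use a(2) b0 in \<open>simp add: c_def\<close>)
  then show "\<exists>a\<in>carrier ?T. upeval ?T ?T id a p = \<zero>\<^bsub>?T\<^esub>" using cT by auto
qed

text \<open>Any map over \<open>R\<close> kills the idempotent \<open>e\<close> supported at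
  \<open>P1\<close>. Its image vanishes away from \<open>P1\<close> because elements of
  \<open>P1\<close> annihilate \<open>e\<close>; at \<open>P1\<close> it is zero or one, and gluing
  with the vanishing component at \<open>P2\<close> excludes one.\<close>

lemma not_embeds_glued:
  assumes h: "ring_hom_cring W (W\<lparr>carrier := glued\<rparr>) h" and h\<Phi>: "\<And>r. r \<in> carrier R \<Longrightarrow> h (\<Phi> r) = \<Phi> r"
  shows "\<not> inj_on h (carrier W)"
proof
  assume inj: "inj_on h (carrier W)"
  let ?T = "W\<lparr>carrier := glued\<rparr>"
  interpret h: ring_hom_cring W ?T h by (rule h)
  interpret D1: "domain" "S P1" by (rule dom[OF P1])
  interpret K: "domain" k by (rule k)
  define e where "e = (\<lambda>P\<in>I. if P = P1 then \<one>\<^bsub>S P\<^esub> else \<zero>\<^bsub>S P\<^esub>)"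
  have cS: "\<one>\<^bsub>S P\<^esub> \<in> carrier (S P)" "\<zero>\<^bsub>S P\<^esub> \<in> carrier (S P)" if "P \<in> I" for P
    using cring.cring_simprules(2,6)[OF S_cring[OF that]] by auto
  have eW: "e \<in> carrier W" unfolding e_def using cS by auto
  have hg: "h e \<in> glued" using h.hom_closed[OF eW] by simp
  then have hW: "h e \<in> carrier W" and hglue: "\<theta>1 (h e P1) = \<theta>2 (h e P2)" unfolding glued_along_def by auto
  have z: "h e P = \<zero>\<^bsub>S P\<^esub>" if P: "P \<in> I" "P \<noteq> P1" for P
  proof -
    interpret D: "domain" "S P" by (rule dom[OF P(1)])
    \<comment> \<open>\<open>\<Phi> x\<close> annihilates \<open>e\<close>, hence also
      \<open>h e\<close> by linearity; at \<open>P\<close> its component is non-zero and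
      cancels.\<close>
    obtain x where x: "x \<in> P1" "x \<notin> P" using antichain[OF P1 P(1)] P(2) by blast
    have xc: "x \<in> carrier R" using ideal.Icarr[OF primeideal.axioms(1)[OF prime[OF P1]] x(1)] .
    have \<Phi>x: "\<Phi> x \<in> carrier W" using \<Phi>_image xc by blast
    have "\<Phi> x \<otimes>\<^bsub>W\<^esub> e = \<zero>\<^bsub>W\<^esub>"
    proof (rule W_eqI[OF W.m_closed[OF \<Phi>x eW] W.zero_closed])
      fix Q assume Q: "Q \<in> I"
      interpret Q: "domain" "S Q" by (rule dom[OF Q])
      have c: "\<phi> Q x \<in> carrier (S Q)" using ring_hom_closed[OF ring_hom_cring.homh[OF hom[OF Q]] xc] .
      show "(\<Phi> x \<otimes>\<^bsub>W\<^esub> e) Q = \<zero>\<^bsub>W\<^esub> Q"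
        using Q c ker[OF Q xc] x(1) by (cases "Q = P1") (auto simp: e_def)
    qed
    then have "\<Phi> x \<otimes>\<^bsub>W\<^esub> h e = \<zero>\<^bsub>W\<^esub>"
      using h.hom_mult[OF \<Phi>x eW] h\<Phi>[OF xc] h.hom_zero by simp
    from fun_cong[OF this, of P] have "\<phi> P x \<otimes>\<^bsub>S P\<^esub> h e P = \<zero>\<^bsub>S P\<^esub>" using P(1) by simp
    moreover have "\<phi> P x \<noteq> \<zero>\<^bsub>S P\<^esub>" using ker[OF P(1) xc] x(2) by blast
    ultimately show ?thesis
      using D.integral[OF _ ring_hom_closed[OF ring_hom_cring.homh[OF hom[OF P(1)]] xc] W_at[OF hW P(1)]] by blast
  qed
  have "e \<otimes>\<^bsub>W\<^esub> e = e"
    by (rule W_eqI[OF W.m_closed[OF eW eW] eW]) (use cring.cring_simprules(12,26)[OF S_cring] cS in \<open>auto simp: e_def\<close>)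
  then have "h e \<otimes>\<^bsub>?T\<^esub> h e = h e" using h.hom_mult[OF eW eW] by simp
  then have "(h e \<otimes>\<^bsub>W\<^esub> h e) P1 = h e P1" by simp
  then have idem: "h e P1 \<otimes>\<^bsub>S P1\<^esub> h e P1 = h e P1" using P1 by simp
  note c1 = W_at[OF hW P1]
  have "h e P1 \<otimes>\<^bsub>S P1\<^esub> (h e P1 \<ominus>\<^bsub>S P1\<^esub> \<one>\<^bsub>S P1\<^esub>) = \<zero>\<^bsub>S P1\<^esub>"
    using c1 idem by (simp add: t1.R.minus_eq t1.R.r_distr t1.R.r_minus t1.R.r_neg)
  then have "h e P1 = \<zero>\<^bsub>S P1\<^esub> \<or> h e P1 = \<one>\<^bsub>S P1\<^esub>"
    using D1.integral[OF _ c1 t1.R.minus_closed[OF c1 t1.R.one_closed]] t1.R.minus_eq_zero_iff[OF c1 t1.R.one_closed] by blast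
  moreover have "\<theta>1 (h e P1) = \<zero>\<^bsub>k\<^esub>" using hglue z[OF P2] P12 by simp
  ultimately have "h e P1 = \<zero>\<^bsub>S P1\<^esub>" using K.one_not_zero t1.hom_one by metis
  then have "h e = \<zero>\<^bsub>W\<^esub>" using z by (intro W_eqI[OF hW W.zero_closed]) (metis W_simps(5))
  then have "h e = h \<zero>\<^bsub>W\<^esub>" using h.hom_zero by simp
  then have "e = \<zero>\<^bsub>W\<^esub>" using inj_onD[OF inj _ eW W.zero_closed] by blast
  then have "e P1 = \<zero>\<^bsub>S P1\<^esub>" using P1 by simp
  then show False using P1 by (simp add: e_def)
qed

end

end

section \<open>Products of domains\<close>

lemma exists_prime_family:
  fixes R :: "('a, 'm) ring_scheme"
  assumes "cring R" and "finite I" and prime: "\<And>P. P \<in> I \<Longrightarrow> primeideal P R"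
    and "\<And>r. r \<in> carrier R \<Longrightarrow> (\<And>P. P \<in> I \<Longrightarrow> r \<in> P) \<Longrightarrow> r = \<zero>\<^bsub>R\<^esub>"
    and "\<And>P Q. P \<in> I \<Longrightarrow> Q \<in> I \<Longrightarrow> P \<subseteq> Q \<Longrightarrow> P = Q"
    and inf: "infinite (UNIV :: 'b set)" and R: "carrier R \<lesssim> (UNIV :: 'b set)"
  obtains S :: "'a set \<Rightarrow> 'b ring" and \<phi> where "prime_family R I S \<phi>"
proof -
  have "\<forall>P\<in>I. \<exists>(S :: 'b ring) \<phi>. ring_hom_cring R S \<phi> \<and> domain S \<and> root_closed S \<and> integral_over R S \<phi> \<and>
      (\<forall>r\<in>carrier R. \<phi> r = \<zero>\<^bsub>S\<^esub> \<longleftrightarrow> r \<in> P)"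
    using exists_residue_closure[OF inf R prime] by metis
  then obtain S :: "'a set \<Rightarrow> 'b ring" and \<phi> where
    S: "\<And>P. P \<in> I \<Longrightarrow> ring_hom_cring R (S P) (\<phi> P) \<and> domain (S P) \<and> root_closed (S P) \<and>
      integral_over R (S P) (\<phi> P) \<and> (\<forall>r\<in>carrier R. \<phi> P r = \<zero>\<^bsub>S P\<^esub> \<longleftrightarrow> r \<in> P)"
    by metis
  have "prime_family R I S \<phi>"
    by (intro prime_family.intro prime_family_axioms.intro) (use assms S in blast)+
  then show thesis by (rule that)
qed

lemma (in prime_family) comaximal_if_unique:
  assumes inf: "infinite (UNIV :: 'b set)" and R: "carrier R \<lesssim> (UNIV :: 'b set)"
    and unique: "aic_exists_uniquely TYPE('b) R"
  shows "comaximal R I"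
proof (rule comaximal_if_pairwise[OF R.is_cring finite prime])
  fix P1 P2 assume P1: "P1 \<in> I" and P2: "P2 \<in> I" and P12: "P1 \<noteq> P2"
  interpret p1: primeideal P1 R by (rule prime[OF P1])
  interpret p2: primeideal P2 R by (rule prime[OF P2])
  show "\<one> \<in> P1 <+>\<^bsub>R\<^esub> P2"
  proof (rule ccontr)
    assume n: "\<one> \<notin> P1 <+>\<^bsub>R\<^esub> P2"
    have "ideal (P1 <+>\<^bsub>R\<^esub> P2) R" by (rule R.add_ideals) unfold_locales
    \<comment> \<open>The prime \<open>M\<close> is where the two components meet; its residue
      domain provides the ring \<open>k\<close> for gluing.\<close>
    then obtain M where M: "primeideal M R" "P1 <+>\<^bsub>R\<^esub> P2 \<subseteq> M" using R.exists_prime_above n by metis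
    have P1M: "r \<in> M" if r: "r \<in> P1" for r
    proof -
      have "r \<oplus> \<zero> \<in> P1 <+>\<^bsub>R\<^esub> P2" using r p2.zero_closed unfolding set_add_def' by blast
      then show ?thesis using M(2) p1.Icarr[OF r] by auto
    qed
    have P2M: "r \<in> M" if r: "r \<in> P2" for r
    proof -
      have "\<zero> \<oplus> r \<in> P1 <+>\<^bsub>R\<^esub> P2" using r p1.zero_closed unfolding set_add_def' by blast
      then show ?thesis using M(2) p2.Icarr[OF r] by auto
    qed
    obtain k :: "'b ring" and \<psi> where k: "ring_hom_cring R k \<psi>" "domain k" "root_closed k"
      "\<And>r. r \<in> carrier R \<Longrightarrow> \<psi> r = \<zero>\<^bsub>k\<^esub> \<longleftrightarrow> r \<in> M"
      using exists_residue_closure[OF inf R M(1)] by metis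
    have kac: "ai_closed k" using root_closed_imp_ai_closed[OF _ k(3)] k(2) unfolding domain_def by blast
    obtain \<theta>1 where t1: "ring_hom_cring (S P1) k \<theta>1" "\<And>r. r \<in> carrier R \<Longrightarrow> \<theta>1 (\<phi> P1 r) = \<psi> r"
    proof (rule exists_hom_into_ai_closed[OF hom[OF P1] k(1) int[OF P1] k(2) kac])
      show "\<psi> r = \<zero>\<^bsub>k\<^esub>" if "r \<in> carrier R" "\<phi> P1 r = \<zero>\<^bsub>S P1\<^esub>" for r
        using that k(4)[OF that(1)] ker[OF P1 that(1)] P1M by blast
    qed blast
    obtain \<theta>2 where t2: "ring_hom_cring (S P2) k \<theta>2" "\<And>r. r \<in> carrier R \<Longrightarrow> \<theta>2 (\<phi> P2 r) = \<psi> r"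
    proof (rule exists_hom_into_ai_closed[OF hom[OF P2] k(1) int[OF P2] k(2) kac])
      show "\<psi> r = \<zero>\<^bsub>k\<^esub>" if "r \<in> carrier R" "\<phi> P2 r = \<zero>\<^bsub>S P2\<^esub>" for r
        using that k(4)[OF that(1)] ker[OF P2 that(1)] P2M by blast
    qed blast
    have gl: "\<theta>1 (\<phi> P1 r) = \<theta>2 (\<phi> P2 r)" if "r \<in> carrier R" for r using t1(2) t2(2) that by simp
    note G = P1 P2 P12 k(2) t1(1) t2(1) gl
    let ?G = "glued_along P1 P2 \<theta>1 \<theta>2"
    let ?T = "W\<lparr>carrier := ?G\<rparr>"
    have sG: "subring ?G W" and \<Phi>G: "\<Phi> ` carrier R \<subseteq> ?G" and rG: "root_closed ?T"
      by (rule glued_subring[OF G] \<Phi>_glued[OF G] glued_root_closed[OF G]; assumption)+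
    interpret W: cring W by (rule W_cring)
    have WW: "W\<lparr>carrier := carrier W\<rparr> = W" by simp
    obtain Y :: "'b ring" and h h' where Y: "ring_iso_pair W Y h h'" "is_aic R Y (h \<circ> \<Phi>)"
      using exists_aic[OF inf W.carrier_is_subring \<Phi>_image, unfolded WW, OF W_root_closed] by blast
    obtain Z :: "'b ring" and g g' where Z: "ring_iso_pair ?T Z g g'" "is_aic R Z (g \<circ> \<Phi>)"
      using exists_aic[OF inf sG \<Phi>G rG] by blast
    obtain f where f: "f \<in> ring_iso Y Z" "\<And>r. r \<in> carrier R \<Longrightarrow> f (h (\<Phi> r)) = g (\<Phi> r)"
      using unique Y(2) Z(2) unfolding aic_exists_uniquely_def algebra_isomorphic_def by fastforce
    have h: "ring_hom_cring W Y h" and h': "\<And>x. x \<in> carrier W \<Longrightarrow> h' (h x) = x"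
      using Y(1) unfolding ring_iso_pair_def by auto
    have g': "ring_hom_cring Z ?T g'" and gg': "\<And>x. x \<in> carrier Z \<Longrightarrow> g (g' x) = x"
      and g'g: "\<And>x. x \<in> carrier ?T \<Longrightarrow> g' (g x) = x"
      using Z(1) unfolding ring_iso_pair_def by auto
    interpret h: ring_hom_cring W Y h by (rule h)
    interpret g': ring_hom_cring Z ?T g' by (rule g')
    have fh: "ring_hom_cring Y Z f"
      by (rule UnivPoly.ring_hom_cringI[OF h.S.is_cring g'.R.is_cring]) (use f(1) in \<open>simp add: ring_iso_def\<close>)
    \<comment> \<open>The isomorphism between the two copies in \<open>'b\<close>, read back as a
      map from \<open>W\<close> to the glued ring over \<open>R\<close>.\<close>
    let ?H = "g' \<circ> (f \<circ> h)"
    have H: "ring_hom_cring W ?T ?H" by (intro ring_hom_cring_trans[OF ring_hom_cring_trans[OF h fh] g'])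
    have H\<Phi>: "?H (\<Phi> r) = \<Phi> r" if r: "r \<in> carrier R" for r
      using f(2)[OF r] g'g[of "\<Phi> r"] \<Phi>G r by auto
    have "\<not> inj_on ?H (carrier W)" by (rule not_embeds_glued[OF G H H\<Phi>])
    moreover have "inj_on ?H (carrier W)"
    proof (intro comp_inj_on)
      show "inj_on h (carrier W)" using h' by (rule inj_on_inverseI)
      have "inj_on f (carrier Y)" and fY: "f ` carrier Y = carrier Z" using f(1) unfolding ring_iso_def bij_betw_def by auto
      show "inj_on f (h ` carrier W)" by (rule inj_on_subset[OF \<open>inj_on f (carrier Y)\<close>]) auto
      have "inj_on g' (carrier Z)" using gg' by (intro inj_on_inverseI[where g = g]) blast
      moreover have "(f \<circ> h) ` carrier W \<subseteq> carrier Z" using fY by auto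
      ultimately show "inj_on g' ((f \<circ> h) ` carrier W)" by (rule inj_on_subset)
    qed
    ultimately show False by blast
  qed
qed

section \<open>Coordinates in finite direct products and comaximal primes\<close>

lemma RDirProd_list_nth:
  assumes "xs \<in> carrier (RDirProd_list Rs)" and "ys \<in> carrier (RDirProd_list Rs)" and "i < length Rs"
  shows "(xs \<otimes>\<^bsub>RDirProd_list Rs\<^esub> ys) ! i = xs ! i \<otimes>\<^bsub>Rs ! i\<^esub> ys ! i"
    and "(xs \<oplus>\<^bsub>RDirProd_list Rs\<^esub> ys) ! i = xs ! i \<oplus>\<^bsub>Rs ! i\<^esub> ys ! i"
proof -
  have "(xs \<otimes>\<^bsub>RDirProd_list Rs\<^esub> ys) ! i = xs ! i \<otimes>\<^bsub>Rs ! i\<^esub> ys ! i \<and>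
    (xs \<oplus>\<^bsub>RDirProd_list Rs\<^esub> ys) ! i = xs ! i \<oplus>\<^bsub>Rs ! i\<^esub> ys ! i"
    using assms
  proof (induct Rs arbitrary: xs ys i)
    case (Cons R Rs)
    let ?D = "RDirProd R (RDirProd_list Rs)"
    obtain x xs' y ys' where x: "xs = x # xs'" "x \<in> carrier R" "xs' \<in> carrier (RDirProd_list Rs)"
      and y: "ys = y # ys'" "y \<in> carrier R" "ys' \<in> carrier (RDirProd_list Rs)"
      using Cons(2,3) unfolding RDirProd_list_carrier by auto
    have c: "(x, xs') \<in> carrier ?D" "(y, ys') \<in> carrier ?D" using x y by (simp_all add: RDirProd_carrier)
    have "xs \<otimes>\<^bsub>RDirProd_list (R # Rs)\<^esub> ys = (x \<otimes>\<^bsub>R\<^esub> y) # (xs' \<otimes>\<^bsub>RDirProd_list Rs\<^esub> ys')"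
      using ring_hom_mult[OF RDirProd_list_hom1 c] x y by (simp add: RDirProd_simps)
    moreover have "xs \<oplus>\<^bsub>RDirProd_list (R # Rs)\<^esub> ys = (x \<oplus>\<^bsub>R\<^esub> y) # (xs' \<oplus>\<^bsub>RDirProd_list Rs\<^esub> ys')"
      using ring_hom_add[OF RDirProd_list_hom1 c] x y by (simp add: RDirProd_simps)
    ultimately show ?case using Cons(1)[OF x(3) y(3)] Cons(4) x(1) y(1) by (cases i) auto
  qed simp
  then show "(xs \<otimes>\<^bsub>RDirProd_list Rs\<^esub> ys) ! i = xs ! i \<otimes>\<^bsub>Rs ! i\<^esub> ys ! i"
    and "(xs \<oplus>\<^bsub>RDirProd_list Rs\<^esub> ys) ! i = xs ! i \<oplus>\<^bsub>Rs ! i\<^esub> ys ! i" by auto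
qed

lemma RDirProd_list_one_zero:
  "\<one>\<^bsub>RDirProd_list Rs\<^esub> = map one Rs" "\<zero>\<^bsub>RDirProd_list Rs\<^esub> = map zero Rs"
  unfolding RDirProd_list_one RDirProd_list_zero by (induct Rs) auto

text \<open>The primes are the kernels of the coordinate projections, and preimages of the unit
  vectors witness comaximality.\<close>

lemma finite_product_imp_comaximal:
  assumes "cring R" and "finite_product_of_domains R"
  obtains I where "finite I" and "\<And>P. P \<in> I \<Longrightarrow> primeideal P R"
    and "\<And>r. r \<in> carrier R \<Longrightarrow> (\<And>P. P \<in> I \<Longrightarrow> r \<in> P) \<Longrightarrow> r = \<zero>\<^bsub>R\<^esub>" and "comaximal R I"
proof -
  interpret R: cring R by fact
  obtain Ds :: "'a ring list" and h where dom: "\<And>D. D \<in> set Ds \<Longrightarrow> domain D" and h: "h \<in> ring_iso R (RDirProd_list Ds)"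
    using assms(2) unfolding finite_product_of_domains_def is_ring_iso_def by blast
  let ?L = "RDirProd_list Ds"
  let ?n = "length Ds"
  note h' = ring_iso_memE[OF h]
  define \<pi> where "\<pi> i r = h r ! i" for i r
  have D: "domain (Ds ! i)" if "i < ?n" for i using dom that by simp
  have Dz: "\<zero>\<^bsub>Ds ! i\<^esub> \<in> carrier (Ds ! i)" and Do: "\<one>\<^bsub>Ds ! i\<^esub> \<in> carrier (Ds ! i)" if i: "i < ?n" for i
  proof -
    interpret D: "domain" "Ds ! i" by (rule D[OF i])
    show "\<zero>\<^bsub>Ds ! i\<^esub> \<in> carrier (Ds ! i)" "\<one>\<^bsub>Ds ! i\<^esub> \<in> carrier (Ds ! i)" by simp_all
  qed
  have \<pi>: "ring_hom_cring R (Ds ! i) (\<pi> i)" if i: "i < ?n" for i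
  proof -
    interpret D: "domain" "Ds ! i" by (rule D[OF i])
    have "\<pi> i \<in> ring_hom R (Ds ! i)"
    proof (rule ring_hom_memI)
      show "\<pi> i \<one>\<^bsub>R\<^esub> = \<one>\<^bsub>Ds ! i\<^esub>" unfolding \<pi>_def h'(4) RDirProd_list_one_zero using i by simp
      fix x y assume xy: "x \<in> carrier R" "y \<in> carrier R"
      show "\<pi> i x \<in> carrier (Ds ! i)" unfolding \<pi>_def by (rule RDirProd_list_carrier_mem(2)[OF h'(1)[OF xy(1)] i])
      show "\<pi> i (x \<otimes>\<^bsub>R\<^esub> y) = \<pi> i x \<otimes>\<^bsub>Ds ! i\<^esub> \<pi> i y"
        unfolding \<pi>_def h'(2)[OF xy] by (rule RDirProd_list_nth(1)[OF h'(1)[OF xy(1)] h'(1)[OF xy(2)] i])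
      show "\<pi> i (x \<oplus>\<^bsub>R\<^esub> y) = \<pi> i x \<oplus>\<^bsub>Ds ! i\<^esub> \<pi> i y"
        unfolding \<pi>_def h'(3)[OF xy] by (rule RDirProd_list_nth(2)[OF h'(1)[OF xy(1)] h'(1)[OF xy(2)] i])
    qed
    then show ?thesis by (rule UnivPoly.ring_hom_cringI[OF R.is_cring D.is_cring])
  qed
  define K where "K i = {r \<in> carrier R. \<pi> i r = \<zero>\<^bsub>Ds ! i\<^esub>}" for i
  have L0: "\<zero>\<^bsub>?L\<^esub> \<in> carrier ?L"
    unfolding RDirProd_list_one_zero
    by (rule RDirProd_list_carrier_memI) (use Dz in auto)
  have h0: "h \<zero>\<^bsub>R\<^esub> = \<zero>\<^bsub>?L\<^esub>"
  proof (rule nth_equalityI)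
    show len: "length (h \<zero>\<^bsub>R\<^esub>) = length \<zero>\<^bsub>?L\<^esub>"
      using RDirProd_list_carrier_mem(1)[OF h'(1)[OF R.zero_closed]] unfolding RDirProd_list_one_zero by simp
    fix i assume "i < length (h \<zero>\<^bsub>R\<^esub>)"
    then have i: "i < ?n" using len unfolding RDirProd_list_one_zero by simp
    interpret p: ring_hom_cring R "Ds ! i" "\<pi> i" by (rule \<pi>[OF i])
    show "h \<zero>\<^bsub>R\<^esub> ! i = \<zero>\<^bsub>?L\<^esub> ! i" using p.hom_zero i unfolding \<pi>_def RDirProd_list_one_zero by simp
  qed
  show thesis
  proof (rule that[of "K ` {..<?n}"])
    show "primeideal P R" if "P \<in> K ` {..<?n}" for P
      using that kernel_primeideal[OF \<pi> D] unfolding K_def by auto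
    show "r = \<zero>\<^bsub>R\<^esub>" if r: "r \<in> carrier R" "\<And>P. P \<in> K ` {..<?n} \<Longrightarrow> r \<in> P" for r
    proof -
      have z: "h r ! i = \<zero>\<^bsub>Ds ! i\<^esub>" if "i < ?n" for i using r(2)[of "K i"] that unfolding K_def \<pi>_def by auto
      have "h r = \<zero>\<^bsub>?L\<^esub>" unfolding RDirProd_list_one_zero
        by (rule nth_equalityI) (use RDirProd_list_carrier_mem(1)[OF h'(1)[OF r(1)]] z in auto)
      then have "h r = h \<zero>\<^bsub>R\<^esub>" using h0 by simp
      then show ?thesis using h'(5) r(1) R.zero_closed unfolding bij_betw_def inj_on_def by blast
    qed
    show "comaximal R (K ` {..<?n})" unfolding comaximal_def
    proof
      fix P assume "P \<in> K ` {..<?n}"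
      then obtain i where i: "i < ?n" "P = K i" by blast
      \<comment> \<open>The unit vector with one in position \<open>i\<close>: one modulo
        \<open>K i\<close>, and zero in every other coordinate.\<close>
      define e where "e = (map zero Ds)[i := \<one>\<^bsub>Ds ! i\<^esub>]"
      have "e \<in> carrier ?L"
        by (rule RDirProd_list_carrier_memI)
          (use Dz Do i in \<open>auto simp: e_def nth_list_update\<close>)
      then have "e \<in> h ` carrier R" using h'(5) unfolding bij_betw_def by simp
      then obtain x where x: "x \<in> carrier R" "h x = e" by blast
      have "\<one>\<^bsub>R\<^esub> \<ominus>\<^bsub>R\<^esub> x \<in> K i"
      proof -
        interpret p: ring_hom_cring R "Ds ! i" "\<pi> i" by (rule \<pi>[OF i(1)])
        have "\<pi> i x = \<one>\<^bsub>Ds ! i\<^esub>" using i x(2) by (simp add: \<pi>_def e_def)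
        then have "\<pi> i (\<one>\<^bsub>R\<^esub> \<ominus>\<^bsub>R\<^esub> x) = \<zero>\<^bsub>Ds ! i\<^esub>" using x(1) by (simp add: R.minus_eq p.S.r_neg)
        then show ?thesis using x(1) unfolding K_def by simp
      qed
      moreover have "x \<in> Q" if Q: "Q \<in> K ` {..<?n}" "Q \<noteq> P" for Q
      proof -
        obtain j where j: "j < ?n" "Q = K j" using Q by blast
        then have "j \<noteq> i" using Q(2) i(2) by blast
        then have "\<pi> j x = \<zero>\<^bsub>Ds ! j\<^esub>" using j x(2) by (simp add: \<pi>_def e_def)
        then show ?thesis using x(1) j(2) unfolding K_def by simp
      qed
      ultimately show "\<exists>e\<in>carrier R. \<one>\<^bsub>R\<^esub> \<ominus>\<^bsub>R\<^esub> e \<in> P \<and> (\<forall>Q\<in>K ` {..<?n}. Q \<noteq> P \<longrightarrow> e \<in> Q)"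
        using x(1) i(2) by blast
    qed
  qed simp
qed

text \<open>The quotients by the primes are realised inside the carrier type of \<open>R\<close> by choosing a
  representative of each coset.\<close>

lemma comaximal_imp_finite_product:
  assumes "cring R" and fin: "finite I" and prime: "\<And>P. P \<in> I \<Longrightarrow> primeideal P R"
    and Inter: "\<And>r. r \<in> carrier R \<Longrightarrow> (\<And>P. P \<in> I \<Longrightarrow> r \<in> P) \<Longrightarrow> r = \<zero>\<^bsub>R\<^esub>" and com: "comaximal R I"
  shows "finite_product_of_domains R"
proof -
  interpret R: cring R by fact
  define f where "f P x = (SOME y. y \<in> P +>\<^bsub>R\<^esub> x)" for P x
  have weak: "weak_ring_morphism (f P) P R" if P: "P \<in> I" for P
  proof -
    interpret P: primeideal P R by (rule prime[OF P])
    show ?thesis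
    proof (rule weak_ring_morphismI[OF P.is_ideal])
      fix a b assume ab: "a \<in> carrier R" "b \<in> carrier R"
      have self: "f P x \<in> P +>\<^bsub>R\<^esub> x" if "x \<in> carrier R" for x
        unfolding f_def using P.a_rcos_self[OF that] by (rule someI)
      have rep: "P +>\<^bsub>R\<^esub> x = P +>\<^bsub>R\<^esub> f P x" if "x \<in> carrier R" for x
        using R.add.repr_independence[OF self[OF that, unfolded a_r_coset_def] that P.a_subgroup]
        unfolding a_r_coset_def .
      have "f P a = f P b \<longleftrightarrow> P +>\<^bsub>R\<^esub> a = P +>\<^bsub>R\<^esub> b"
      proof
        assume "f P a = f P b" then show "P +>\<^bsub>R\<^esub> a = P +>\<^bsub>R\<^esub> b" using rep ab by metis
      qed (simp add: f_def)
      then show "f P a = f P b \<longleftrightarrow> a \<ominus>\<^bsub>R\<^esub> b \<in> P"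
        using R.quotient_eq_iff_same_a_r_cos[OF P.is_ideal ab] by simp
    qed
  qed
  define D where "D P = image_ring (f P) R" for P
  have D: "domain (D P)" if P: "P \<in> I" for P
  proof -
    interpret P: primeideal P R by (rule prime[OF P])
    show ?thesis
      using domain.ring_iso_imp_img_domain[OF P.quotient_is_domain R.weak_ring_morphism_is_iso[OF weak[OF P]]]
      unfolding R.image_ring_zero'[OF weak[OF P]] D_def by simp
  qed
  have fh: "f P \<in> ring_hom R (D P)" if "P \<in> I" for P
    unfolding D_def by (rule R.weak_ring_morphism_is_hom[OF weak[OF that]])
  obtain Ps where Ps: "set Ps = I" "distinct Ps" using finite_distinct_list[OF fin] by blast
  have PsI: "i < length Ps \<Longrightarrow> Ps ! i \<in> I" for i using Ps nth_mem by blast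
  let ?L = "RDirProd_list (map D Ps)"
  define F where "F x = map (\<lambda>P. f P x) Ps" for x
  have Fc: "F x \<in> carrier ?L" if "x \<in> carrier R" for x
    by (rule RDirProd_list_carrier_memI) (use ring_hom_closed[OF fh that] PsI in \<open>auto simp: F_def\<close>)
  interpret L: ring ?L
    by (rule RDirProd_list_is_ring) (use D PsI in \<open>auto simp: domain_def cring_def\<close>)
  have eqI: "xs = ys" if xs: "xs \<in> carrier ?L" and ys: "ys \<in> carrier ?L"
    and e: "\<And>i. i < length Ps \<Longrightarrow> xs ! i = ys ! i" for xs ys
    by (rule nth_equalityI) (use RDirProd_list_carrier_mem(1)[OF xs] RDirProd_list_carrier_mem(1)[OF ys] e in auto)
  have Fh: "F \<in> ring_hom R ?L"
  proof (rule ring_hom_memI)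
    show "F \<one>\<^bsub>R\<^esub> = \<one>\<^bsub>?L\<^esub>"
      unfolding RDirProd_list_one_zero F_def using ring_hom_one[OF fh] Ps by simp
    fix x y assume xy: "x \<in> carrier R" "y \<in> carrier R"
    show "F x \<in> carrier ?L" by (rule Fc[OF xy(1)])
    show "F (x \<otimes>\<^bsub>R\<^esub> y) = F x \<otimes>\<^bsub>?L\<^esub> F y"
    proof (rule eqI[OF Fc L.m_closed[OF Fc Fc]])
      fix i assume i: "i < length Ps"
      show "F (x \<otimes>\<^bsub>R\<^esub> y) ! i = (F x \<otimes>\<^bsub>?L\<^esub> F y) ! i"
        using RDirProd_list_nth(1)[OF Fc[OF xy(1)] Fc[OF xy(2)], of i] ring_hom_mult[OF fh[OF PsI[OF i]] xy] i
        by (simp add: F_def)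
    qed (use xy in simp_all)
    show "F (x \<oplus>\<^bsub>R\<^esub> y) = F x \<oplus>\<^bsub>?L\<^esub> F y"
    proof (rule eqI[OF Fc L.a_closed[OF Fc Fc]])
      fix i assume i: "i < length Ps"
      show "F (x \<oplus>\<^bsub>R\<^esub> y) ! i = (F x \<oplus>\<^bsub>?L\<^esub> F y) ! i"
        using RDirProd_list_nth(2)[OF Fc[OF xy(1)] Fc[OF xy(2)], of i] ring_hom_add[OF fh[OF PsI[OF i]] xy] i
        by (simp add: F_def)
    qed (use xy in simp_all)
  qed
  have inj: "inj_on F (carrier R)"
  proof (rule inj_onI)
    fix x y assume xy: "x \<in> carrier R" "y \<in> carrier R" and e: "F x = F y"
    have "x \<ominus>\<^bsub>R\<^esub> y = \<zero>\<^bsub>R\<^esub>"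
    proof (rule Inter)
      fix P assume P: "P \<in> I"
      then have "f P x = f P y" using e Ps unfolding F_def by simp
      then show "x \<ominus>\<^bsub>R\<^esub> y \<in> P" using weak_ring_morphism.inj_mod_ideal[OF weak[OF P] xy] by blast
    qed (use xy in simp)
    then show "x = y" using R.minus_eq_zero_iff[OF xy] by blast
  qed
  have "xs \<in> F ` carrier R" if xs: "xs \<in> carrier ?L" for xs
  proof -
    obtain e where e: "\<And>P. P \<in> I \<Longrightarrow> e P \<in> carrier R" "\<And>P. P \<in> I \<Longrightarrow> \<one>\<^bsub>R\<^esub> \<ominus>\<^bsub>R\<^esub> e P \<in> P"
      "\<And>P Q. P \<in> I \<Longrightarrow> Q \<in> I \<Longrightarrow> Q \<noteq> P \<Longrightarrow> e P \<in> Q"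
      using com unfolding comaximal_def by metis
    have at: "xs ! i \<in> f (Ps ! i) ` carrier R" if "i < length Ps" for i
      using RDirProd_list_carrier_mem(2)[OF xs, of i] that unfolding D_def by (simp add: image_ring_carrier)
    then have "\<forall>i<length Ps. \<exists>x\<in>carrier R. xs ! i = f (Ps ! i) x" by blast
    then obtain x where x: "\<And>i. i < length Ps \<Longrightarrow> x i \<in> carrier R" "\<And>i. i < length Ps \<Longrightarrow> xs ! i = f (Ps ! i) (x i)"
      by metis
    \<comment> \<open>The Chinese remainder theorem is indexed by positions here;
      \<open>distinct Ps\<close> makes different positions give different primes.\<close>
    obtain y where y: "y \<in> carrier R" "\<And>i. i < length Ps \<Longrightarrow> y \<ominus>\<^bsub>R\<^esub> x i \<in> Ps ! i"
    proof (rule R.chinese_remainder_idempotents[of "{..<length Ps}" "\<lambda>i. Ps ! i" "\<lambda>i. e (Ps ! i)" x])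
      fix i assume "i \<in> {..<length Ps}"
      then have i: "i < length Ps" by simp
      note PsI[OF i]
      then show "ideal (Ps ! i) R" "e (Ps ! i) \<in> carrier R" "\<one>\<^bsub>R\<^esub> \<ominus>\<^bsub>R\<^esub> e (Ps ! i) \<in> Ps ! i" "x i \<in> carrier R"
        using primeideal.axioms(1)[OF prime] e(1,2) x(1)[OF i] by auto
      fix j assume "j \<in> {..<length Ps}" "i \<noteq> j"
      then have "j < length Ps" "Ps ! j \<noteq> Ps ! i" using i Ps(2) nth_eq_iff_index_eq by fastforce+
      then show "e (Ps ! i) \<in> Ps ! j" using e(3) PsI i by blast
    qed auto
    have "F y = xs"
    proof (rule eqI[OF Fc[OF y(1)] xs])
      fix i assume i: "i < length Ps"
      have "f (Ps ! i) y = f (Ps ! i) (x i)"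
        using weak_ring_morphism.inj_mod_ideal[OF weak[OF PsI[OF i]] y(1) x(1)[OF i]] y(2)[OF i] by blast
      then show "F y ! i = xs ! i" using x(2)[OF i] i by (simp add: F_def)
    qed
    then show ?thesis using y(1) by blast
  qed
  then have "F \<in> ring_iso R ?L" unfolding ring_iso_def bij_betw_def using Fh inj Fc by blast
  then show ?thesis
    unfolding finite_product_of_domains_def is_ring_iso_def using D Ps by (intro exI[of _ "map D Ps"]) auto
qed

theorem theorem2:
  fixes R :: "('a, 'm) ring_scheme"
  assumes "cring R" and "reduced_ring R" and "finite (min_primes R)"
    and "infinite (UNIV :: 'b set)" and "carrier R \<lesssim> (UNIV :: 'b set)"
  shows "aic_exists_uniquely TYPE('b) R \<longleftrightarrow> finite_product_of_domains R"
proof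
  assume u: "aic_exists_uniquely TYPE('b) R"
  have prime: "primeideal P R" if "P \<in> min_primes R" for P using that unfolding min_primes_def by blast
  have anti: "P = Q" if "P \<in> min_primes R" "Q \<in> min_primes R" "P \<subseteq> Q" for P Q
    using that unfolding min_primes_def by blast
  \<comment> \<open>Reducedness enters only here, to make the minimal primes intersect in
    zero.\<close>
  note Inter = reduced_Inter_min_primes[OF assms(1,2)]
  obtain S :: "'a set \<Rightarrow> 'b ring" and \<phi> where "prime_family R (min_primes R) S \<phi>"
    using exists_prime_family[OF assms(1,3) prime Inter anti assms(4,5)] by blast
  then have "comaximal R (min_primes R)" by (rule prime_family.comaximal_if_unique[OF _ assms(4,5) u])
  then show "finite_product_of_domains R"
    using comaximal_imp_finite_product[OF assms(1,3) prime Inter] by blast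
next
  assume "finite_product_of_domains R"
  then obtain I where I: "finite I" "\<And>P. P \<in> I \<Longrightarrow> primeideal P R"
    "\<And>r. r \<in> carrier R \<Longrightarrow> (\<And>P. P \<in> I \<Longrightarrow> r \<in> P) \<Longrightarrow> r = \<zero>\<^bsub>R\<^esub>" "comaximal R I"
    using finite_product_imp_comaximal[OF assms(1)] by metis
  \<comment> \<open>Here the primes come from the product decomposition, so incomparability is
    deduced from comaximality instead of minimality.\<close>
  note anti = comaximal_antichain[OF I(4,2)]
  obtain S :: "'a set \<Rightarrow> 'b ring" and \<phi> where "prime_family R I S \<phi>"
    using exists_prime_family[OF assms(1) I(1-3) anti assms(4,5)] by blast
  then show "aic_exists_uniquely TYPE('b) R" by (rule prime_family.unique_if_comaximal[OF _ assms(4) I(4)])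
qed

end
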